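(* Let $\Lambda\mathsf{Lie}_\infty\to\mathcal O\xrightarrow{F}\mathcal O'$ be a morphism of the under-category $\Lambda\mathsf{Lie}_\infty\downarrow\mathit{Operads}$ with $F$ being a quasi-isomorphism. Then the map $\mathrm{Tw}(F):\mathrm{Tw}\,\mathcal O\to\mathrm{Tw}\,\mathcal O'$ is also a quasi-isomorphism.
   Context: **Conventions.** $\mathbb K$ is a field of characteristic zero. A dg operad is a unital symmetric operad in unbounded cochain complexes over $\mathbb K$ (differentials of degree $+1$), with elementary insertions $\circ_i$; $\mathit{Operads}$ is the category of dg operads; quasi-isomorphisms are arity-wise. $\mathbf s$ raises degree by one. $\mathrm{Sh}_{p,q}\subset S_{p+q}$ is the set of $\sigma$ with $\sigma(1)<\dots<\sigma(p)$ and $\sigma(p+1)<\dots<\sigma(p+q)$. For $v\in\mathcal O(k)$, $w\in\mathcal O(m)$, an expression $v(i_1,\dots,w(j_1,\dots,j_m),\dots)$ in which each of $1,\dots,k+m-1$ occurs once denotes the operadic composite with inputs labelled as displayed. **$\Lambda\mathsf{Lie}_\infty$** is the dg operad free as a graded operad on $S_n$-invariant generators $\lambda_n$, arity $n\ge2$, degree $3-2n$, with $\partial\lambda_n=-\sum_{p=2}^{n-1}\sum_{\sigma\in\mathrm{Sh}_{p,n-p}}\sigma(\lambda_{n-p+1}\circ_1\lambda_p)$. Objects of the under-category are dg operad maps $\Lambda\mathsf{Lie}_\infty\to\mathcal O$; morphisms are commutative triangles. **$\mathrm{Tw}$.** Given $\hat\varphi:\Lambda\mathsf{Lie}_\infty\to\mathcal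 O$, put $\varphi_n=\hat\varphi(\lambda_n)$ for $n\ge2$, $\varphi_1=0$. $\mathrm{Tw}\,\mathcal O(n)=\prod_{r\ge0}\mathbf s^{2r}(\mathcal O(r+n))^{S_r}$, where $S_r\subset S_{r+n}$ permutes the first $r$ letters: a homogeneous $f$ is a sequence $(f_r)_{r\ge0}$ with $f_r\in\mathcal O(r+n)^{S_r}$ of degree $|f|-2r$. $S_n$ acts on the last $n$ inputs; the unit is $(u_{\mathcal O},0,0,\dots)$; for $f\in\mathrm{Tw}\,\mathcal O(n)$, $g\in\mathrm{Tw}\,\mathcal O(m)$, $$(f\circ_ig)_r=\sum_{p=0}^r\sum_{\sigma\in\mathrm{Sh}_{p,r-p}}f_p(\sigma(1),\dots,\sigma(p),r+1,\dots,r+i-1,g_{r-p}(\sigma(p+1),\dots,\sigma(r),r+i,\dots,r+i+m-1),r+i+m,\dots,r+n+m-1).$$ With $\kappa\in\mathrm{Tw}\,\mathcal O(1)$, $\kappa_r=\varphi_{r+1}$, the differential is $$(\partial^{\mathrm{Tw}}f)_r=\partial^{\mathcal O}f_r-(-1)^{|f|}\sum_{p=1}^r\sum_{\sigma\in\mathrm{Sh}_{p,r-p}}f_{r-p+1}(\varphi_p(\sigma(1),\dots,\sigma(p)),\sigma(p+1),\dots,\sigma(r),r+1,\dots,r+n)+(\kappa\circ_1f)_r-(-1)^{|f|}\sum_{i=1}^n(f\circ_i\kappa)_r.$$ For a morphism $F$ under $\Lambda\mathsf{Lie}_\infty$, $(\mathrm{Tw}\,F)(f)_r=F(f_r)$.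 *)

theory Defs
  imports Complex_Main "HOL-Library.Function_Algebras" "HOL-Combinatorics.Permutations"
begin

(*
  Conventions. The homogeneous parts O(n)^d of an operad O are subspaces of one ambient
  vector space over the field 'k (for instance of the direct sum of all of them); all
  elements are homogeneous. Permutations of {1..n} act from the left by relabelling:
  (act O n s v) is v with its j-th input labelled s(j), i.e. v(s(1),...,s(n)).
  (pcomp O n m i v w) is the insertion of w in O(m) into the i-th input of v in O(n).
*)

record ('k, 'a) goperad =
  scl :: "'k \<Rightarrow> 'a \<Rightarrow> 'a"
  part :: "nat \<Rightarrow> int \<Rightarrow> 'a set"
  act :: "nat \<Rightarrow> (nat \<Rightarrow> nat) \<Rightarrow> 'a \<Rightarrow> 'a"
  pcomp :: "nat \<Rightarrow> nat \<Rightarrow> nat \<Rightarrow> 'a \<Rightarrow> 'a \<Rightarrow> 'a"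
  unt :: 'a

(* The differential also takes the degree of its argument, since it may involve (-1)^degree. *)
record ('k, 'a) dgoperad = "('k, 'a) goperad" +
  dif :: "nat \<Rightarrow> int \<Rightarrow> 'a \<Rightarrow> 'a"

definition sgn_pow :: "int \<Rightarrow> 'a :: ab_group_add \<Rightarrow> 'a" where
  "sgn_pow k x = (if even k then x else - x)"

(* s acts on the inputs of v in O(n), t on those of w in O(m): the permutation by which
   (s v) o_{s(i)} (t w) differs from v o_i w. *)
definition block_perm :: "nat \<Rightarrow> nat \<Rightarrow> nat \<Rightarrow> (nat \<Rightarrow> nat) \<Rightarrow> (nat \<Rightarrow> nat) \<Rightarrow> nat \<Rightarrow> nat" where
  "block_perm n m i \<sigma> \<tau> j =
    (let shift = (\<lambda>l. if l < \<sigma> i then l else l + m - 1) in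
     if j < 1 \<or> n + m - 1 < j then j
     else if j < i then shift (\<sigma> j)
     else if j < i + m then \<sigma> i - 1 + \<tau> (j - i + 1)
     else shift (\<sigma> (j + 1 - m)))"

locale graded_operad = vector_space "scl P"
  for P :: "('k :: field_char_0, 'a :: ab_group_add, 'z) goperad_scheme" +
  assumes part_subspace: "subspace (part P n d)"
    and act_part: "\<sigma> permutes {1..n} \<Longrightarrow> x \<in> part P n d \<Longrightarrow> act P n \<sigma> x \<in> part P n d"
    and act_add: "\<sigma> permutes {1..n} \<Longrightarrow> x \<in> part P n d \<Longrightarrow> y \<in> part P n d \<Longrightarrow>
      act P n \<sigma> (x + y) = act P n \<sigma> x + act P n \<sigma> y"
    and act_scl: "\<sigma> permutes {1..n} \<Longrightarrow> x \<in> part P n d \<Longrightarrow>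
      act P n \<sigma> (scl P c x) = scl P c (act P n \<sigma> x)"
    and act_id: "x \<in> part P n d \<Longrightarrow> act P n id x = x"
    and act_comp: "\<sigma> permutes {1..n} \<Longrightarrow> \<tau> permutes {1..n} \<Longrightarrow> x \<in> part P n d \<Longrightarrow>
      act P n (\<sigma> \<circ> \<tau>) x = act P n \<sigma> (act P n \<tau> x)"
    and pcomp_part: "i \<in> {1..n} \<Longrightarrow> x \<in> part P n d \<Longrightarrow> y \<in> part P m e \<Longrightarrow>
      pcomp P n m i x y \<in> part P (n + m - 1) (d + e)"
    and pcomp_add_left: "i \<in> {1..n} \<Longrightarrow> x \<in> part P n d \<Longrightarrow> x' \<in> part P n d \<Longrightarrow> y \<in> part P m e \<Longrightarrow>
      pcomp P n m i (x + x') y = pcomp P n m i x y + pcomp P n m i x' y"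
    and pcomp_scl_left: "i \<in> {1..n} \<Longrightarrow> x \<in> part P n d \<Longrightarrow> y \<in> part P m e \<Longrightarrow>
      pcomp P n m i (scl P c x) y = scl P c (pcomp P n m i x y)"
    and pcomp_add_right: "i \<in> {1..n} \<Longrightarrow> x \<in> part P n d \<Longrightarrow> y \<in> part P m e \<Longrightarrow> y' \<in> part P m e \<Longrightarrow>
      pcomp P n m i x (y + y') = pcomp P n m i x y + pcomp P n m i x y'"
    and pcomp_scl_right: "i \<in> {1..n} \<Longrightarrow> x \<in> part P n d \<Longrightarrow> y \<in> part P m e \<Longrightarrow>
      pcomp P n m i x (scl P c y) = scl P c (pcomp P n m i x y)"
    and unt_part: "unt P \<in> part P 1 0"
    and unt_left: "x \<in> part P n d \<Longrightarrow> pcomp P 1 n 1 (unt P) x = x"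
    and unt_right: "i \<in> {1..n} \<Longrightarrow> x \<in> part P n d \<Longrightarrow> pcomp P n 1 i x (unt P) = x"
    and pcomp_nested: "i \<in> {1..n} \<Longrightarrow> j \<in> {1..m} \<Longrightarrow>
      x \<in> part P n d \<Longrightarrow> y \<in> part P m e \<Longrightarrow> z \<in> part P k f \<Longrightarrow>
      pcomp P (n + m - 1) k (i - 1 + j) (pcomp P n m i x y) z =
      pcomp P n (m + k - 1) i x (pcomp P m k j y z)"
    and pcomp_parallel: "1 \<le> i \<Longrightarrow> i < j \<Longrightarrow> j \<le> n \<Longrightarrow>
      x \<in> part P n d \<Longrightarrow> y \<in> part P m e \<Longrightarrow> z \<in> part P k f \<Longrightarrow>
      pcomp P (n + m - 1) k (j + m - 1) (pcomp P n m i x y) z =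
      sgn_pow (e * f) (pcomp P (n + k - 1) m i (pcomp P n k j x z) y)"
    and pcomp_act: "i \<in> {1..n} \<Longrightarrow> \<sigma> permutes {1..n} \<Longrightarrow> \<tau> permutes {1..m} \<Longrightarrow>
      x \<in> part P n d \<Longrightarrow> y \<in> part P m e \<Longrightarrow>
      pcomp P n m (\<sigma> i) (act P n \<sigma> x) (act P m \<tau> y) =
      act P (n + m - 1) (block_perm n m i \<sigma> \<tau>) (pcomp P n m i x y)"

locale dg_operad = graded_operad P
  for P :: "('k :: field_char_0, 'a :: ab_group_add, 'z) dgoperad_scheme" +
  assumes dif_part: "x \<in> part P n d \<Longrightarrow> dif P n d x \<in> part P n (d + 1)"
    and dif_add: "x \<in> part P n d \<Longrightarrow> y \<in> part P n d \<Longrightarrow>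
      dif P n d (x + y) = dif P n d x + dif P n d y"
    and dif_scl: "x \<in> part P n d \<Longrightarrow> dif P n d (scl P c x) = scl P c (dif P n d x)"
    and dif_dif: "x \<in> part P n d \<Longrightarrow> dif P n (d + 1) (dif P n d x) = 0"
    and dif_act: "\<sigma> permutes {1..n} \<Longrightarrow> x \<in> part P n d \<Longrightarrow>
      dif P n d (act P n \<sigma> x) = act P n \<sigma> (dif P n d x)"
    and dif_pcomp: "i \<in> {1..n} \<Longrightarrow> x \<in> part P n d \<Longrightarrow> y \<in> part P m e \<Longrightarrow>
      dif P (n + m - 1) (d + e) (pcomp P n m i x y) =
      pcomp P n m i (dif P n d x) y + sgn_pow d (pcomp P n m i x (dif P m e y))"

(* A map of operads is a sequence of maps, of which only the values on homogeneous elements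
   are relevant. *)
definition graded_map ::
  "('k :: field_char_0, 'a :: ab_group_add, 'y) goperad_scheme \<Rightarrow>
   ('k, 'b :: ab_group_add, 'z) goperad_scheme \<Rightarrow> (nat \<Rightarrow> 'a \<Rightarrow> 'b) \<Rightarrow> bool" where
  "graded_map P Q F \<longleftrightarrow>
    (\<forall>n d. \<forall>x\<in>part P n d. F n x \<in> part Q n d) \<and>
    (\<forall>n d. \<forall>x\<in>part P n d. \<forall>y\<in>part P n d. F n (x + y) = F n x + F n y) \<and>
    (\<forall>n d c. \<forall>x\<in>part P n d. F n (scl P c x) = scl Q c (F n x)) \<and>
    (\<forall>n d \<sigma>. \<forall>x\<in>part P n d. \<sigma> permutes {1..n} \<longrightarrow> F n (act P n \<sigma> x) = act Q n \<sigma> (F n x)) \<and>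
    (\<forall>n m d e. \<forall>i\<in>{1..n}. \<forall>x\<in>part P n d. \<forall>y\<in>part P m e.
       F (n + m - 1) (pcomp P n m i x y) = pcomp Q n m i (F n x) (F m y)) \<and>
    F 1 (unt P) = unt Q"

definition dg_map ::
  "('k :: field_char_0, 'a :: ab_group_add, 'y) dgoperad_scheme \<Rightarrow>
   ('k, 'b :: ab_group_add, 'z) dgoperad_scheme \<Rightarrow> (nat \<Rightarrow> 'a \<Rightarrow> 'b) \<Rightarrow> bool" where
  "dg_map P Q F \<longleftrightarrow> graded_map P Q F \<and>
    (\<forall>n d. \<forall>x\<in>part P n d. F n (dif P n d x) = dif Q n d (F n x))"

definition cocycles :: "('k, 'a :: ab_group_add, 'z) dgoperad_scheme \<Rightarrow> nat \<Rightarrow> int \<Rightarrow> 'a set" where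
  "cocycles P n d = {x \<in> part P n d. dif P n d x = 0}"

definition coboundaries :: "('k, 'a :: ab_group_add, 'z) dgoperad_scheme \<Rightarrow> nat \<Rightarrow> int \<Rightarrow> 'a set" where
  "coboundaries P n d = dif P n (d - 1) ` part P n (d - 1)"

definition cohomologous ::
  "('k, 'a :: ab_group_add, 'z) dgoperad_scheme \<Rightarrow> nat \<Rightarrow> int \<Rightarrow> ('a \<times> 'a) set" where
  "cohomologous P n d =
    {(x, y). x \<in> cocycles P n d \<and> y \<in> cocycles P n d \<and> x - y \<in> coboundaries P n d}"

definition cohomology ::
  "('k, 'a :: ab_group_add, 'z) dgoperad_scheme \<Rightarrow> nat \<Rightarrow> int \<Rightarrow> 'a set set" where
  "cohomology P n d = cocycles P n d // cohomologous P n d"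

definition cohomology_map ::
  "('k, 'b :: ab_group_add, 'z) dgoperad_scheme \<Rightarrow> (nat \<Rightarrow> 'a \<Rightarrow> 'b) \<Rightarrow> nat \<Rightarrow> int \<Rightarrow> 'a set \<Rightarrow> 'b set" where
  "cohomology_map Q F n d X = cohomologous Q n d `` (F n ` X)"

definition quasi_iso ::
  "('k :: field_char_0, 'a :: ab_group_add, 'y) dgoperad_scheme \<Rightarrow>
   ('k, 'b :: ab_group_add, 'z) dgoperad_scheme \<Rightarrow> (nat \<Rightarrow> 'a \<Rightarrow> 'b) \<Rightarrow> bool" where
  "quasi_iso P Q F \<longleftrightarrow> dg_map P Q F \<and>
    (\<forall>n d. bij_betw (cohomology_map Q F n d) (cohomology P n d) (cohomology Q n d))"

definition Sh :: "nat \<Rightarrow> nat \<Rightarrow> (nat \<Rightarrow> nat) set" where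
  "Sh p q = {\<sigma>. \<sigma> permutes {1..p + q} \<and>
    strict_mono_on {1..p} \<sigma> \<and> strict_mono_on {p + 1..p + q} \<sigma>}"

(* A family of elements of the arities and degrees of the generators of Lambda Lie_infinity. *)
definition lie_family ::
  "('k, 'a, 'z) goperad_scheme \<Rightarrow> (nat \<Rightarrow> 'a) \<Rightarrow> bool" where
  "lie_family P x \<longleftrightarrow> (\<forall>n\<ge>2. x n \<in> part P n (3 - 2 * int n) \<and>
    (\<forall>\<sigma>. \<sigma> permutes {1..n} \<longrightarrow> act P n \<sigma> (x n) = x n))"

(* The universal property of the free graded operad on invariant generators lam n (n >= 2),
   with respect to the graded operads whose ambient vector space has type 'x. *)
definition free_wrt ::
  "'x :: ab_group_add itself \<Rightarrow> ('k :: field_char_0, 'a :: ab_group_add, 'z) goperad_scheme \<Rightarrow>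
   (nat \<Rightarrow> 'a) \<Rightarrow> bool" where
  "free_wrt T L lam \<longleftrightarrow>
    (\<forall>(X :: ('k, 'x) goperad) x. graded_operad X \<longrightarrow> lie_family X x \<longrightarrow>
      (\<exists>G. graded_map L X G \<and> (\<forall>n\<ge>2. G n (lam n) = x n) \<and>
        (\<forall>H. graded_map L X H \<and> (\<forall>n\<ge>2. H n (lam n) = x n) \<longrightarrow>
          (\<forall>n d. \<forall>v\<in>part L n d. H n v = G n v))))"

(*
  (L, lam) is a model of Lambda Lie_infinity. HOL cannot quantify over the types of the test
  operads, but two types are enough to determine (L, lam) up to isomorphism. The free operad
  has countable dimension, so it has a copy with ambient type nat => 'k; testing against it
  gives a map from L to the free operad under the generators, and uniqueness with respect to
  the ambient type of L itself shows that this map is inverse to the canonical one.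
*)
definition is_LambdaLie_inf ::
  "('k :: field_char_0, 'l :: ab_group_add, 'z) dgoperad_scheme \<Rightarrow> (nat \<Rightarrow> 'l) \<Rightarrow> bool" where
  "is_LambdaLie_inf L lam \<longleftrightarrow>
    dg_operad L \<and> lie_family L lam \<and>
    free_wrt TYPE('l) L lam \<and> free_wrt TYPE(nat \<Rightarrow> 'k) L lam \<and>
    (\<forall>n\<ge>2. dif L n (3 - 2 * int n) (lam n) =
      - (\<Sum>p = 2..n - 1. \<Sum>\<sigma>\<in>Sh p (n - p).
          act L n \<sigma> (pcomp L (n - p + 1) p 1 (lam (n - p + 1)) (lam p))))"

definition under_object ::
  "('k :: field_char_0, 'l :: ab_group_add, 'y) dgoperad_scheme \<Rightarrow>
   ('k, 'a :: ab_group_add, 'z) dgoperad_scheme \<Rightarrow> (nat \<Rightarrow> 'l \<Rightarrow> 'a) \<Rightarrow> bool" where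
  "under_object L P \<phi> \<longleftrightarrow> dg_operad P \<and> dg_map L P \<phi>"

definition under_morphism ::
  "('k :: field_char_0, 'l :: ab_group_add, 'x) dgoperad_scheme \<Rightarrow>
   ('k, 'a :: ab_group_add, 'y) dgoperad_scheme \<Rightarrow> (nat \<Rightarrow> 'l \<Rightarrow> 'a) \<Rightarrow>
   ('k, 'b :: ab_group_add, 'z) dgoperad_scheme \<Rightarrow> (nat \<Rightarrow> 'l \<Rightarrow> 'b) \<Rightarrow> (nat \<Rightarrow> 'a \<Rightarrow> 'b) \<Rightarrow> bool" where
  "under_morphism L P \<phi> Q \<psi> F \<longleftrightarrow>
    under_object L P \<phi> \<and> under_object L Q \<psi> \<and> dg_map P Q F \<and>
    (\<forall>n d. \<forall>x\<in>part L n d. F n (\<phi> n x) = \<psi> n x)"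

(* relabel P [i_1, ..., i_n] v is v(i_1, ..., i_n); if v is an operadic composite, its inputs
   are listed in the order in which they are displayed, reading through the inner brackets. *)
definition relabel :: "('k, 'a, 'z) goperad_scheme \<Rightarrow> nat list \<Rightarrow> 'a \<Rightarrow> 'a" where
  "relabel P is v =
    act P (length is) (\<lambda>j. if j \<in> {1..length is} then is ! (j - 1) else j) v"

definition lie_elems :: "(nat \<Rightarrow> 'l) \<Rightarrow> (nat \<Rightarrow> 'l \<Rightarrow> 'a :: ab_group_add) \<Rightarrow> nat \<Rightarrow> 'a" where
  "lie_elems lam \<phi> n = (if n \<ge> 2 then \<phi> n (lam n) else 0)"

definition tw_part :: "('k, 'a, 'z) goperad_scheme \<Rightarrow> nat \<Rightarrow> int \<Rightarrow> (nat \<Rightarrow> 'a) set" where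
  "tw_part P n d = {f. \<forall>r. f r \<in> part P (r + n) (d - 2 * int r) \<and>
    (\<forall>\<sigma>. \<sigma> permutes {1..r} \<longrightarrow> act P (r + n) \<sigma> (f r) = f r)}"

definition tw_act ::
  "('k, 'a, 'z) goperad_scheme \<Rightarrow> nat \<Rightarrow> (nat \<Rightarrow> nat) \<Rightarrow> (nat \<Rightarrow> 'a) \<Rightarrow> nat \<Rightarrow> 'a" where
  "tw_act P n \<tau> f r = act P (r + n) (\<lambda>j. if j \<le> r then j else r + \<tau> (j - r)) (f r)"

definition tw_pcomp ::
  "('k, 'a :: ab_group_add, 'z) goperad_scheme \<Rightarrow> nat \<Rightarrow> nat \<Rightarrow> nat \<Rightarrow>
   (nat \<Rightarrow> 'a) \<Rightarrow> (nat \<Rightarrow> 'a) \<Rightarrow> nat \<Rightarrow> 'a" where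
  "tw_pcomp P n m i f g r =
    (\<Sum>p = 0..r. \<Sum>\<sigma>\<in>Sh p (r - p).
      relabel P
        (map \<sigma> [1..<p + 1] @ [r + 1..<r + i] @
          map \<sigma> [p + 1..<r + 1] @ [r + i..<r + i + m] @
         [r + i + m..<r + n + m])
        (pcomp P (p + n) (r - p + m) (p + i) (f p) (g (r - p))))"

(* The argument a is the sequence a_n = phi_n of the images of the generators (with a_1 = 0). *)
definition tw_dif ::
  "('k, 'a :: ab_group_add, 'z) dgoperad_scheme \<Rightarrow> (nat \<Rightarrow> 'a) \<Rightarrow> nat \<Rightarrow> int \<Rightarrow>
   (nat \<Rightarrow> 'a) \<Rightarrow> nat \<Rightarrow> 'a" where
  "tw_dif P a n d f r =
    (let \<kappa> = (\<lambda>r. a (r + 1)) in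
      dif P (r + n) (d - 2 * int r) (f r)
      - sgn_pow d (\<Sum>p = 1..r. \<Sum>\<sigma>\<in>Sh p (r - p).
          relabel P (map \<sigma> [1..<p + 1] @ map \<sigma> [p + 1..<r + 1] @ [r + 1..<r + n + 1])
            (pcomp P (r - p + 1 + n) p 1 (f (r - p + 1)) (a p)))
      + tw_pcomp P 1 n 1 \<kappa> f r
      - sgn_pow d (\<Sum>i = 1..n. tw_pcomp P n 1 i f \<kappa> r))"

definition Tw ::
  "('k, 'a :: ab_group_add, 'z) dgoperad_scheme \<Rightarrow> (nat \<Rightarrow> 'a) \<Rightarrow> ('k, nat \<Rightarrow> 'a) dgoperad" where
  "Tw P a = \<lparr>
    scl = (\<lambda>c f r. scl P c (f r)),
    part = tw_part P,
    act = tw_act P,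
    pcomp = tw_pcomp P,
    unt = (\<lambda>r. if r = 0 then unt P else 0),
    dif = tw_dif P a\<rparr>"

definition Tw_map :: "(nat \<Rightarrow> 'a \<Rightarrow> 'b) \<Rightarrow> nat \<Rightarrow> (nat \<Rightarrow> 'a) \<Rightarrow> nat \<Rightarrow> 'b" where
  "Tw_map F n f r = F (r + n) (f r)"

end

theory Submission
  imports Defs
begin

text \<open>
  The differential of a twisted operad is triangular. The component in arity \<open>r\<close> of the twisted
  differential of \<open>f\<close> is the internal differential of \<open>f r\<close> plus terms in which an element
  \<open>a p\<close> is composed with some \<open>f s\<close>; as \<open>a 1 = 0\<close>, only \<open>s < r\<close> occurs. So the twisted complex is
  complete for the filtration by \<open>r\<close>, and its graded pieces are the \<open>S_r\<close>-invariants of the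
  complexes \<open>O(r + n)\<close>. On invariants the map \<open>F\<close> is again a quasi-isomorphism, because in
  characteristic zero one can average over \<open>S_r\<close> (\<open>cone_acyclic_invariants\<close>). A filtered map of
  complete complexes that is a quasi-isomorphism on every graded piece is a quasi-isomorphism. It is
  convenient to say this in terms of the mapping cone, where it becomes one statement: a cocycle of
  the cone is a coboundary, and a primitive is constructed one component at a time
  (\<open>cone_acyclic_total\<close>).

  The successive approximation replaces a cocycle by its difference with a coboundary and needs that
  this difference is again a cocycle. Hence the main work is to show that the twisted differential
  squares to zero (\<open>tw_dif_square\<close>). With \<open>\<mu>\<close> for the family \<open>a\<close>, the differential has the form
  \<open>D f = \<partial> f + \<mu> \<star> f - (-1)^|f| f \<star> \<mu>\<close>, where \<open>f \<star> \<mu>\<close> sums over all ways of inserting \<open>\<mu>\<close> into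
  \<open>f\<close> and \<open>\<mu> \<star> f\<close> over all ways of inserting \<open>f\<close> into \<open>\<mu>\<close>, and the relation between the generators
  reads \<open>\<partial> \<mu> = - \<mu> \<star> \<mu>\<close>. As in any pre-Lie algebra, \<open>D\<^sup>2 = 0\<close> follows by sorting composites of
  three operations into nested and parallel ones:
  \<^item> \<open>(f \<star> \<mu>) \<star> \<mu> = f \<star> (\<mu> \<star> \<mu>)\<close>, since the parallel insertions of two copies of the odd element
    \<open>\<mu>\<close> cancel (\<open>insert_twice\<close>);
  \<^item> \<open>(\<mu> \<star> f) \<star> \<mu> = \<mu> \<star> (f \<star> \<mu>) + R\<close>, where \<open>R\<close> collects the parallel insertions of \<open>f\<close> and \<open>\<mu>\<close>
    into \<open>\<mu>\<close> (\<open>insert_into_lstar\<close>);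
  \<^item> \<open>(\<mu> \<star> \<mu>) \<star> f = \<mu> \<star> (\<mu> \<star> f) + (-1)^|f| R\<close> (\<open>dif_a_fam\<close>).

  Shuffles and explicit block permutations are unsuitable for such a sorting. Therefore operations
  are first equipped with inputs labelled by arbitrary finite sets of natural numbers. A sum over
  shuffles then is a sum over subsets, composition at a label satisfies the two associativity laws
  without any renumbering (\<open>circ_nested\<close>, \<open>circ_parallel\<close>), and the three identities above are
  bijections between sets of nested or disjoint subsets.
\<close>

section \<open>Additive maps on homogeneous parts\<close>

text \<open>
  All operations of an operad are additive only on homogeneous parts, which are subsets of one
  ambient group; hence additivity is taken relative to a subgroup.
\<close>
definition subgroup_of :: "'a :: ab_group_add set \<Rightarrow> bool" where
  "subgroup_of C \<longleftrightarrow> 0 \<in> C \<and> (\<forall>x\<in>C. \<forall>y\<in>C. x - y \<in> C)"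

lemma
  assumes "subgroup_of C"
  shows subgroup_zero: "0 \<in> C"
    and subgroup_diff: "x \<in> C \<Longrightarrow> y \<in> C \<Longrightarrow> x - y \<in> C"
    and subgroup_minus: "x \<in> C \<Longrightarrow> - x \<in> C"
    and subgroup_add: "x \<in> C \<Longrightarrow> y \<in> C \<Longrightarrow> x + y \<in> C"
    and subgroup_sgn_pow: "x \<in> C \<Longrightarrow> sgn_pow k x \<in> C"
proof -
  show 0: "0 \<in> C" using assms by (simp add: subgroup_of_def)
  show d: "x - y \<in> C" if "x \<in> C" "y \<in> C" for x y
    using assms that by (simp add: subgroup_of_def)
  show m: "- x \<in> C" if "x \<in> C" for x using d[OF 0 that] by simp
  show "x + y \<in> C" if "x \<in> C" "y \<in> C" using d[OF that(1) m[OF that(2)]] by simp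
  show "sgn_pow k x \<in> C" if "x \<in> C" using m that by (simp add: sgn_pow_def)
qed

lemma subgroup_sum:
  assumes "subgroup_of C" "\<And>i. i \<in> I \<Longrightarrow> g i \<in> C"
  shows "sum g I \<in> C"
  using assms(2)
  by (induction I rule: infinite_finite_induct)
    (auto intro: subgroup_zero[OF assms(1)] subgroup_add[OF assms(1)])

definition additive_on :: "'a :: ab_group_add set \<Rightarrow> ('a \<Rightarrow> 'b :: ab_group_add) \<Rightarrow> bool" where
  "additive_on C h \<longleftrightarrow> subgroup_of C \<and> (\<forall>x\<in>C. \<forall>y\<in>C. h (x + y) = h x + h y)"

lemma
  assumes "additive_on C h"
  shows additive_on_add: "x \<in> C \<Longrightarrow> y \<in> C \<Longrightarrow> h (x + y) = h x + h y"
    and additive_on_zero: "h 0 = 0"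
    and additive_on_minus: "x \<in> C \<Longrightarrow> h (- x) = - h x"
    and additive_on_diff: "x \<in> C \<Longrightarrow> y \<in> C \<Longrightarrow> h (x - y) = h x - h y"
    and additive_on_sgn_pow: "x \<in> C \<Longrightarrow> h (sgn_pow k x) = sgn_pow k (h x)"
proof -
  have C: "subgroup_of C" using assms by (simp add: additive_on_def)
  show a: "h (x + y) = h x + h y" if "x \<in> C" "y \<in> C" for x y
    using assms that by (simp add: additive_on_def)
  show z: "h 0 = 0" using a[OF subgroup_zero[OF C] subgroup_zero[OF C]] by simp
  show m: "h (- x) = - h x" if "x \<in> C" for x
    using a[OF that subgroup_minus[OF C that]] z by (simp add: eq_neg_iff_add_eq_0 add.commute)
  show "h (x - y) = h x - h y" if "x \<in> C" "y \<in> C"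
    using a[OF that(1) subgroup_minus[OF C that(2)]] m[OF that(2)] by simp
  show "h (sgn_pow k x) = sgn_pow k (h x)" if "x \<in> C"
    using m[OF that] by (simp add: sgn_pow_def)
qed

lemma additive_on_sum:
  assumes h: "additive_on C h" and g: "\<And>i. i \<in> I \<Longrightarrow> g i \<in> C"
  shows "h (sum g I) = (\<Sum>i\<in>I. h (g i))"
proof -
  have C: "subgroup_of C" using h by (simp add: additive_on_def)
  show ?thesis using g
  proof (induction I rule: infinite_finite_induct)
    case (insert i I)
    have "h (sum g (insert i I)) = h (g i + sum g I)" using insert by simp
    also have "\<dots> = h (g i) + h (sum g I)"
      by (rule additive_on_add[OF h]) (auto intro: subgroup_sum[OF C] insert.prems)
    finally show ?case using insert by simp
  qed (auto simp: additive_on_zero[OF h])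
qed

lemma additive_on_comp:
  assumes "additive_on C h" "additive_on D g" "\<And>x. x \<in> C \<Longrightarrow> h x \<in> D"
  shows "additive_on C (\<lambda>x. g (h x))"
  using assms unfolding additive_on_def by simp

lemma additive_on_sum_fun:
  assumes "subgroup_of C" "\<And>i. i \<in> I \<Longrightarrow> additive_on C (h i)"
  shows "additive_on C (\<lambda>x. \<Sum>i\<in>I. h i x)"
  using assms by (auto simp: additive_on_def sum.distrib[symmetric] intro!: sum.cong)

lemma sgn_pow_simps:
  "sgn_pow k (x + y) = sgn_pow k x + sgn_pow k y"
  "sgn_pow k (x - y) = sgn_pow k x - sgn_pow k y"
  "sgn_pow k (- x) = - sgn_pow k x"
  "sgn_pow k (sgn_pow k x) = x"
  "sgn_pow (k + 1) x = - sgn_pow k x"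
  "sgn_pow k 0 = 0"
  by (auto simp: sgn_pow_def)

lemma sgn_pow_sum: "sgn_pow k (sum g I) = (\<Sum>i\<in>I. sgn_pow k (g i))"
  by (auto simp: sgn_pow_def sum_negf)

section \<open>Operations with labelled inputs\<close>

text \<open>
  The lists for which \<open>relabel\<close> applies a permutation.
\<close>
definition arrangement :: "nat list \<Rightarrow> nat \<Rightarrow> bool" where
  "arrangement js n \<longleftrightarrow> distinct js \<and> set js = {1..n}"

definition position_perm :: "nat list \<Rightarrow> nat \<Rightarrow> nat" where
  "position_perm js = (\<lambda>j. if j \<in> {1..length js} then js ! (j - 1) else j)"

lemma relabel_conv: "relabel P js v = act P (length js) (position_perm js) v"
  by (simp add: relabel_def position_perm_def)

lemma arrangement_length: "arrangement js n \<Longrightarrow> length js = n"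
  using distinct_card[of js] by (simp add: arrangement_def)

lemma bij_betw_pred: "bij_betw (\<lambda>j. j - 1) {1..n} {..<n :: nat}"
  by (rule bij_betwI[where g = Suc]) auto

lemma position_perm_permutes:
  assumes "arrangement js n"
  shows "position_perm js permutes {1..n}"
proof (rule bij_imp_permutes)
  have l: "length js = n" by (rule arrangement_length[OF assms])
  have "bij_betw ((!) js) {..<n} {1..n}"
    using assms l by (intro bij_betw_nth) (auto simp: arrangement_def)
  from bij_betw_trans[OF bij_betw_pred this]
  show "bij_betw (position_perm js) {1..n} {1..n}"
    by (rule bij_betw_cong[THEN iffD1, rotated]) (auto simp: position_perm_def l)
  show "position_perm js x = x" if "x \<notin> {1..n}" for x
    using that l by (auto simp: position_perm_def)
qed

lemma arrangement_permutes:
  assumes "\<sigma> permutes {1..n}"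
  shows "arrangement (map \<sigma> [1..<n + 1]) n"
proof -
  have "{1..<n + 1} = {1..n}" by auto
  then show ?thesis
    using permutes_inj_on[OF assms, of "{1..n}"] permutes_image[OF assms]
    by (simp add: arrangement_def distinct_map del: upt_Suc)
qed

lemma position_perm_map_upt:
  assumes "\<sigma> permutes {1..n}"
  shows "position_perm (map \<sigma> [1..<n + 1]) = \<sigma>"
proof
  fix j show "position_perm (map \<sigma> [1..<n + 1]) j = \<sigma> j"
    using permutes_not_in[OF assms, of j] by (auto simp: position_perm_def simp del: upt_Suc)
qed

definition rank :: "nat set \<Rightarrow> nat \<Rightarrow> nat" where
  "rank X x = card {y \<in> X. y \<le> x}"

abbreviation sorted_of :: "nat set \<Rightarrow> nat list" where
  "sorted_of \<equiv> sorted_list_of_set"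

lemma rank_nth:
  assumes "finite X" "i < card X"
  shows "rank X (sorted_of X ! i) = i + 1"
proof -
  let ?s = "sorted_of X"
  have l: "length ?s = card X" using assms by simp
  have "{y \<in> X. y \<le> ?s ! i} = (!) ?s ` {..i}"
  proof (intro equalityI subsetI)
    fix y assume "y \<in> {y \<in> X. y \<le> ?s ! i}"
    then have y: "y \<in> set ?s" "y \<le> ?s ! i" using assms by auto
    then obtain j where j: "j < length ?s" "y = ?s ! j" by (auto simp: in_set_conv_nth)
    have "j \<le> i"
    proof (rule ccontr)
      assume "\<not> j \<le> i"
      then have "?s ! i < ?s ! j"
        using sorted_wrt_nth_less[OF strict_sorted_list_of_set, of i j X] j by simp
      then show False using y j by simp
    qed
    then show "y \<in> (!) ?s ` {..i}" using j by auto
  next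
    fix y assume "y \<in> (!) ?s ` {..i}"
    then obtain j where j: "j \<le> i" "y = ?s ! j" by auto
    then have "y \<in> X" using assms l nth_mem[of j ?s] by auto
    moreover have "y \<le> ?s ! i"
      using j assms l sorted_nth_mono[OF sorted_sorted_list_of_set, of j i X] by auto
    ultimately show "y \<in> {y \<in> X. y \<le> ?s ! i}" by simp
  qed
  moreover have "inj_on ((!) ?s) {..i}"
    using assms l by (intro inj_on_nth) auto
  ultimately show ?thesis by (simp add: rank_def card_image)
qed

lemma
  assumes "finite X" "x \<in> X"
  shows sorted_of_rank: "sorted_of X ! (rank X x - 1) = x"
    and rank_bounds: "rank X x \<in> {1..card X}"
proof -
  obtain i where i: "i < card X" "x = sorted_of X ! i"
    using assms by (metis in_set_conv_nth length_sorted_list_of_set set_sorted_list_of_set)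
  show "sorted_of X ! (rank X x - 1) = x" "rank X x \<in> {1..card X}"
    using rank_nth[OF assms(1) i(1)] i by auto
qed

lemma rank_inj_on: "finite X \<Longrightarrow> inj_on (rank X) X"
  by (rule inj_on_inverseI[where g = "\<lambda>k. sorted_of X ! (k - 1)"]) (rule sorted_of_rank)

lemma map_rank_sorted_of:
  assumes "finite X"
  shows "map (rank X) (sorted_of X) = [1..<card X + 1]"
  by (rule nth_equalityI) (auto simp: rank_nth[OF assms] simp del: upt_Suc)

lemma rank_interval: "j \<in> {1..n} \<Longrightarrow> rank {1..n} j = j"
proof -
  assume "j \<in> {1..n}"
  then have "{y \<in> {1..n}. y \<le> j} = {1..j}" by auto
  then show ?thesis by (simp add: rank_def)
qed

lemma arrangement_map_rank:
  assumes "distinct xs"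
  shows "arrangement (map (rank (set xs)) xs) (length xs)"
proof -
  have "rank (set xs) ` set xs = {1..card (set xs)}"
    using rank_bounds[of "set xs"] rank_inj_on[of "set xs"]
    by (intro card_subset_eq) (auto simp: card_image)
  then show ?thesis
    using assms rank_inj_on[of "set xs"]
    by (simp add: arrangement_def distinct_map distinct_card)
qed

text \<open>
  An operation whose inputs are labelled by a finite set \<open>X\<close> is encoded as an element of arity
  \<open>card X\<close>, its \<open>k\<close>-th input being labelled by the \<open>k\<close>-th smallest element of \<open>X\<close>. In this encoding
  \<open>lab P xs v\<close> is the operation \<open>v\<close> with inputs labelled \<open>xs\<close> in the order of its own inputs. It depends
  on the labels only through their relative order, so that labels \<open>1, ..., n\<close> give back \<open>relabel\<close>.
\<close>
definition lab :: "('k, 'a, 'z) goperad_scheme \<Rightarrow> nat list \<Rightarrow> 'a \<Rightarrow> 'a" where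
  "lab P xs v = relabel P (map (rank (set xs)) xs) v"

lemma lab_arrangement:
  assumes "arrangement js n"
  shows "lab P js v = relabel P js v"
proof -
  have "map (rank (set js)) js = js"
    using assms rank_interval[of _ n] by (intro map_idI) (simp add: arrangement_def)
  then show ?thesis by (simp add: lab_def)
qed

context graded_operad
begin

lemma subgroup_part: "subgroup_of (part P n d)"
  using part_subspace[of n d] by (auto simp: subgroup_of_def subspace_0 subspace_diff)

lemma additive_act: "\<sigma> permutes {1..n} \<Longrightarrow> additive_on (part P n d) (act P n \<sigma>)"
  by (simp add: additive_on_def subgroup_part act_add)

lemma relabel_part:
  assumes "arrangement js n" "v \<in> part P n d"
  shows "relabel P js v \<in> part P n d"
  using act_part[OF position_perm_permutes[OF assms(1)] assms(2)] arrangement_length[OF assms(1)]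
  by (simp add: relabel_conv)

lemma additive_relabel:
  assumes "arrangement js n"
  shows "additive_on (part P n d) (relabel P js)"
proof -
  have "relabel P js = act P n (position_perm js)"
    by (simp add: relabel_conv[abs_def] arrangement_length[OF assms])
  then show ?thesis using additive_act[OF position_perm_permutes[OF assms]] by simp
qed

lemma lab_part: "distinct xs \<Longrightarrow> v \<in> part P (length xs) d \<Longrightarrow> lab P xs v \<in> part P (length xs) d"
  unfolding lab_def by (rule relabel_part[OF arrangement_map_rank])

lemma additive_lab: "distinct xs \<Longrightarrow> additive_on (part P (length xs) d) (lab P xs)"
  unfolding lab_def by (rule additive_relabel[OF arrangement_map_rank])

lemma act_conv_relabel:
  "\<sigma> permutes {1..n} \<Longrightarrow> act P n \<sigma> v = relabel P (map \<sigma> [1..<n + 1]) v"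
  using position_perm_map_upt[of \<sigma> n] by (simp add: relabel_conv del: upt_Suc)

lemma lab_sorted: "finite X \<Longrightarrow> v \<in> part P (card X) d \<Longrightarrow> lab P (sorted_of X) v = v"
  using act_conv_relabel[of id "card X" v] act_id[of v "card X" d] map_rank_sorted_of[of X]
  by (simp add: lab_def permutes_id)

text \<open>
  Two successive labellings amount to one: \<open>relabel P js v\<close> names positions of \<open>xs\<close>, which are then
  looked up there.
\<close>
lemma lab_relabel:
  assumes "distinct xs" "arrangement js (length xs)" "v \<in> part P (length xs) d"
  shows "lab P xs (relabel P js v) = lab P (map (\<lambda>i. xs ! (i - 1)) js) v"
proof -
  let ?n = "length xs" and ?r = "map (rank (set xs)) xs" and ?ys = "map (\<lambda>i. xs ! (i - 1)) js"
  have l: "length js = ?n" by (rule arrangement_length[OF assms(2)])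
  have s: "set ?ys = set xs"
  proof -
    have "(\<lambda>i. xs ! (i - 1)) ` {1..?n} = (!) xs ` ((\<lambda>i. i - 1) ` {1..?n})"
      by (simp add: image_image)
    also have "\<dots> = set xs"
      using bij_betw_pred[of ?n] by (auto simp: bij_betw_def set_conv_nth)
    finally show ?thesis using assms(2) by (simp add: arrangement_def)
  qed
  have "position_perm ?r \<circ> position_perm js = position_perm (map (rank (set xs)) ?ys)"
  proof
    fix j
    show "(position_perm ?r \<circ> position_perm js) j = position_perm (map (rank (set xs)) ?ys) j"
    proof (cases "j \<in> {1..?n}")
      case True
      then have "js ! (j - 1) \<in> {1..?n}"
        using assms(2) l nth_mem[of "j - 1" js] by (auto simp: arrangement_def)
      then show ?thesis using True l by (auto simp: position_perm_def)
    next
      case False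
      then show ?thesis using l by (auto simp: position_perm_def)
    qed
  qed
  with act_comp[OF position_perm_permutes[OF arrangement_map_rank[OF assms(1)]]
      position_perm_permutes[OF assms(2)] assms(3)]
  show ?thesis unfolding lab_def s by (simp add: relabel_conv l)
qed

lemma lab_act:
  assumes "distinct xs" "\<sigma> permutes {1..length xs}" "v \<in> part P (length xs) d"
  shows "lab P xs (act P (length xs) \<sigma> v) = lab P (map (\<lambda>i. xs ! (\<sigma> i - 1)) [1..<length xs + 1]) v"
  using lab_relabel[OF assms(1) arrangement_permutes[OF assms(2)] assms(3)]
  by (simp add: act_conv_relabel[OF assms(2)] comp_def del: upt_Suc)

text \<open>
  Transport of labelled operations along a map \<open>\<beta>\<close> that is injective on the label set.
\<close>
definition ren :: "nat set \<Rightarrow> (nat \<Rightarrow> nat) \<Rightarrow> 'a \<Rightarrow> 'a" where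
  "ren X \<beta> v = lab P (map \<beta> (sorted_of X)) v"

lemma map_sorted_rank:
  assumes "finite X" "set xs \<subseteq> X"
  shows "map (\<lambda>i. map \<beta> (sorted_of X) ! (i - 1)) (map (rank X) xs) = map \<beta> xs"
proof (rule nth_equalityI)
  fix i assume "i < length (map (\<lambda>i. map \<beta> (sorted_of X) ! (i - 1)) (map (rank X) xs))"
  then have x: "xs ! i \<in> X" and i: "i < length xs" using assms(2) by (auto simp: nth_mem)
  then show "map (\<lambda>i. map \<beta> (sorted_of X) ! (i - 1)) (map (rank X) xs) ! i = map \<beta> xs ! i"
    using rank_bounds[OF assms(1) x] sorted_of_rank[OF assms(1) x] by auto
qed simp

lemma ren_lab:
  assumes "distinct xs" "set xs = X" "inj_on \<beta> X" "v \<in> part P (length xs) d"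
  shows "ren X \<beta> (lab P xs v) = lab P (map \<beta> xs) v"
proof -
  have c: "length (map \<beta> (sorted_of X)) = length xs"
    using assms(1,2) distinct_card[of xs] by auto
  have "ren X \<beta> (lab P xs v) = lab P (map \<beta> (sorted_of X)) (relabel P (map (rank X) xs) v)"
    by (simp add: ren_def lab_def[of P xs] assms(2))
  also have "\<dots> = lab P (map (\<lambda>i. map \<beta> (sorted_of X) ! (i - 1)) (map (rank X) xs)) v"
  proof (rule lab_relabel)
    show "distinct (map \<beta> (sorted_of X))" using assms(2,3) by (auto simp: distinct_map)
    show "arrangement (map (rank X) xs) (length (map \<beta> (sorted_of X)))"
      using arrangement_map_rank[OF assms(1)] assms(2) c by simp
    show "v \<in> part P (length (map \<beta> (sorted_of X))) d" using assms(4) c by simp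
  qed
  also have "\<dots> = lab P (map \<beta> xs) v" using assms(2) by (subst map_sorted_rank) auto
  finally show ?thesis .
qed

text \<open>
  Every labelled operation can be written with its labels in any prescribed order. This allows to put
  the labels at which one composes first, so that only compositions at the first inputs remain.
\<close>
lemma lab_surj:
  assumes "distinct xs" "length xs = n" "v \<in> part P n d"
  obtains v' where "v' \<in> part P n d" "v = lab P xs v'"
proof
  let ?p = "position_perm (map (rank (set xs)) xs)"
  have p: "?p permutes {1..n}"
    using position_perm_permutes[OF arrangement_map_rank[OF assms(1)]] assms(2) by simp
  show "act P n (inv ?p) v \<in> part P n d" by (rule act_part[OF permutes_inv[OF p] assms(3)])
  show "v = lab P xs (act P n (inv ?p) v)"
    using act_comp[OF p permutes_inv[OF p] assms(3)] act_id[OF assms(3)] assms(2)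
    by (simp add: lab_def relabel_conv permutes_inv_o[OF p])
qed

end

section \<open>Composition of labelled operations\<close>

context graded_operad
begin

text \<open>
  The operation \<open>v\<close>, with inputs labelled by \<open>X\<close>, receives \<open>w\<close>, with inputs labelled by \<open>Y\<close>, at its
  input \<open>x\<close>. The list gives the labels of the result in the order in which the inputs of the composite
  are displayed. The label \<open>x\<close> disappears, so it may be reused in \<open>Y\<close>.
\<close>
definition circ :: "nat set \<Rightarrow> nat \<Rightarrow> nat set \<Rightarrow> 'a \<Rightarrow> 'a \<Rightarrow> 'a" where
  "circ X x Y v w =
    lab P (take (rank X x - 1) (sorted_of X) @ sorted_of Y @ drop (rank X x) (sorted_of X))
      (pcomp P (card X) (card Y) (rank X x) v w)"

lemma circ_list:
  assumes "finite X" "finite Y" "x \<in> X" "Y \<inter> (X - {x}) = {}"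
  defines "L \<equiv> take (rank X x - 1) (sorted_of X) @ sorted_of Y @ drop (rank X x) (sorted_of X)"
  shows "distinct L" "set L = X - {x} \<union> Y" "length L = card X + card Y - 1"
proof -
  define A where "A = take (rank X x - 1) (sorted_of X)"
  define B where "B = drop (rank X x) (sorted_of X)"
  note r = rank_bounds[OF assms(1,3)] sorted_of_rank[OF assms(1,3)]
  have s: "A @ x # B = sorted_of X"
  proof -
    have "rank X x - 1 < length (sorted_of X)" "Suc (rank X x - 1) = rank X x" using r(1) by auto
    then show ?thesis
      using id_take_nth_drop[of "rank X x - 1" "sorted_of X"] r(2) by (simp add: A_def B_def)
  qed
  have d: "distinct (A @ x # B)" "set (A @ x # B) = X"
    unfolding s using assms(1) by simp_all
  then have "X - {x} = set A \<union> set B" by auto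
  then show "distinct L" "set L = X - {x} \<union> Y"
    using d assms(2,4) unfolding L_def A_def[symmetric] B_def[symmetric] by auto
  have "length A + 1 + length B = card X" using arg_cong[OF s, of length] by simp
  then show "length L = card X + card Y - 1"
    unfolding L_def A_def[symmetric] B_def[symmetric] by simp
qed

lemma position_perm_rank:
  assumes "distinct zs" "k \<in> {1..length zs}"
  shows "position_perm (map (rank (set zs)) zs) k = rank (set zs) (zs ! (k - 1))"
  using assms by (auto simp: position_perm_def)

text \<open>
  This is the equivariance axiom freed of block permutations: whatever the orders in which the labels
  of \<open>v\<close> and \<open>w\<close> are listed, the composite is labelled by the first list with \<open>x\<close> replaced by the second.
\<close>
lemma circ_lab:
  assumes zs: "distinct (xs @ x # xs')" and ys: "distinct ys"
    and disj: "set ys \<inter> set (xs @ xs') = {}"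
    and v: "v \<in> part P (length (xs @ x # xs')) d" and w: "w \<in> part P (length ys) e"
  shows "circ (set (xs @ x # xs')) x (set ys) (lab P (xs @ x # xs') v) (lab P ys w) =
    lab P (xs @ ys @ xs') (pcomp P (length (xs @ x # xs')) (length ys) (length xs + 1) v w)"
proof -
  define zs where "zs = xs @ x # xs'"
  define X where "X = set zs"
  define Y where "Y = set ys"
  define n where "n = length zs"
  define m where "m = length ys"
  define i where "i = length xs + 1"
  define \<sigma> where "\<sigma> = position_perm (map (rank X) zs)"
  define \<tau> where "\<tau> = position_perm (map (rank Y) ys)"
  define p where "p = rank X x"
  define L where "L = take (p - 1) (sorted_of X) @ sorted_of Y @ drop p (sorted_of X)"
  define N where "N = n + m - 1"
  define bp where "bp = block_perm n m i \<sigma> \<tau>"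
  have dz: "distinct zs" using zs by (simp add: zs_def)
  have fX: "finite X" "finite Y" by (simp_all add: X_def Y_def)
  have cX: "card X = n" "card Y = m"
    using dz ys by (auto simp: X_def n_def Y_def m_def distinct_card)
  have x: "x \<in> X" by (simp add: X_def zs_def)
  have p: "p \<in> {1..n}" using rank_bounds[OF fX(1) x] cX by (simp add: p_def)
  have i: "i \<in> {1..n}" by (simp add: i_def n_def zs_def)
  have zsi: "zs ! (i - 1) = x" by (simp add: zs_def i_def)
  have \<sigma>: "\<sigma> permutes {1..n}" "\<tau> permutes {1..m}"
    unfolding \<sigma>_def n_def X_def \<tau>_def Y_def m_def
    by (intro position_perm_permutes arrangement_map_rank dz ys)+
  have \<sigma>k: "\<sigma> k = rank X (zs ! (k - 1))" if "k \<in> {1..n}" for k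
    unfolding \<sigma>_def X_def using that by (intro position_perm_rank dz) (simp add: n_def)
  have \<tau>k: "\<tau> k = rank Y (ys ! (k - 1))" if "k \<in> {1..m}" for k
    unfolding \<tau>_def Y_def using that by (intro position_perm_rank ys) (simp add: m_def)
  have \<sigma>b: "\<sigma> k \<in> {1..n}" and \<sigma>s: "sorted_of X ! (\<sigma> k - 1) = zs ! (k - 1)" if "k \<in> {1..n}" for k
  proof -
    have "zs ! (k - 1) \<in> X" using that by (auto simp: X_def n_def)
    with rank_bounds[OF fX(1) this] sorted_of_rank[OF fX(1) this] \<sigma>k[OF that] cX
    show "\<sigma> k \<in> {1..n}" "sorted_of X ! (\<sigma> k - 1) = zs ! (k - 1)" by auto
  qed
  have \<tau>b: "\<tau> k \<in> {1..m}" and \<tau>s: "sorted_of Y ! (\<tau> k - 1) = ys ! (k - 1)" if "k \<in> {1..m}" for k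
  proof -
    have "ys ! (k - 1) \<in> Y" using that by (auto simp: Y_def m_def)
    with rank_bounds[OF fX(2) this] sorted_of_rank[OF fX(2) this] \<tau>k[OF that] cX
    show "\<tau> k \<in> {1..m}" "sorted_of Y ! (\<tau> k - 1) = ys ! (k - 1)" by auto
  qed
  have \<sigma>i: "\<sigma> i = p" using \<sigma>k[OF i] zsi by (simp add: p_def)
  have \<sigma>ne: "\<sigma> k \<noteq> p" if "k \<noteq> i" for k
    using permutes_inj[OF \<sigma>(1)] that \<sigma>i by (auto dest: injD)
  have lX: "length (sorted_of X) = n" "length (sorted_of Y) = m" using cX by simp_all
  have lL: "length L = N" using p lX by (auto simp: L_def N_def)
  have L1: "L ! (q - 1) = sorted_of X ! (q - 1)" if "1 \<le> q" "q < p" for q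
    using that lX p by (auto simp: L_def nth_append)
  have L2: "L ! (p - 1 + t - 1) = sorted_of Y ! (t - 1)" if "t \<in> {1..m}" for t
    using that lX p by (auto simp: L_def nth_append)
  have L3: "L ! (q + m - 1 - 1) = sorted_of X ! (q - 1)" if "p < q" "q \<le> n" for q
    using that lX p by (auto simp: L_def nth_append)
  \<comment> \<open>the block permutation sends the position of a label in the displayed list to its position in \<open>L\<close>\<close>
  have key: "bp j \<in> {1..N} \<and> L ! (bp j - 1) = (xs @ ys @ xs') ! (j - 1)" if j: "j \<in> {1..N}" for j
  proof -
    have shift: "(if \<sigma> k < p then \<sigma> k else \<sigma> k + m - 1) \<in> {1..N} \<and>
        L ! ((if \<sigma> k < p then \<sigma> k else \<sigma> k + m - 1) - 1) = zs ! (k - 1)"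
      if "k \<in> {1..n}" "k \<noteq> i" for k
      using L1[of "\<sigma> k"] L3[of "\<sigma> k"] \<sigma>b[OF that(1)] \<sigma>s[OF that(1)] \<sigma>ne[OF that(2)] p
      by (auto simp: N_def)
    consider "j < i" | "i \<le> j" "j < i + m" | "i + m \<le> j" by linarith
    then show ?thesis
    proof cases
      case 1
      then have "bp j = (if \<sigma> j < p then \<sigma> j else \<sigma> j + m - 1)"
        using j by (auto simp: bp_def block_perm_def Let_def \<sigma>i N_def)
      moreover have "zs ! (j - 1) = (xs @ ys @ xs') ! (j - 1)"
        using 1 j by (auto simp: zs_def nth_append i_def)
      moreover have "j \<in> {1..n}" using 1 i j by auto
      ultimately show ?thesis using shift[of j] 1 by auto
    next
      case 2
      then have b: "bp j = p - 1 + \<tau> (j - i + 1)"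
        using j by (auto simp: bp_def block_perm_def Let_def \<sigma>i N_def)
      have t: "j - i + 1 \<in> {1..m}" using 2 by auto
      have "ys ! (j - i) = (xs @ ys @ xs') ! (j - 1)"
        using 2 by (auto simp: nth_append i_def m_def)
      moreover have "bp j \<in> {1..N}"
        using b \<tau>b[OF t] p unfolding N_def atLeastAtMost_iff by linarith
      ultimately show ?thesis using \<tau>b[OF t] \<tau>s[OF t] b L2[of "\<tau> (j - i + 1)"] by auto
    next
      case 3
      then have b: "bp j = (if \<sigma> (j + 1 - m) < p then \<sigma> (j + 1 - m) else \<sigma> (j + 1 - m) + m - 1)"
        using j by (auto simp: bp_def block_perm_def Let_def \<sigma>i N_def)
      have "zs ! (j + 1 - m - 1) = (xs @ ys @ xs') ! (j - 1)"
      proof -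
        obtain k where "j = i + m + k" using 3 le_Suc_ex by blast
        then show ?thesis by (simp add: zs_def nth_append i_def m_def)
      qed
      moreover have "j + 1 - m \<in> {1..n}" "j + 1 - m \<noteq> i" using 3 j i by (auto simp: N_def)
      ultimately show ?thesis using shift[of "j + 1 - m"] b by auto
    qed
  qed
  define js where "js = map bp [1..<N + 1]"
  have lys: "length (xs @ ys @ xs') = N"
    by (simp add: N_def n_def m_def zs_def)
  have js: "map (\<lambda>q. L ! (q - 1)) js = xs @ ys @ xs'"
    by (rule nth_equalityI) (use key lys in \<open>auto simp: js_def simp del: upt_Suc\<close>)
  have dL: "distinct (xs @ ys @ xs')"
    using zs ys disj by auto
  have "distinct js" using dL js by (metis distinct_map)
  moreover have "set js \<subseteq> {1..N}" using key by (auto simp: js_def simp del: upt_Suc)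
  moreover have "length js = N" by (simp add: js_def)
  ultimately have arr: "arrangement js N"
    by (simp add: arrangement_def card_subset_eq distinct_card)
  have bpjs: "bp = position_perm js"
  proof
    fix j show "bp j = position_perm js j"
      by (auto simp: position_perm_def js_def bp_def block_perm_def N_def simp del: upt_Suc)
  qed
  have "Y \<inter> (X - {x}) = {}" using disj by (auto simp: X_def Y_def zs_def)
  from circ_list(1)[OF fX x this] have dist_L: "distinct L" by (simp add: L_def p_def)
  have pc: "pcomp P n m i v w \<in> part P N (d + e)"
    unfolding N_def using v w i by (intro pcomp_part) (auto simp: n_def zs_def m_def)
  have "circ X x Y (lab P zs v) (lab P ys w) = lab P L (pcomp P n m p (act P n \<sigma> v) (act P m \<tau> w))"
  proof -
    have "lab P zs v = act P n \<sigma> v" "lab P ys w = act P m \<tau> w"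
      by (simp_all add: lab_def relabel_conv \<sigma>_def \<tau>_def X_def Y_def n_def m_def)
    then show ?thesis by (simp only: circ_def L_def p_def cX)
  qed
  also have "pcomp P n m p (act P n \<sigma> v) (act P m \<tau> w) = act P N bp (pcomp P n m i v w)"
    unfolding bp_def N_def \<sigma>i[symmetric]
    using v w by (intro pcomp_act i \<sigma>) (auto simp: n_def zs_def m_def)
  also have "act P N bp (pcomp P n m i v w) = relabel P js (pcomp P n m i v w)"
    by (simp add: relabel_conv bpjs arrangement_length[OF arr])
  also have "lab P L (relabel P js (pcomp P n m i v w)) = lab P (xs @ ys @ xs') (pcomp P n m i v w)"
    using lab_relabel[of L js "pcomp P n m i v w" "d + e", OF dist_L] arr pc by (simp only: lL js)
  finally show ?thesis by (simp add: X_def Y_def zs_def n_def m_def i_def)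
qed

lemma obtain_labelled:
  assumes "finite X" "v \<in> part P (card X) d"
  obtains xs v' where "distinct xs" "set xs = X" "length xs = card X"
    "v' \<in> part P (length xs) d" "v = lab P xs v'"
proof -
  let ?xs = "sorted_of X"
  obtain v' where "v' \<in> part P (length ?xs) d" "v = lab P ?xs v'"
    using lab_surj[of ?xs "card X" v d] assms by auto
  then show ?thesis using that[of ?xs v'] assms(1) by simp
qed

lemma obtain_labelled_Cons:
  assumes "finite X" "x \<in> X" "v \<in> part P (card X) d"
  obtains xs v' where "distinct (x # xs)" "set (x # xs) = X" "length (x # xs) = card X"
    "v' \<in> part P (length (x # xs)) d" "v = lab P (x # xs) v'"
proof -
  let ?xs = "x # sorted_of (X - {x})"
  have s: "distinct ?xs" "set ?xs = X" using assms by auto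
  then have l: "length ?xs = card X" using distinct_card[of ?xs] by simp
  obtain v' where "v' \<in> part P (length ?xs) d" "v = lab P ?xs v'"
    using lab_surj[OF s(1) l assms(3)] l by metis
  then show ?thesis using that[of "sorted_of (X - {x})" v'] s l by blast
qed

lemma circ_lab_Cons:
  assumes "distinct (x # xs)" "distinct ys" "set ys \<inter> set xs = {}"
    and "v \<in> part P (length (x # xs)) d" "w \<in> part P (length ys) e"
    and "X = set (x # xs)" "Y = set ys"
  shows "circ X x Y (lab P (x # xs) v) (lab P ys w) =
    lab P (ys @ xs) (pcomp P (length (x # xs)) (length ys) 1 v w)"
  using circ_lab[of "[]" x xs ys v d w e] assms by simp

lemma additive_pcomp_left:
  assumes "i \<in> {1..n}" "y \<in> part P m e"
  shows "additive_on (part P n d) (\<lambda>x. pcomp P n m i x y)"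
  unfolding additive_on_def using subgroup_part pcomp_add_left[OF assms(1) _ _ assms(2)] by blast

lemma additive_pcomp_right:
  assumes "i \<in> {1..n}" "x \<in> part P n d"
  shows "additive_on (part P m e) (pcomp P n m i x)"
  unfolding additive_on_def using subgroup_part pcomp_add_right[OF assms] by blast

context
  fixes X Y :: "nat set" and x :: nat
  assumes X: "finite X" "finite Y" "x \<in> X" "Y \<inter> (X - {x}) = {}"
begin

lemmas result_labels = circ_list[OF X]
  and insertion_rank = rank_bounds[OF X(1,3)]

lemma circ_part:
  assumes "v \<in> part P (card X) d" "w \<in> part P (card Y) e"
  shows "circ X x Y v w \<in> part P (card X + card Y - 1) (d + e)"
  using lab_part[OF result_labels(1)] pcomp_part[OF insertion_rank assms] unfolding circ_def result_labels(3) by blast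

lemma additive_circ_left:
  assumes "w \<in> part P (card Y) e"
  shows "additive_on (part P (card X) d) (\<lambda>v. circ X x Y v w)"
  unfolding circ_def
  by (rule additive_on_comp[OF additive_pcomp_left[OF insertion_rank assms] additive_lab[OF result_labels(1), unfolded result_labels(3)]
        pcomp_part[OF insertion_rank _ assms]])

lemma additive_circ_right:
  assumes "v \<in> part P (card X) d"
  shows "additive_on (part P (card Y) e) (circ X x Y v)"
  unfolding circ_def
  by (rule additive_on_comp[OF additive_pcomp_right[OF insertion_rank assms] additive_lab[OF result_labels(1), unfolded result_labels(3)]
        pcomp_part[OF insertion_rank assms]])

end

text \<open>
  With the label \<open>x\<close> in front of \<open>v\<close> and \<open>y\<close> in front of \<open>w\<close>, all compositions are at first inputs.
\<close>
lemma circ_nested: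
  assumes fin: "finite X" "finite Y" "finite Z" and mem: "x \<in> X" "y \<in> Y"
    and disj: "Y \<inter> (X - {x}) = {}" "Z \<inter> (X - {x}) = {}" "Z \<inter> (Y - {y}) = {}"
    and vwu: "v \<in> part P (card X) d" "w \<in> part P (card Y) e" "u \<in> part P (card Z) f"
  shows "circ (X - {x} \<union> Y) y Z (circ X x Y v w) u = circ X x (Y - {y} \<union> Z) v (circ Y y Z w u)"
proof -
  obtain xs v' where v: "distinct (x # xs)"
    "set (x # xs) = X" "length (x # xs) = card X" "v' \<in> part P (length (x # xs)) d"
    "v = lab P (x # xs) v'"
    by (rule obtain_labelled_Cons[OF fin(1) mem(1) vwu(1)])
  obtain ys w' where w: "distinct (y # ys)"
    "set (y # ys) = Y" "length (y # ys) = card Y" "w' \<in> part P (length (y # ys)) e"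
    "w = lab P (y # ys) w'"
    by (rule obtain_labelled_Cons[OF fin(2) mem(2) vwu(2)])
  obtain zs u' where u: "distinct zs" "set zs = Z"
    "length zs = card Z" "u' \<in> part P (length zs) f" "u = lab P zs u'"
    by (rule obtain_labelled[OF fin(3) vwu(3)])
  have xs: "set xs = X - {x}" and ys: "set ys = Y - {y}" using v w by auto
  let ?n = "length (x # xs)" and ?m = "length (y # ys)" and ?k = "length zs"
  have p1: "pcomp P ?n ?m 1 v' w' \<in> part P (?n + ?m - 1) (d + e)"
    using v w by (intro pcomp_part) auto
  have p2: "pcomp P ?m ?k 1 w' u' \<in> part P (?m + ?k - 1) (e + f)"
    using u w by (intro pcomp_part) auto
  have "circ X x Y v w = lab P ((y # ys) @ xs) (pcomp P ?n ?m 1 v' w')"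
    unfolding v(5) w(5) using v w disj xs ys by (intro circ_lab_Cons) auto
  then have "circ (X - {x} \<union> Y) y Z (circ X x Y v w) u =
      circ (X - {x} \<union> Y) y Z (lab P (y # (ys @ xs)) (pcomp P ?n ?m 1 v' w')) (lab P zs u')"
    by (simp add: u)
  also have "\<dots> = lab P (zs @ (ys @ xs)) (pcomp P (length (y # (ys @ xs))) ?k 1 (pcomp P ?n ?m 1 v' w') u')"
  proof (rule circ_lab_Cons)
    show "distinct (y # ys @ xs)" "set zs \<inter> set (ys @ xs) = {}" "X - {x} \<union> Y = set (y # ys @ xs)"
      using v w u disj xs ys mem by auto
    show "pcomp P ?n ?m 1 v' w' \<in> part P (length (y # ys @ xs)) (d + e)"
      using p1 by (simp add: add.commute)
  qed (use u in auto)
  also have "length (y # (ys @ xs)) = ?n + ?m - 1" by simp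
  also have "pcomp P (?n + ?m - 1) ?k 1 (pcomp P ?n ?m 1 v' w') u' =
      pcomp P ?n (?m + ?k - 1) 1 v' (pcomp P ?m ?k 1 w' u')"
  proof -
    have "pcomp P (?n + ?m - 1) ?k (1 - 1 + 1) (pcomp P ?n ?m 1 v' w') u' =
        pcomp P ?n (?m + ?k - 1) 1 v' (pcomp P ?m ?k 1 w' u')"
      by (rule pcomp_nested[OF _ _ v(4) w(4) u(4)]) auto
    then show ?thesis by simp
  qed
  finally have l: "circ (X - {x} \<union> Y) y Z (circ X x Y v w) u =
     lab P (zs @ ys @ xs) (pcomp P ?n (?m + ?k - 1) 1 v' (pcomp P ?m ?k 1 w' u'))" .
  have "circ Y y Z w u = lab P (zs @ ys) (pcomp P ?m ?k 1 w' u')"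
    unfolding u(5) w(5) using u w disj ys by (intro circ_lab_Cons) auto
  then have "circ X x (Y - {y} \<union> Z) v (circ Y y Z w u) =
      circ X x (Y - {y} \<union> Z) (lab P (x # xs) v') (lab P (zs @ ys) (pcomp P ?m ?k 1 w' u'))"
    by (simp add: v)
  also have "\<dots> = lab P ((zs @ ys) @ xs) (pcomp P ?n (length (zs @ ys)) 1 v' (pcomp P ?m ?k 1 w' u'))"
  proof (rule circ_lab_Cons)
    show "distinct (zs @ ys)" "set (zs @ ys) \<inter> set xs = {}" "Y - {y} \<union> Z = set (zs @ ys)"
      using v w u disj xs ys by auto
    show "pcomp P ?m ?k 1 w' u' \<in> part P (length (zs @ ys)) (e + f)"
      using p2 by (simp add: add.commute)
  qed (use v in auto)
  also have "length (zs @ ys) = ?m + ?k - 1" by simp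
  finally show ?thesis using l by simp
qed

text \<open>
  With \<open>x\<close> and \<open>x'\<close> as the first two labels of \<open>v\<close>, this is the parallel axiom at inputs 1 and 2.
\<close>
lemma circ_parallel:
  assumes fin: "finite X" "finite Y" "finite Z" and mem: "x \<in> X" "x' \<in> X" "x \<noteq> x'"
    and disj: "Y \<inter> (X - {x}) = {}" "Z \<inter> (X - {x'}) = {}" "Y \<inter> Z = {}"
    and vwu: "v \<in> part P (card X) d" "w \<in> part P (card Y) e" "u \<in> part P (card Z) f"
  shows "circ (X - {x} \<union> Y) x' Z (circ X x Y v w) u =
    sgn_pow (e * f) (circ (X - {x'} \<union> Z) x Y (circ X x' Z v u) w)"
proof -
  define xs where "xs = sorted_of (X - {x, x'})"
  have xs: "distinct (x # x' # xs)" "set xs = X - {x, x'}" "set (x # x' # xs) = X"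
    using fin mem by (auto simp: xs_def)
  have lX: "length (x # x' # xs) = card X" using distinct_card[OF xs(1)] xs(3) by simp
  obtain v' where v: "v' \<in> part P (length (x # x' # xs)) d" "v = lab P (x # x' # xs) v'"
    using lab_surj[OF xs(1) lX vwu(1)] lX by metis
  obtain ys w' where w: "distinct ys" "set ys = Y"
    "length ys = card Y" "w' \<in> part P (length ys) e" "w = lab P ys w'"
    by (rule obtain_labelled[OF fin(2) vwu(2)])
  obtain zs u' where u: "distinct zs" "set zs = Z"
    "length zs = card Z" "u' \<in> part P (length zs) f" "u = lab P zs u'"
    by (rule obtain_labelled[OF fin(3) vwu(3)])
  let ?n = "length (x # x' # xs)" and ?m = "length ys" and ?k = "length zs"
  have dxs: "x \<noteq> x'" "x \<notin> set xs" "x' \<notin> set xs" "distinct xs" using xs(1) by auto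
  have dis: "set ys \<inter> set xs = {}" "x' \<notin> set ys" "set zs \<inter> set xs = {}" "x \<notin> set zs"
    "set zs \<inter> set ys = {}"
    unfolding w(2) u(2) xs(2) using disj mem by auto
  have Xs: "X = insert x (insert x' (set xs))" using xs(3) by simp
  have p1: "pcomp P ?n ?m 1 v' w' \<in> part P (?n + ?m - 1) (d + e)"
    using v w by (intro pcomp_part) auto
  have p2: "pcomp P ?n ?k 2 v' u' \<in> part P (?n + ?k - 1) (d + f)"
    using v u by (intro pcomp_part) auto
  have p3: "pcomp P (?n + ?k - 1) ?m 1 (pcomp P ?n ?k 2 v' u') w' \<in> part P (?n + ?k - 1 + ?m - 1) (d + f + e)"
    using w by (intro pcomp_part p2) auto
  have XY: "X - {x} \<union> Y = set (ys @ x' # xs)" using Xs w(2) dxs by auto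
  have "circ X x Y v w = lab P (ys @ x' # xs) (pcomp P ?n ?m 1 v' w')"
    unfolding v(2) w(5) using v(1) w(1,2,4) dxs dis Xs by (intro circ_lab_Cons) auto
  then have "circ (X - {x} \<union> Y) x' Z (circ X x Y v w) u =
      circ (X - {x} \<union> Y) x' Z (lab P (ys @ x' # xs) (pcomp P ?n ?m 1 v' w')) (lab P zs u')"
    by (simp add: u)
  also have "\<dots> = lab P (ys @ zs @ xs) (pcomp P (length (ys @ x' # xs)) ?k (?m + 1) (pcomp P ?n ?m 1 v' w') u')"
    unfolding XY u(2)[symmetric]
  proof (rule circ_lab)
    show "distinct (ys @ x' # xs)" "set zs \<inter> set (ys @ xs) = {}"
      using w(1) dxs dis by auto
    show "pcomp P ?n ?m 1 v' w' \<in> part P (length (ys @ x' # xs)) (d + e)"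
      using p1 by (simp add: add.commute)
  qed (use u in auto)
  also have "length (ys @ x' # xs) = ?n + ?m - 1" by simp
  also have "pcomp P (?n + ?m - 1) ?k (?m + 1) (pcomp P ?n ?m 1 v' w') u' =
      sgn_pow (e * f) (pcomp P (?n + ?k - 1) ?m 1 (pcomp P ?n ?k 2 v' u') w')"
  proof -
    have "pcomp P (?n + ?m - 1) ?k (2 + ?m - 1) (pcomp P ?n ?m 1 v' w') u' =
      sgn_pow (e * f) (pcomp P (?n + ?k - 1) ?m 1 (pcomp P ?n ?k 2 v' u') w')"
      by (rule pcomp_parallel[OF _ _ _ v(1) w(4) u(4)]) auto
    then show ?thesis by simp
  qed
  also have "lab P (ys @ zs @ xs) \<dots> =
      sgn_pow (e * f) (lab P (ys @ zs @ xs) (pcomp P (?n + ?k - 1) ?m 1 (pcomp P ?n ?k 2 v' u') w'))"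
  proof (rule additive_on_sgn_pow[OF additive_lab])
    show "distinct (ys @ zs @ xs)" using w(1) u(1) dxs dis by auto
    show "pcomp P (?n + ?k - 1) ?m 1 (pcomp P ?n ?k 2 v' u') w' \<in> part P (length (ys @ zs @ xs)) (d + f + e)"
      using p3 by (simp add: ac_simps)
  qed
  finally have l: "circ (X - {x} \<union> Y) x' Z (circ X x Y v w) u = 
    sgn_pow (e * f) (lab P (ys @ zs @ xs) (pcomp P (?n + ?k - 1) ?m 1 (pcomp P ?n ?k 2 v' u') w'))" .
  have X: "X = set ([x] @ x' # xs)" using xs(3) by simp
  have "circ (set ([x] @ x' # xs)) x' (set zs) (lab P ([x] @ x' # xs) v') (lab P zs u') =
    lab P ([x] @ zs @ xs) (pcomp P (length ([x] @ x' # xs)) ?k (length [x] + 1) v' u')"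
  proof (rule circ_lab)
    show "distinct ([x] @ x' # xs)" using xs(1) by simp
    show "distinct zs" by (rule u(1))
    show "set zs \<inter> set ([x] @ xs) = {}" using dis by simp
    show "v' \<in> part P (length ([x] @ x' # xs)) d" using v(1) by simp
  qed (rule u(4))
  then have "circ X x' Z v u = lab P ([x] @ zs @ xs) (pcomp P (length ([x] @ x' # xs)) ?k (length [x] + 1) v' u')"
    unfolding X u(5) u(2) v(2) by simp
  then have "circ (X - {x'} \<union> Z) x Y (circ X x' Z v u) w =
      circ (X - {x'} \<union> Z) x Y (lab P (x # (zs @ xs)) (pcomp P ?n ?k 2 v' u')) (lab P ys w')"
    by (simp add: w numeral_2_eq_2)
  also have "\<dots> = lab P (ys @ (zs @ xs)) (pcomp P (length (x # (zs @ xs))) ?m 1 (pcomp P ?n ?k 2 v' u') w')"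
  proof (rule circ_lab_Cons)
    show "distinct (x # (zs @ xs))" using u(1) dxs dis by auto
    show "set ys \<inter> set (zs @ xs) = {}" using dis by auto
    show "X - {x'} \<union> Z = set (x # zs @ xs)" using Xs u(2) dxs by auto
    show "pcomp P ?n ?k 2 v' u' \<in> part P (length (x # (zs @ xs))) (d + f)"
      using p2 by (simp add: add.commute)
  qed (use w in auto)
  also have "length (x # (zs @ xs)) = ?n + ?k - 1" by simp
  finally show ?thesis using l by simp
qed

end

context dg_operad
begin

lemma additive_dif: "additive_on (part P n d) (dif P n d)"
  by (simp add: additive_on_def subgroup_part dif_add)

lemma dif_lab:
  assumes "distinct xs" "v \<in> part P (length xs) d"
  shows "dif P (length xs) d (lab P xs v) = lab P xs (dif P (length xs) d v)"
  using dif_act[OF position_perm_permutes[OF arrangement_map_rank[OF assms(1)]] assms(2)]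
  by (simp add: lab_def relabel_conv)

lemma dif_circ:
  assumes X: "finite X" "finite Y" "x \<in> X" "Y \<inter> (X - {x}) = {}"
    and v: "v \<in> part P (card X) d" and w: "w \<in> part P (card Y) e"
  shows "dif P (card X + card Y - 1) (d + e) (circ X x Y v w) =
    circ X x Y (dif P (card X) d v) w + sgn_pow d (circ X x Y v (dif P (card Y) e w))"
proof -
  note L = circ_list[OF X] and r = rank_bounds[OF X(1,3)]
  let ?p = "pcomp P (card X) (card Y) (rank X x)"
  have p: "?p (dif P (card X) d v) w \<in> part P (card X + card Y - 1) (d + e + 1)"
    "?p v (dif P (card Y) e w) \<in> part P (card X + card Y - 1) (d + e + 1)"
    using pcomp_part[OF r dif_part[OF v] w] pcomp_part[OF r v dif_part[OF w]]
    by (simp_all add: algebra_simps)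
  note lab = additive_lab[OF L(1), unfolded L(3), of "d + e + 1"]
  have "dif P (card X + card Y - 1) (d + e) (circ X x Y v w) =
      lab P (take (rank X x - 1) (sorted_of X) @ sorted_of Y @ drop (rank X x) (sorted_of X))
        (?p (dif P (card X) d v) w + sgn_pow d (?p v (dif P (card Y) e w)))"
    unfolding circ_def dif_lab[OF L(1), unfolded L(3), OF pcomp_part[OF r v w]] dif_pcomp[OF r v w] ..
  then show ?thesis
    unfolding circ_def
    using additive_on_add[OF lab p(1) subgroup_sgn_pow[OF subgroup_part p(2), of d]]
      additive_on_sgn_pow[OF lab p(2), of d] by simp
qed

end

section \<open>Shuffles as subsets\<close>

lemma sorted_of_unique:
  "sorted xs \<Longrightarrow> distinct xs \<Longrightarrow> sorted_of (set xs) = xs"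
  by (rule sorted_distinct_set_unique) auto

lemma sorted_map_strict_mono_on:
  assumes "strict_mono_on {i..<j} \<sigma>"
  shows "sorted_of (\<sigma> ` {i..<j}) = map \<sigma> [i..<j :: nat]"
proof -
  have "sorted_wrt (<) (map \<sigma> [i..<j])"
    unfolding sorted_wrt_map
    by (rule sorted_wrt_mono_rel[OF _ sorted_wrt_upt]) (auto intro: strict_mono_onD[OF assms])
  then show ?thesis
    using sorted_of_unique[of "map \<sigma> [i..<j]"] by (simp add: strict_sorted_iff)
qed

lemma strict_mono_on_nth_shift:
  fixes xs :: "nat list"
  assumes "sorted_wrt (<) xs" "\<And>j. j \<in> {k + 1..k + length xs} \<Longrightarrow> g j = xs ! (j - k - 1)"
  shows "strict_mono_on {k + 1..k + length xs} g"
  using assms sorted_wrt_nth_less[OF assms(1)] by (intro strict_mono_onI) auto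

lemma Sh_blocks:
  assumes "\<sigma> \<in> Sh p q"
  shows "map \<sigma> [1..<p + 1] = sorted_of (\<sigma> ` {1..p})"
    and "map \<sigma> [p + 1..<p + q + 1] = sorted_of ({1..p + q} - \<sigma> ` {1..p})"
    and "\<sigma> ` {1..p} \<subseteq> {1..p + q}" "card (\<sigma> ` {1..p}) = p"
proof -
  have s: "\<sigma> permutes {1..p + q}" "strict_mono_on {1..p} \<sigma>" "strict_mono_on {p + 1..p + q} \<sigma>"
    using assms by (auto simp: Sh_def)
  have iv: "{1..<p + 1} = {1..p}" "{p + 1..<p + q + 1} = {p + 1..p + q}" by auto
  show "map \<sigma> [1..<p + 1] = sorted_of (\<sigma> ` {1..p})"
    using sorted_map_strict_mono_on[of 1 "p + 1" \<sigma>] s(2) unfolding iv by simp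
  have "\<sigma> ` ({1..p + q} - {1..p}) = {1..p + q} - \<sigma> ` {1..p}"
    using permutes_image[OF s(1)] permutes_inj[OF s(1)] by (simp add: image_set_diff)
  moreover have "{1..p + q} - {1..p} = {p + 1..p + q}" by auto
  ultimately show "map \<sigma> [p + 1..<p + q + 1] = sorted_of ({1..p + q} - \<sigma> ` {1..p})"
    using sorted_map_strict_mono_on[of "p + 1" "p + q + 1" \<sigma>] s(3) unfolding iv by simp
  show "\<sigma> ` {1..p} \<subseteq> {1..p + q}"
    using permutes_image[OF s(1)] image_mono[of "{1..p}" "{1..p + q}" \<sigma>] by auto
  show "card (\<sigma> ` {1..p}) = p"
    using permutes_inj_on[OF s(1), of "{1..p}"] by (simp add: card_image)
qed

lemma Sh_of_subset:
  assumes "S \<subseteq> {1..p + q}" "card S = p"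
  defines "\<sigma> \<equiv> position_perm (sorted_of S @ sorted_of ({1..p + q} - S))"
  shows "\<sigma> \<in> Sh p q" "\<sigma> ` {1..p} = S"
proof -
  let ?T = "{1..p + q} - S" and ?js = "sorted_of S @ sorted_of ({1..p + q} - S)"
  have f: "finite S" using assms(1) finite_subset by blast
  have cT: "card ?T = q" using assms f by (simp add: card_Diff_subset)
  have l: "length (sorted_of S) = p" "length (sorted_of ?T) = q" "length ?js = p + q"
    using assms(2) cT by simp_all
  have "arrangement ?js (p + q)" using assms(1) f by (auto simp: arrangement_def)
  then have "\<sigma> permutes {1..p + q}" unfolding \<sigma>_def by (rule position_perm_permutes)
  moreover have "strict_mono_on {0 + 1..0 + length (sorted_of S)} \<sigma>"
    by (rule strict_mono_on_nth_shift)
      (use l in \<open>auto simp: \<sigma>_def position_perm_def nth_append\<close>)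
  moreover have "strict_mono_on {p + 1..p + length (sorted_of ?T)} \<sigma>"
    by (rule strict_mono_on_nth_shift)
      (use l assms(2) in \<open>auto simp: \<sigma>_def position_perm_def nth_append\<close>)
  ultimately show "\<sigma> \<in> Sh p q" using l by (auto simp: Sh_def)
  have "map \<sigma> [1..<p + 1] = sorted_of S"
    by (rule nth_equalityI) (use l in \<open>auto simp: \<sigma>_def position_perm_def nth_append simp del: upt_Suc\<close>)
  then have "\<sigma> ` set [1..<p + 1] = S" using f by (metis set_map set_sorted_list_of_set)
  moreover have "set [1..<p + 1] = {1..p}" by auto
  ultimately show "\<sigma> ` {1..p} = S" by simp
qed

text \<open>
  A \<open>(p, q)\<close>-shuffle is determined by the image of \<open>{1..p}\<close>; its two increasing blocks enumerate this
  set and its complement.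
\<close>
lemma sum_Sh:
  "(\<Sum>\<sigma>\<in>Sh p q. G (map \<sigma> [1..<p + 1]) (map \<sigma> [p + 1..<p + q + 1])) =
   (\<Sum>S | S \<subseteq> {1..p + q} \<and> card S = p. G (sorted_of S) (sorted_of ({1..p + q} - S)))"
proof (rule sum.reindex_bij_witness[where
    i = "\<lambda>S. position_perm (sorted_of S @ sorted_of ({1..p + q} - S))" and j = "\<lambda>\<sigma>. \<sigma> ` {1..p}"])
  fix \<sigma> assume \<sigma>: "\<sigma> \<in> Sh p q"
  then have s: "\<sigma> permutes {1..p + q}" by (simp add: Sh_def)
  have "[1..<p + 1] @ [p + 1..<p + q + 1] = [1..<p + q + 1]"
    using upt_add_eq_append[of 1 "p + 1" q] by simp
  then have "position_perm (map \<sigma> [1..<p + 1] @ map \<sigma> [p + 1..<p + q + 1]) = \<sigma>"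
    using position_perm_map_upt[OF s] by (simp del: upt_Suc flip: map_append)
  then show "position_perm (sorted_of (\<sigma> ` {1..p}) @ sorted_of ({1..p + q} - \<sigma> ` {1..p})) = \<sigma>"
    by (simp only: Sh_blocks[OF \<sigma>])
  show "\<sigma> ` {1..p} \<in> {S. S \<subseteq> {1..p + q} \<and> card S = p}" using Sh_blocks[OF \<sigma>] by blast
  show "G (sorted_of (\<sigma> ` {1..p})) (sorted_of ({1..p + q} - \<sigma> ` {1..p})) =
      G (map \<sigma> [1..<p + 1]) (map \<sigma> [p + 1..<p + q + 1])"
    by (simp only: Sh_blocks[OF \<sigma>])
qed (use Sh_of_subset in auto)

lemma sum_over_card:
  assumes "finite B"
  shows "(\<Sum>p=0..card B. \<Sum>S | S \<subseteq> B \<and> card S = p. h S) = (\<Sum>S\<in>Pow B. h S)"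
proof -
  have "(\<Sum>S\<in>Pow B. h S) = (\<Sum>p=0..card B. \<Sum>S | S \<in> Pow B \<and> card S = p. h S)"
    by (rule sum.group[symmetric]) (use assms in \<open>auto intro: card_mono\<close>)
  then show ?thesis by (simp add: Pow_def)
qed

lemma sum_Sh_all:
  "(\<Sum>p=0..r. \<Sum>\<sigma>\<in>Sh p (r - p). G p (map \<sigma> [1..<p + 1]) (map \<sigma> [p + 1..<r + 1])) =
   (\<Sum>S\<in>Pow {1..r}. G (card S) (sorted_of S) (sorted_of ({1..r} - S)))"
proof -
  have "(\<Sum>p=0..r. \<Sum>\<sigma>\<in>Sh p (r - p). G p (map \<sigma> [1..<p + 1]) (map \<sigma> [p + 1..<r + 1])) =
    (\<Sum>p=0..r. \<Sum>S | S \<subseteq> {1..r} \<and> card S = p. G (card S) (sorted_of S) (sorted_of ({1..r} - S)))"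
  proof (rule sum.cong[OF refl])
    fix p assume "p \<in> {0..r}"
    then have "p + (r - p) = r" by simp
    then show "(\<Sum>\<sigma>\<in>Sh p (r - p). G p (map \<sigma> [1..<p + 1]) (map \<sigma> [p + 1..<r + 1])) =
        (\<Sum>S | S \<subseteq> {1..r} \<and> card S = p. G (card S) (sorted_of S) (sorted_of ({1..r} - S)))"
      using sum_Sh[of "G p" p "r - p"] by (simp del: upt_Suc cong: conj_cong)
  qed
  also have "\<dots> = (\<Sum>S\<in>Pow {1..r}. G (card S) (sorted_of S) (sorted_of ({1..r} - S)))"
    using sum_over_card[of "{1..r}" "\<lambda>S. G (card S) (sorted_of S) (sorted_of ({1..r} - S))"]
    by simp
  finally show ?thesis .
qed

lemma sum_Sh_nonempty:
  "(\<Sum>p=1..r. \<Sum>\<sigma>\<in>Sh p (r - p). G p (map \<sigma> [1..<p + 1]) (map \<sigma> [p + 1..<r + 1])) =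
   (\<Sum>S\<in>Pow {1..r} - {{}}. G (card S) (sorted_of S) (sorted_of ({1..r} - S)))"
proof -
  \<comment> \<open>the summand for \<open>p = 0\<close> is the one of the empty set\<close>
  define G' where "G' p xs ys = (if p = 0 then 0 else G p xs ys)" for p xs ys
  have "(\<Sum>p=1..r. \<Sum>\<sigma>\<in>Sh p (r - p). G p (map \<sigma> [1..<p + 1]) (map \<sigma> [p + 1..<r + 1])) =
      (\<Sum>p=0..r. \<Sum>\<sigma>\<in>Sh p (r - p). G' p (map \<sigma> [1..<p + 1]) (map \<sigma> [p + 1..<r + 1]))"
    by (rule sum.mono_neutral_cong_left) (auto simp: G'_def not_less_eq_eq)
  also have "\<dots> = (\<Sum>S\<in>Pow {1..r}. G' (card S) (sorted_of S) (sorted_of ({1..r} - S)))"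
    by (rule sum_Sh_all)
  also have "\<dots> = (\<Sum>S\<in>Pow {1..r} - {{}}. G (card S) (sorted_of S) (sorted_of ({1..r} - S)))"
    by (rule sum.mono_neutral_cong_right) (auto simp: G'_def finite_subset)
  finally show ?thesis .
qed

section \<open>Twisted elements on arbitrary label sets\<close>

context graded_operad
begin

text \<open>
  The element \<open>f\<close> evaluated on the label set \<open>X\<close>: the labels \<open>\<nu>\<close> belong, in this order, to the last
  inputs of \<open>f\<close>, and the other labels to the inputs in which \<open>f\<close> is symmetric. So \<open>f\<close> becomes a family
  of operations, one for each finite set containing \<open>\<nu>\<close>.
\<close>
definition fam :: "(nat \<Rightarrow> 'a) \<Rightarrow> nat list \<Rightarrow> nat set \<Rightarrow> 'a" where
  "fam f \<nu> X = lab P (sorted_of (X - set \<nu>) @ \<nu>) (f (card (X - set \<nu>)))"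

lemma tw_partD:
  assumes "f \<in> tw_part P n d"
  shows "f r \<in> part P (r + n) (d - 2 * int r)"
    and "\<sigma> permutes {1..r} \<Longrightarrow> act P (r + n) \<sigma> (f r) = f r"
  using assms by (auto simp: tw_part_def)

text \<open>
  The order of the symmetric inputs is irrelevant: an enumeration \<open>zs\<close> differs from the increasing one by
  a permutation of \<open>{1..length zs}\<close>, which fixes \<open>v\<close>.
\<close>
lemma lab_invariant:
  assumes f: "v \<in> part P (length zs + length \<nu>) d"
    and inv: "\<And>\<sigma>. \<sigma> permutes {1..length zs} \<Longrightarrow> act P (length zs + length \<nu>) \<sigma> v = v"
    and zs: "distinct (zs @ \<nu>)"
  shows "lab P (zs @ \<nu>) v = lab P (sorted_of (set zs) @ \<nu>) v"
proof -
  let ?s = "sorted_of (set zs)" and ?r = "length zs" and ?n = "length \<nu>"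
  let ?js = "map (rank (set zs)) zs"
  define \<sigma> where "\<sigma> = position_perm ?js"
  have dz: "distinct zs" and ls: "length ?s = ?r" using zs by (auto simp: distinct_card)
  have js: "arrangement ?js ?r" by (rule arrangement_map_rank[OF dz])
  have \<sigma>: "\<sigma> permutes {1..?r}" unfolding \<sigma>_def by (rule position_perm_permutes[OF js])
  then have \<sigma>': "\<sigma> permutes {1..?r + ?n}" by (rule permutes_subset) auto
  have "map (\<lambda>i. (?s @ \<nu>) ! (\<sigma> i - 1)) [1..<?r + ?n + 1] = zs @ \<nu>"
  proof (rule nth_equalityI)
    fix i assume "i < length (map (\<lambda>i. (?s @ \<nu>) ! (\<sigma> i - 1)) [1..<?r + ?n + 1])"
    then have i: "i < ?r + ?n" by (simp del: upt_Suc)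
    show "map (\<lambda>i. (?s @ \<nu>) ! (\<sigma> i - 1)) [1..<?r + ?n + 1] ! i = (zs @ \<nu>) ! i"
    proof (cases "i < ?r")
      case True
      then have "\<sigma> (i + 1) = rank (set zs) (zs ! i)" by (simp add: \<sigma>_def position_perm_def)
      moreover have "zs ! i \<in> set zs" using True by simp
      ultimately show ?thesis
        using True i ls sorted_of_rank[of "set zs" "zs ! i"] rank_bounds[of "set zs" "zs ! i"]
          distinct_card[OF dz]
        by (auto simp: nth_append simp del: upt_Suc)
    next
      case False
      then have "\<sigma> (i + 1) = i + 1" by (simp add: \<sigma>_def position_perm_def)
      then show ?thesis using False i ls by (simp add: nth_append del: upt_Suc)
    qed
  qed (simp del: upt_Suc)
  then show ?thesis
    using lab_act[of "?s @ \<nu>" \<sigma> v d] zs \<sigma>' f inv[OF \<sigma>] ls by (simp del: upt_Suc)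
qed

lemma fam_eq:
  assumes f: "f \<in> tw_part P n d" and zs: "distinct (zs @ \<nu>)" "length \<nu> = n"
    and X: "X = set (zs @ \<nu>)"
  shows "fam f \<nu> X = lab P (zs @ \<nu>) (f (length zs))"
proof -
  have "X - set \<nu> = set zs" using X zs by auto
  then show ?thesis
    using lab_invariant[of "f (length zs)" zs \<nu> "d - 2 * int (length zs)"] tw_partD[OF f] zs
    by (simp add: fam_def distinct_card)
qed

lemma fam_part:
  assumes f: "f \<in> tw_part P n d" and "distinct \<nu>" "length \<nu> = n" "finite X" "set \<nu> \<subseteq> X"
  shows "fam f \<nu> X \<in> part P (card X) (d - 2 * int (card (X - set \<nu>)))"
proof -
  let ?zs = "sorted_of (X - set \<nu>) @ \<nu>" and ?r = "card (X - set \<nu>)"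
  have "card X = ?r + n"
    using assms card_mono[OF assms(4,5)]
    by (simp add: card_Diff_subset distinct_card)
  moreover have "lab P ?zs (f ?r) \<in> part P (length ?zs) (d - 2 * int ?r)"
    by (rule lab_part) (use assms tw_partD(1)[OF f] in auto)
  ultimately show ?thesis using assms(3) by (simp add: fam_def)
qed

end

section \<open>Contracting a set of labels\<close>

text \<open>
  The sets of labels that one operation \<open>\<mu>\<close> inserted into \<open>f\<close> may carry, when \<open>V\<close> are the labels of the
  non-symmetric inputs of \<open>f\<close>. Without a label from \<open>V\<close> the operation \<open>\<mu>\<close> goes into one of the symmetric
  inputs of \<open>f\<close>; with the single label \<open>i \<in> V\<close> it goes into the input \<open>i\<close>.
\<close>
definition contractions :: "nat set \<Rightarrow> nat set \<Rightarrow> nat set set" where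
  "contractions V X = {S. S \<subseteq> X \<and> S \<noteq> {} \<and> (S \<inter> V = {} \<or> (\<exists>i. S \<inter> V = {i}))}"

text \<open>
  The name of the input of \<open>f\<close> that receives the operation with labels \<open>S\<close>. In a symmetric input any label
  outside the remaining ones would do; the choice of \<open>Min S\<close> has the virtue that contracting \<open>S\<close> first and
  a larger set afterwards gives the same label as contracting the union at once, see
  \<open>nested_contraction\<close>.
\<close>
definition pt :: "nat set \<Rightarrow> nat set \<Rightarrow> nat" where
  "pt V S = (if S \<inter> V = {} then Min S else the_elem (S \<inter> V))"

text \<open>
  The labels that remain after \<open>S\<close> is contracted to a point.
\<close>
definition quot :: "nat set \<Rightarrow> nat set \<Rightarrow> nat set \<Rightarrow> nat set" where
  "quot V X S = X - S \<union> {pt V S}"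

lemma contractionsD:
  assumes "S \<in> contractions V X" "finite X"
  shows "S \<subseteq> X" "finite S" "S \<noteq> {}" "pt V S \<in> S" "S \<inter> V \<subseteq> {pt V S}"
    "S \<inter> V = {} \<Longrightarrow> pt V S = Min S" "card S \<ge> 1"
proof -
  show *: "S \<subseteq> X" "S \<noteq> {}" using assms by (auto simp: contractions_def)
  show f: "finite S" by (rule finite_subset[OF *(1) assms(2)])
  show "pt V S \<in> S" "S \<inter> V \<subseteq> {pt V S}" "S \<inter> V = {} \<Longrightarrow> pt V S = Min S"
    using assms f * by (auto simp: contractions_def pt_def)
  show "card S \<ge> 1" using f * card_gt_0_iff[of S] by linarith
qed

lemma contractionsI: "S \<subseteq> X \<Longrightarrow> S \<noteq> {} \<Longrightarrow> S \<inter> V \<subseteq> {i} \<Longrightarrow> S \<in> contractions V X"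
  unfolding contractions_def by blast

lemma contractions_mono: "S \<in> contractions V X \<Longrightarrow> S \<subseteq> Y \<Longrightarrow> S \<in> contractions V Y"
  by (auto simp: contractions_def)

lemma pt_eq_of_Int:
  assumes "S \<in> contractions V X" "T \<in> contractions V Y" "finite X" "finite Y"
    and "S \<inter> V = T \<inter> V" "S \<inter> V = {} \<Longrightarrow> Min S = Min T"
  shows "pt V S = pt V T"
  using assms by (auto simp: pt_def)

text \<open>
  Contracting \<open>S\<close> and then a set \<open>T\<close> that contains the new point is contracting \<open>U\<close>, where \<open>U\<close> is \<open>T\<close>
  with its point blown up to \<open>S\<close>.
\<close>
lemma nested_contraction:
  assumes X: "finite X" and S: "S \<in> contractions V X" and T: "T \<in> contractions V (quot V X S)"
    and pT: "pt V S \<in> T"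
  defines "U \<equiv> T - {pt V S} \<union> S"
  shows "U \<in> contractions V X" "S \<subseteq> U" "pt V U = pt V T" "quot V (quot V X S) T = quot V X U"
    "T = quot V U S"
proof -
  have fq: "finite (quot V X S)" using X by (simp add: quot_def)
  note s = contractionsD[OF S X] and t = contractionsD[OF T fq]
  have TX: "T \<subseteq> X - S \<union> {pt V S}" using t(1) by (simp add: quot_def)
  have UV: "U \<inter> V = T \<inter> V" using s(4,5) pT unfolding U_def by auto
  show SU: "S \<subseteq> U" by (simp add: U_def)
  show U: "U \<in> contractions V X"
  proof (rule contractionsI[where i = "pt V T"])
    show "U \<subseteq> X" using TX s(1) unfolding U_def by blast
    show "U \<noteq> {}" using SU s(3) by blast
    show "U \<inter> V \<subseteq> {pt V T}" using UV t(5) by simp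
  qed
  note u = contractionsD[OF U X]
  show TU: "T = quot V U S"
  proof (intro equalityI subsetI)
    fix x assume "x \<in> T"
    then show "x \<in> quot V U S" using TX unfolding U_def quot_def by auto
  next
    fix x assume "x \<in> quot V U S"
    then show "x \<in> T" using pT unfolding U_def quot_def by auto
  qed
  show p: "pt V U = pt V T"
  proof (rule pt_eq_of_Int[OF U T X fq UV])
    assume "U \<inter> V = {}"
    then have m: "pt V S = Min S" using s(6) SU by auto
    show "Min U = Min T"
    proof (rule Min_eqI)
      show "finite U" by (rule u(2))
      have "Min T \<in> T" using t by simp
      then show "Min T \<in> U" using s(4) unfolding U_def by auto
      fix y assume "y \<in> U"
      then consider "y \<in> S" | "y \<in> T" unfolding U_def by auto
      then show "Min T \<le> y"
      proof cases
        case 1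
        then have "Min S \<le> y" using s by simp
        moreover have "Min T \<le> Min S" using t(2) pT m by simp
        ultimately show ?thesis by simp
      qed (use t in simp)
    qed
  qed
  show "quot V (quot V X S) T = quot V X U"
  proof -
    have "X - S \<union> {pt V S} - T = X - U"
      using pT s(1,4) TX unfolding U_def by auto
    then show ?thesis unfolding quot_def p by simp
  qed
qed

lemma contraction_of_nested:
  assumes X: "finite X" and U: "U \<in> contractions V X" and S: "S \<subseteq> U" "S \<noteq> {}"
  shows "S \<in> contractions V X" "quot V U S \<in> contractions V (quot V X S)" "pt V S \<in> quot V U S"
    "quot V U S - {pt V S} \<union> S = U"
proof -
  note u = contractionsD[OF U X]
  show s0: "S \<in> contractions V X"
    by (rule contractionsI[where i = "pt V U"]) (use S u(1,5) in auto)
  note s = contractionsD[OF s0 X]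
  show "pt V S \<in> quot V U S" by (simp add: quot_def)
  show "quot V U S - {pt V S} \<union> S = U" using S(1) s(4) unfolding quot_def by auto
  show "quot V U S \<in> contractions V (quot V X S)"
  proof (rule contractionsI[where i = "pt V U"])
    show "quot V U S \<subseteq> quot V X S" "quot V U S \<noteq> {}" using u(1) unfolding quot_def by auto
    show "quot V U S \<inter> V \<subseteq> {pt V U}" using u(5) s(4) S unfolding quot_def by auto
  qed
qed

text \<open>
  If the second set avoids the new point, it is disjoint from the first, and the order of the two
  contractions does not matter.
\<close>
lemma parallel_contraction:
  assumes X: "finite X"
  shows "S \<in> contractions V X \<and> T \<in> contractions V (quot V X S) \<and> pt V S \<notin> T \<longleftrightarrow>
    S \<in> contractions V X \<and> T \<in> contractions V X \<and> S \<inter> T = {}"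
proof (intro iffI; elim conjE; intro conjI)
  assume S: "S \<in> contractions V X" and T: "T \<in> contractions V (quot V X S)" "pt V S \<notin> T"
  have sub: "T \<subseteq> X - S" using T by (auto simp: contractions_def quot_def)
  then show "T \<in> contractions V X" "S \<inter> T = {}" using T by (auto intro: contractions_mono)
next
  assume S: "S \<in> contractions V X" and T: "T \<in> contractions V X" "S \<inter> T = {}"
  note s = contractionsD[OF S X]
  have "T \<subseteq> quot V X S" using T by (auto simp: contractions_def quot_def)
  then show "T \<in> contractions V (quot V X S)" using T(1) by (rule contractions_mono[rotated])
  show "pt V S \<notin> T" using s(4) T(2) by auto
qed

lemma quot_props:
  assumes "finite X" "V \<subseteq> X" "S \<in> contractions V X"
  shows "finite (quot V X S)" "V \<subseteq> quot V X S" "quot V X S \<subseteq> X" "S \<inter> (quot V X S - {pt V S}) = {}"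
    "pt V S \<in> quot V X S" "card (quot V X S) + card S - 1 = card X"
    "card (quot V X S - V) + card S = card (X - V) + 1"
proof -
  note s = contractionsD[OF assms(3,1)]
  show 1: "finite (quot V X S)" "V \<subseteq> quot V X S" "quot V X S \<subseteq> X" "S \<inter> (quot V X S - {pt V S}) = {}"
    "pt V S \<in> quot V X S"
    using assms(1,2) s(1,4,5) unfolding quot_def by auto
  have "card (quot V X S) = card (X - S) + 1"
    using assms(1) s(4) by (simp add: quot_def)
  moreover have "card X = card (X - S) + card S"
    using s(1,2) card_mono[OF assms(1) s(1)] by (simp add: card_Diff_subset)
  ultimately have 2: "card (quot V X S) + card S = card X + 1" by simp
  then show "card (quot V X S) + card S - 1 = card X" by simp
  have fV: "finite V" by (rule finite_subset[OF assms(2,1)])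
  have "card (quot V X S - V) + card V = card (quot V X S)" "card (X - V) + card V = card X"
    using card_mono[OF 1(1,2)] card_mono[OF assms(1,2)] fV 1(2) assms(2)
    by (simp_all add: card_Diff_subset)
  then show "card (quot V X S - V) + card S = card (X - V) + 1" using 2 by linarith
qed

lemma split_card:
  assumes "finite X" "0 \<notin> X" "V \<subseteq> S" "S \<subseteq> X"
  shows "card (X - S \<union> {0}) + card S - 1 = card X" "card (X - S \<union> {0}) = card (X - S) + 1"
    "card (X - V) = card (X - S) + card (S - V)"
proof -
  have fS: "finite S" by (rule finite_subset[OF assms(4,1)])
  show c: "card (X - S \<union> {0}) = card (X - S) + 1" using assms(1,2) by simp
  have "card (X - S) + card S = card X"
    using card_mono[OF assms(1,4)] fS assms(4) by (simp add: card_Diff_subset)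
  then show "card (X - S \<union> {0}) + card S - 1 = card X" using c by simp
  have "X - V = (X - S) \<union> (S - V)" using assms(3,4) by auto
  then show "card (X - V) = card (X - S) + card (S - V)"
    using assms(1) fS card_Un_disjoint[of "X - S" "S - V"] by auto
qed

section \<open>Insertions of the Maurer-Cartan family\<close>

text \<open>
  The family \<open>a\<close> of images of the generators of \<open>\<Lambda>Lie_\<infinity>\<close>. The value \<open>a 1 = 0\<close> permits to write the
  defining relation as a sum over all \<open>p\<close> from 1 to \<open>k\<close>.
\<close>
locale mc_operad = dg_operad P
  for P :: "('k :: field_char_0, 'a :: ab_group_add, 'z) dgoperad_scheme" +
  fixes a :: "nat \<Rightarrow> 'a"
  assumes a_part: "k \<ge> 1 \<Longrightarrow> a k \<in> part P k (3 - 2 * int k)"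
    and a_inv: "k \<ge> 1 \<Longrightarrow> \<sigma> permutes {1..k} \<Longrightarrow> act P k \<sigma> (a k) = a k"
    and a_one: "a 1 = 0"
    and a_dif: "k \<ge> 1 \<Longrightarrow> dif P k (3 - 2 * int k) (a k) =
      - (\<Sum>p = 1..k. \<Sum>\<sigma>\<in>Sh p (k - p). act P k \<sigma> (pcomp P (k - p + 1) p 1 (a (k - p + 1)) (a p)))"
begin

text \<open>
  By symmetry \<open>a k\<close> is the same operation under any labelling; no labels need to be recorded for it.
\<close>
lemma lab_a:
  assumes "distinct xs" "length xs = k" "k \<ge> 1"
  shows "lab P xs (a k) = a k"
  using a_inv[OF assms(3) position_perm_permutes] arrangement_map_rank[OF assms(1)] assms(2)
  by (simp add: lab_def relabel_conv)

text \<open>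
  The summand of \<open>f \<star> \<mu>\<close> in which the inserted \<open>\<mu>\<close> carries the labels \<open>S\<close>.
\<close>
definition rterm :: "(nat \<Rightarrow> 'a) \<Rightarrow> nat list \<Rightarrow> nat set \<Rightarrow> nat set \<Rightarrow> 'a" where
  "rterm f \<nu> X S = circ (quot (set \<nu>) X S) (pt (set \<nu>) S) S
     (fam f \<nu> (quot (set \<nu>) X S)) (a (card S))"

definition rstar :: "(nat \<Rightarrow> 'a) \<Rightarrow> nat list \<Rightarrow> nat set \<Rightarrow> 'a" where
  "rstar f \<nu> X = sum (rterm f \<nu> X) (contractions (set \<nu>) X)"

text \<open>
  The summand of \<open>\<mu> \<star> f\<close> in which \<open>f\<close> carries the labels \<open>S\<close>. Labels are positive, so that 0 can name the
  input of \<open>\<mu>\<close> that receives \<open>f\<close>. A label of \<open>S\<close> would not do, since \<open>S\<close> may be empty.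
\<close>
definition lterm :: "(nat \<Rightarrow> 'a) \<Rightarrow> nat list \<Rightarrow> nat set \<Rightarrow> nat set \<Rightarrow> 'a" where
  "lterm f \<nu> X S = circ (X - S \<union> {0}) 0 S (a (card (X - S) + 1)) (fam f \<nu> S)"

definition lstar :: "(nat \<Rightarrow> 'a) \<Rightarrow> nat list \<Rightarrow> nat set \<Rightarrow> 'a" where
  "lstar f \<nu> X = (\<Sum>S | set \<nu> \<subseteq> S \<and> S \<subseteq> X. lterm f \<nu> X S)"

text \<open>
  The right-hand side does not mention \<open>c\<close>: the name of the receiving symmetric input is immaterial.
\<close>
lemma circ_fam_a_free:
  assumes f: "f \<in> tw_part P n d" and \<nu>: "length \<nu> = n"
    and d: "distinct (c # zs @ \<nu>)" "distinct ss" "set ss \<inter> set (zs @ \<nu>) = {}" "ss \<noteq> []"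
    and X: "X = set (c # zs @ \<nu>)" and S: "S = set ss"
  shows "circ X c S (fam f \<nu> X) (a (card S)) = lab P (ss @ zs @ \<nu>)
    (pcomp P (length zs + 1 + n) (length ss) 1 (f (length zs + 1)) (a (length ss)))"
proof -
  have l: "length ss \<ge> 1" using d(4) by (cases ss) auto
  have "fam f \<nu> X = lab P ((c # zs) @ \<nu>) (f (length (c # zs)))"
    by (rule fam_eq[OF f]) (use d X \<nu> in auto)
  moreover have "a (card S) = lab P ss (a (length ss))"
    using lab_a[OF d(2) refl l] S d(2) by (simp add: distinct_card)
  moreover have "circ X c S (lab P (c # (zs @ \<nu>)) (f (length (c # zs)))) (lab P ss (a (length ss))) =
     lab P (ss @ (zs @ \<nu>)) (pcomp P (length (c # (zs @ \<nu>))) (length ss) 1 (f (length (c # zs))) (a (length ss)))"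
    by (rule circ_lab_Cons[where d = "d - 2 * int (length (c # zs))" and e = "3 - 2 * int (length ss)"])
      (use d X S a_part[OF l] tw_partD(1)[OF f, of "length (c # zs)"] \<nu> in auto)
  ultimately show ?thesis by (simp add: \<nu>)
qed

lemma circ_fam_a_bound:
  assumes f: "f \<in> tw_part P n d" and \<nu>: "length \<nu> = n" "\<nu> = \<nu>1 @ c # \<nu>2"
    and d: "distinct (zs @ \<nu>)" "distinct ss" "set ss \<inter> set (zs @ \<nu>1 @ \<nu>2) = {}" "ss \<noteq> []"
    and X: "X = set (zs @ \<nu>)" and S: "S = set ss"
  shows "circ X c S (fam f \<nu> X) (a (card S)) = lab P (zs @ \<nu>1 @ ss @ \<nu>2)
    (pcomp P (length zs + n) (length ss) (length zs + length \<nu>1 + 1) (f (length zs)) (a (length ss)))"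
proof -
  have l: "length ss \<ge> 1" using d(4) by (cases ss) auto
  have "fam f \<nu> X = lab P (zs @ \<nu>) (f (length zs))"
    by (rule fam_eq[OF f]) (use d X \<nu> in auto)
  moreover have "a (card S) = lab P ss (a (length ss))"
    using lab_a[OF d(2) refl l] S d(2) by (simp add: distinct_card)
  moreover have "circ (set ((zs @ \<nu>1) @ c # \<nu>2)) c (set ss)
      (lab P ((zs @ \<nu>1) @ c # \<nu>2) (f (length zs))) (lab P ss (a (length ss))) =
     lab P ((zs @ \<nu>1) @ ss @ \<nu>2) (pcomp P (length ((zs @ \<nu>1) @ c # \<nu>2)) (length ss) (length (zs @ \<nu>1) + 1)
       (f (length zs)) (a (length ss)))"
    by (rule circ_lab[where d = "d - 2 * int (length zs)" and e = "3 - 2 * int (length ss)"])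
      (use d X S a_part[OF l] tw_partD(1)[OF f, of "length zs"] \<nu> in auto)
  ultimately show ?thesis using X S by (simp add: \<nu>(1)[symmetric] \<nu>(2))
qed

lemma circ_a_fam:
  assumes f: "f \<in> tw_part P n d" and \<nu>: "length \<nu> = n"
    and d: "distinct (xs @ ss @ \<nu>)" "0 \<notin> set (xs @ ss @ \<nu>)"
    and X: "X = insert 0 (set xs)" and S: "S = set (ss @ \<nu>)"
  shows "circ X 0 S (a (length xs + 1)) (fam f \<nu> S) = lab P (xs @ ss @ \<nu>)
    (pcomp P (length xs + 1) (length ss + n) (length xs + 1) (a (length xs + 1)) (f (length ss)))"
proof -
  have "fam f \<nu> S = lab P (ss @ \<nu>) (f (length ss))"
    by (rule fam_eq[OF f]) (use d S \<nu> in auto)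
  moreover have "a (length xs + 1) = lab P (xs @ [0]) (a (length xs + 1))"
    using lab_a[of "xs @ [0]" "length xs + 1"] d by simp
  moreover have "circ (set (xs @ 0 # [])) 0 (set (ss @ \<nu>))
      (lab P (xs @ 0 # []) (a (length xs + 1))) (lab P (ss @ \<nu>) (f (length ss))) =
     lab P (xs @ (ss @ \<nu>) @ []) (pcomp P (length (xs @ 0 # [])) (length (ss @ \<nu>)) (length xs + 1)
       (a (length xs + 1)) (f (length ss)))"
    by (rule circ_lab[where e = "d - 2 * int (length ss)" and d = "3 - 2 * int (length xs + 1)"])
      (use d X S a_part[of "length xs + 1"] tw_partD(1)[OF f, of "length ss"] \<nu> in auto)
  ultimately show ?thesis using X S \<nu> by simp
qed

text \<open>
  The two kinds of contraction, with all sets replaced by lists of labels as in the previous lemmas.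
\<close>
lemma contractions_cases:
  assumes "S \<in> contractions (set \<nu>) X" "finite X" "set \<nu> \<subseteq> X" "distinct \<nu>"
  obtains (free) ss zs where "distinct (ss @ zs @ \<nu>)" "ss \<noteq> []" "S = set ss"
      "X = set (ss @ zs @ \<nu>)"
  | (bound) \<nu>1 \<nu>2 c ss zs where "\<nu> = \<nu>1 @ c # \<nu>2" "distinct (ss @ zs @ \<nu>)"
      "S = set (ss @ [c])" "X = set (ss @ zs @ \<nu>)"
proof (cases "S \<inter> set \<nu> = {}")
  case True
  let ?ss = "sorted_of S" and ?zs = "sorted_of (X - S - set \<nu>)"
  have fS: "finite S" "S \<subseteq> X" "S \<noteq> {}" using assms by (auto simp: contractions_def intro: finite_subset)
  show ?thesis
    by (rule free[of ?ss ?zs]) (use fS True assms in auto)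
next
  case False
  then obtain c where c: "S \<inter> set \<nu> = {c}" using assms(1) by (auto simp: contractions_def)
  let ?ss = "sorted_of (S - {c})" and ?zs = "sorted_of (X - S - set \<nu>)"
  have fS: "finite S" "S \<subseteq> X" using assms by (auto simp: contractions_def intro: finite_subset)
  have cS: "c \<in> S" "c \<in> set \<nu>" using c by auto
  obtain \<nu>1 \<nu>2 where \<nu>: "\<nu> = \<nu>1 @ c # \<nu>2" using cS(2) by (meson split_list)
  show ?thesis
  proof (rule bound[of \<nu>1 c \<nu>2 ?ss ?zs])
    show "S = set (?ss @ [c])" "X = set (?ss @ ?zs @ \<nu>)"
      using fS cS c assms(2,3) by auto
    show "distinct (?ss @ ?zs @ \<nu>)" using fS c assms by auto
  qed (rule \<nu>)
qed

lemma rterm_free: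
  assumes f: "f \<in> tw_part P n d" and \<nu>: "length \<nu> = n" and d: "distinct (ss @ zs @ \<nu>)" "ss \<noteq> []"
    and S: "S = set ss" and X: "X = set (ss @ zs @ \<nu>)"
  shows "rterm f \<nu> X S = lab P (ss @ zs @ \<nu>)
    (pcomp P (length zs + 1 + n) (length ss) 1 (f (length zs + 1)) (a (length ss)))"
proof -
  have p: "pt (set \<nu>) S \<in> S" using d S by (auto simp: pt_def)
  then have "X - S \<union> {pt (set \<nu>) S} = set (pt (set \<nu>) S # zs @ \<nu>)"
    using d X S by auto
  then show ?thesis unfolding rterm_def quot_def
    by (intro circ_fam_a_free[OF f \<nu>]) (use d S p in auto)
qed

lemma rterm_bound:
  assumes f: "f \<in> tw_part P n d" and \<nu>: "length \<nu> = n" "\<nu> = \<nu>1 @ c # \<nu>2"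
    and d: "distinct (ss @ zs @ \<nu>)"
    and S: "S = set (ss @ [c])" and X: "X = set (ss @ zs @ \<nu>)"
  shows "rterm f \<nu> X S = lab P (zs @ \<nu>1 @ (ss @ [c]) @ \<nu>2)
    (pcomp P (length zs + n) (length ss + 1) (length zs + length \<nu>1 + 1) (f (length zs)) (a (length ss + 1)))"
proof -
  have c: "S \<inter> set \<nu> = {c}" using d S \<nu> by auto
  then have p: "pt (set \<nu>) S = c" by (simp add: pt_def)
  then have X': "X - S \<union> {pt (set \<nu>) S} = set (zs @ \<nu>)"
    using d X S \<nu> by auto
  have "rterm f \<nu> X S = lab P (zs @ \<nu>1 @ (ss @ [c]) @ \<nu>2)
    (pcomp P (length zs + n) (length (ss @ [c])) (length zs + length \<nu>1 + 1) (f (length zs)) (a (length (ss @ [c]))))"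
    unfolding rterm_def quot_def X' unfolding p
    by (rule circ_fam_a_bound[OF f \<nu>]) (use d S \<nu> in auto)
  then show ?thesis by simp
qed

lemma lterm_lab:
  assumes f: "f \<in> tw_part P n d" and \<nu>: "length \<nu> = n"
    and d: "distinct (xs @ ss @ \<nu>)" "0 \<notin> set (xs @ ss @ \<nu>)"
    and X: "X = set (xs @ ss @ \<nu>)" and S: "S = set (ss @ \<nu>)"
  shows "lterm f \<nu> X S = lab P (xs @ ss @ \<nu>)
    (pcomp P (length xs + 1) (length ss + n) (length xs + 1) (a (length xs + 1)) (f (length ss)))"
proof -
  have XS: "X - S = set xs" using d X S by auto
  then have "card (X - S) + 1 = length xs + 1" using d by (simp add: distinct_card)
  then show ?thesis unfolding lterm_def XS
    using circ_a_fam[OF f \<nu> d _ S, of "set xs \<union> {0}"] XS by simp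
qed

lemma pcomp_fa_part:
  assumes "f \<in> tw_part P n d" "k \<ge> 1" "i \<in> {1..r + n}"
  shows "pcomp P (r + n) k i (f r) (a k) \<in> part P (r + n + k - 1) (d - 2 * int r + (3 - 2 * int k))"
  using assms a_part tw_partD(1)[OF assms(1)] by (intro pcomp_part) auto

lemma pcomp_af_part:
  assumes "f \<in> tw_part P n d" "k \<ge> 1" "i \<in> {1..k}"
  shows "pcomp P k (r + n) i (a k) (f r) \<in> part P (k + (r + n) - 1) (3 - 2 * int k + (d - 2 * int r))"
  using assms a_part tw_partD(1)[OF assms(1)] by (intro pcomp_part) auto

text \<open>
  Naturality in the labels holds although \<open>pt\<close> is not natural for maps that fail to be monotone, because
  \<open>rterm_free\<close> and \<open>rterm_bound\<close> express the term without it.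
\<close>
lemma rterm_ren:
  assumes f: "f \<in> tw_part P n d" and \<nu>: "length \<nu> = n" "distinct \<nu>" "set \<nu> \<subseteq> X" and X: "finite X"
    and \<beta>: "inj_on \<beta> X" and S: "S \<in> contractions (set \<nu>) X"
  shows "ren X \<beta> (rterm f \<nu> X S) = rterm f (map \<beta> \<nu>) (\<beta> ` X) (\<beta> ` S)"
  using S X \<nu>(3,2)
proof (cases rule: contractions_cases)
  case (free ss zs)
  let ?u = "pcomp P (length zs + 1 + n) (length ss) 1 (f (length zs + 1)) (a (length ss))"
  have "length ss \<ge> 1" using free(2) by (cases ss) auto
  from pcomp_fa_part[OF f this, of 1 "length zs + 1"]
  have u: "?u \<in> part P (length (ss @ zs @ \<nu>)) (d - 2 * int (length zs + 1) + (3 - 2 * int (length ss)))"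
    using \<nu>(1) by (simp add: ac_simps)
  have "ren X \<beta> (rterm f \<nu> X S) = lab P (map \<beta> (ss @ zs @ \<nu>)) ?u"
    unfolding rterm_free[OF f \<nu>(1) free]
    by (rule ren_lab[OF free(1) free(4)[symmetric] \<beta> u])
  also have "\<dots> = lab P (map \<beta> ss @ map \<beta> zs @ map \<beta> \<nu>)
    (pcomp P (length (map \<beta> zs) + 1 + n) (length (map \<beta> ss)) 1 (f (length (map \<beta> zs) + 1)) (a (length (map \<beta> ss))))"
    by simp
  also have "\<dots> = rterm f (map \<beta> \<nu>) (\<beta> ` X) (\<beta> ` S)"
  proof (rule rterm_free[OF f, symmetric])
    have "distinct (map \<beta> (ss @ zs @ \<nu>))" unfolding distinct_map using free(1,4) \<beta> by simp
    then show "distinct (map \<beta> ss @ map \<beta> zs @ map \<beta> \<nu>)" by simp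
  qed (use free \<nu> in \<open>auto simp: image_Un\<close>)
  finally show ?thesis .
next
  case (bound \<nu>1 \<nu>2 c ss zs)
  let ?u = "pcomp P (length zs + n) (length ss + 1) (length zs + length \<nu>1 + 1) (f (length zs)) (a (length ss + 1))"
  have "length zs + length \<nu>1 + 1 \<in> {1..length zs + n}" using \<nu>(1) bound(1) by simp
  then have p: "?u \<in> part P (length zs + n + (length ss + 1) - 1) (d - 2 * int (length zs) + (3 - 2 * int (length ss + 1)))"
    by (intro pcomp_fa_part[OF f]) auto
  have "length (zs @ \<nu>1 @ (ss @ [c]) @ \<nu>2) = length zs + n + (length ss + 1) - 1"
    using \<nu>(1) bound(1) by simp
  with p have u: "?u \<in> part P (length (zs @ \<nu>1 @ (ss @ [c]) @ \<nu>2)) (d - 2 * int (length zs) + (3 - 2 * int (length ss + 1)))"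
    by (simp only:)
  have "distinct (zs @ \<nu>1 @ (ss @ [c]) @ \<nu>2)" "set (zs @ \<nu>1 @ (ss @ [c]) @ \<nu>2) = X"
    using bound by auto
  then have "ren X \<beta> (rterm f \<nu> X S) = lab P (map \<beta> (zs @ \<nu>1 @ (ss @ [c]) @ \<nu>2)) ?u"
    unfolding rterm_bound[OF f \<nu>(1) bound] by (intro ren_lab[OF _ _ \<beta> u])
  also have "\<dots> = lab P (map \<beta> zs @ map \<beta> \<nu>1 @ (map \<beta> ss @ [\<beta> c]) @ map \<beta> \<nu>2)
    (pcomp P (length (map \<beta> zs) + n) (length (map \<beta> ss) + 1) (length (map \<beta> zs) + length (map \<beta> \<nu>1) + 1)
      (f (length (map \<beta> zs))) (a (length (map \<beta> ss) + 1)))"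
    by simp
  also have "\<dots> = rterm f (map \<beta> \<nu>) (\<beta> ` X) (\<beta> ` S)"
  proof (rule rterm_bound[OF f, symmetric])
    have "distinct (map \<beta> (ss @ zs @ \<nu>))" unfolding distinct_map using bound(2,4) \<beta> by simp
    then show "distinct (map \<beta> ss @ map \<beta> zs @ map \<beta> \<nu>)" by simp
  qed (use bound \<nu> in \<open>auto simp: image_Un\<close>)
  finally show ?thesis .
qed

lemma lterm_ren:
  assumes f: "f \<in> tw_part P n d" and \<nu>: "length \<nu> = n" "distinct \<nu>" "set \<nu> \<subseteq> S" and X: "finite X" "0 \<notin> X"
    and \<beta>: "inj_on \<beta> X" "0 \<notin> \<beta> ` X" and S: "S \<subseteq> X"
  shows "ren X \<beta> (lterm f \<nu> X S) = lterm f (map \<beta> \<nu>) (\<beta> ` X) (\<beta> ` S)"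
proof -
  define xs where "xs = sorted_of (X - S)"
  define ss where "ss = sorted_of (S - set \<nu>)"
  have fS: "finite S" using S X finite_subset by blast
  have eq: "X = set (xs @ ss @ \<nu>)" "S = set (ss @ \<nu>)" and d: "distinct (xs @ ss @ \<nu>)"
    using S \<nu> X(1) fS by (auto simp: xs_def ss_def)
  let ?u = "pcomp P (length xs + 1) (length ss + n) (length xs + 1) (a (length xs + 1)) (f (length ss))"
  have u: "?u \<in> part P (length (xs @ ss @ \<nu>)) (3 - 2 * int (length xs + 1) + (d - 2 * int (length ss)))"
    using pcomp_af_part[OF f, of "length xs + 1" "length xs + 1" "length ss"] \<nu> by simp
  have "ren X \<beta> (lterm f \<nu> X S) = lab P (map \<beta> (xs @ ss @ \<nu>)) ?u"
    unfolding lterm_lab[OF f \<nu>(1) d X(2)[unfolded eq(1)] eq]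
    by (rule ren_lab[OF d eq(1)[symmetric] \<beta>(1) u])
  also have "\<dots> = lab P (map \<beta> xs @ map \<beta> ss @ map \<beta> \<nu>)
    (pcomp P (length (map \<beta> xs) + 1) (length (map \<beta> ss) + n) (length (map \<beta> xs) + 1)
      (a (length (map \<beta> xs) + 1)) (f (length (map \<beta> ss))))"
    by simp
  also have "\<dots> = lterm f (map \<beta> \<nu>) (\<beta> ` X) (\<beta> ` S)"
  proof (rule lterm_lab[OF f, symmetric])
    have "distinct (map \<beta> (xs @ ss @ \<nu>))" unfolding distinct_map using d eq(1) \<beta> by simp
    then show "distinct (map \<beta> xs @ map \<beta> ss @ map \<beta> \<nu>)" by simp
    show "\<beta> ` X = set (map \<beta> xs @ map \<beta> ss @ map \<beta> \<nu>)" "\<beta> ` S = set (map \<beta> ss @ map \<beta> \<nu>)"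
      unfolding eq by (auto simp: image_Un)
    then show "0 \<notin> set (map \<beta> xs @ map \<beta> ss @ map \<beta> \<nu>)" using \<beta>(2) by blast
  qed (use \<nu> in simp)
  finally show ?thesis .
qed

end

section \<open>The twisted differential on arbitrary label sets\<close>

context mc_operad
begin

lemma rterm_part:
  assumes f: "f \<in> tw_part P n d" and \<nu>: "length \<nu> = n" "distinct \<nu>" "set \<nu> \<subseteq> X" and X: "finite X"
    and S: "S \<in> contractions (set \<nu>) X"
  shows "rterm f \<nu> X S \<in> part P (card X) (d - 2 * int (card (X - set \<nu>)) + 1)"
proof -
  let ?Q = "quot (set \<nu>) X S"
  note s = contractionsD[OF S X] and q = quot_props[OF X \<nu>(3) S]
  have "rterm f \<nu> X S \<in> part P (card ?Q + card S - 1)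
      (d - 2 * int (card (?Q - set \<nu>)) + (3 - 2 * int (card S)))"
    unfolding rterm_def
    by (rule circ_part[OF q(1) s(2) q(5,4) fam_part[OF f \<nu>(2,1) q(1,2)] a_part[OF s(7)]])
  moreover have "d - 2 * int (card (?Q - set \<nu>)) + (3 - 2 * int (card S)) = d - 2 * int (card (X - set \<nu>)) + 1"
    using q(7) by linarith
  ultimately show ?thesis by (simp only: q(6))
qed

lemma lterm_part:
  assumes f: "f \<in> tw_part P n d" and \<nu>: "length \<nu> = n" "distinct \<nu>" "set \<nu> \<subseteq> S" and X: "finite X" "0 \<notin> X"
    and S: "S \<subseteq> X"
  shows "lterm f \<nu> X S \<in> part P (card X) (d - 2 * int (card (X - set \<nu>)) + 1)"
proof -
  let ?B = "X - S \<union> {0}"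
  note c = split_card[OF X \<nu>(3) S]
  have fS: "finite S" by (rule finite_subset[OF S X(1)])
  have "lterm f \<nu> X S \<in> part P (card ?B + card S - 1)
      (3 - 2 * int (card ?B) + (d - 2 * int (card (S - set \<nu>))))"
    unfolding lterm_def c(2)[symmetric]
  proof (rule circ_part[OF _ fS _ _ _ fam_part[OF f \<nu>(2,1) fS \<nu>(3)]])
    show "a (card ?B) \<in> part P (card ?B) (3 - 2 * int (card ?B))"
      by (rule a_part) (use c(2) in linarith)
  qed (use X(1) in auto)
  moreover have "3 - 2 * int (card ?B) + (d - 2 * int (card (S - set \<nu>))) = d - 2 * int (card (X - set \<nu>)) + 1"
    using c(2,3) by linarith
  ultimately show ?thesis by (simp only: c(1))
qed

text \<open>
  The twisted differential on an arbitrary label set. That it is natural in the labels (\<open>tw_dif_on_ren\<close>)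
  yields both the symmetry of \<open>tw_dif P a n d f\<close> and its value on other label sets (\<open>fam_tw_dif\<close>).
\<close>
definition tw_dif_on :: "int \<Rightarrow> (nat \<Rightarrow> 'a) \<Rightarrow> nat list \<Rightarrow> nat set \<Rightarrow> 'a" where
  "tw_dif_on d f \<nu> X = dif P (card X) (d - 2 * int (card (X - set \<nu>))) (fam f \<nu> X)
     - sgn_pow d (rstar f \<nu> X) + lstar f \<nu> X"

lemma rstar_part:
  assumes f: "f \<in> tw_part P n d" and \<nu>: "length \<nu> = n" "distinct \<nu>" "set \<nu> \<subseteq> X" and X: "finite X"
  shows "rstar f \<nu> X \<in> part P (card X) (d - 2 * int (card (X - set \<nu>)) + 1)"
  unfolding rstar_def by (rule subgroup_sum[OF subgroup_part rterm_part[OF f \<nu> X]])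

lemma lstar_part:
  assumes f: "f \<in> tw_part P n d" and \<nu>: "length \<nu> = n" "distinct \<nu>" "set \<nu> \<subseteq> X"
    and X: "finite X" "0 \<notin> X"
  shows "lstar f \<nu> X \<in> part P (card X) (d - 2 * int (card (X - set \<nu>)) + 1)"
  unfolding lstar_def
  by (rule subgroup_sum[OF subgroup_part]) (use lterm_part[OF f \<nu>(1,2) _ X] in auto)

lemma tw_dif_on_part:
  assumes f: "f \<in> tw_part P n d" and \<nu>: "length \<nu> = n" "distinct \<nu>" "set \<nu> \<subseteq> X"
    and X: "finite X" "0 \<notin> X"
  shows "tw_dif_on d f \<nu> X \<in> part P (card X) (d - 2 * int (card (X - set \<nu>)) + 1)"
  unfolding tw_dif_on_def
  by (intro subgroup_add[OF subgroup_part] subgroup_diff[OF subgroup_part] subgroup_sgn_pow[OF subgroup_part]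
    rstar_part[OF f \<nu> X(1)] lstar_part[OF f \<nu> X] dif_part fam_part[OF f \<nu>(2,1) X(1) \<nu>(3)])

lemma additive_ren:
  assumes "finite X" "inj_on \<beta> X"
  shows "additive_on (part P (card X) d) (ren X \<beta>)"
proof -
  have "distinct (map \<beta> (sorted_of X))" using assms by (simp add: distinct_map)
  from additive_lab[OF this, of d] show ?thesis by (simp add: ren_def[abs_def])
qed

lemma fam_ren:
  assumes f: "f \<in> tw_part P n d" and \<nu>: "length \<nu> = n" "distinct \<nu>" "set \<nu> \<subseteq> X" and X: "finite X"
    and \<beta>: "inj_on \<beta> X"
  shows "ren X \<beta> (fam f \<nu> X) = fam f (map \<beta> \<nu>) (\<beta> ` X)"
proof -
  define zs where "zs = sorted_of (X - set \<nu>)"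
  have eq: "X = set (zs @ \<nu>)" and d: "distinct (zs @ \<nu>)" using \<nu> X by (auto simp: zs_def)
  have fr: "f (length zs) \<in> part P (length (zs @ \<nu>)) (d - 2 * int (length zs))"
    using tw_partD(1)[OF f] \<nu> by simp
  have "ren X \<beta> (fam f \<nu> X) = lab P (map \<beta> (zs @ \<nu>)) (f (length zs))"
    unfolding fam_eq[OF f d \<nu>(1) eq] by (rule ren_lab[OF d eq[symmetric] \<beta> fr])
  also have "\<dots> = lab P (map \<beta> zs @ map \<beta> \<nu>) (f (length (map \<beta> zs)))" by simp
  also have "\<dots> = fam f (map \<beta> \<nu>) (\<beta> ` X)"
  proof (rule fam_eq[OF f, symmetric])
    have "distinct (map \<beta> (zs @ \<nu>))" unfolding distinct_map using d eq \<beta> by simp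
    then show "distinct (map \<beta> zs @ map \<beta> \<nu>)" by simp
    show "\<beta> ` X = set (map \<beta> zs @ map \<beta> \<nu>)" unfolding eq by (auto simp: image_Un)
  qed (use \<nu> in simp)
  finally show ?thesis .
qed

lemma dif_ren:
  assumes "finite X" "inj_on \<beta> X" "v \<in> part P (card X) d"
  shows "dif P (card X) d (ren X \<beta> v) = ren X \<beta> (dif P (card X) d v)"
proof -
  have "distinct (map \<beta> (sorted_of X))" using assms by (simp add: distinct_map)
  from dif_lab[OF this, of v d] show ?thesis using assms by (simp add: ren_def)
qed

lemma contractions_image:
  assumes "inj_on \<beta> X" "V \<subseteq> X"
  shows "bij_betw ((`) \<beta>) (contractions V X) (contractions (\<beta> ` V) (\<beta> ` X))"
proof -
  have int: "\<beta> ` S \<inter> \<beta> ` V = \<beta> ` (S \<inter> V)" if "S \<subseteq> X" for S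
    using assms that by (simp add: inj_on_image_Int)
  have "(`) \<beta> ` contractions V X = contractions (\<beta> ` V) (\<beta> ` X)"
  proof (intro equalityI subsetI)
    fix T assume "T \<in> (`) \<beta> ` contractions V X"
    then obtain S where "T = \<beta> ` S" "S \<subseteq> X" "S \<noteq> {}" "S \<inter> V = {} \<or> (\<exists>i. S \<inter> V = {i})"
      by (auto simp: contractions_def)
    then show "T \<in> contractions (\<beta> ` V) (\<beta> ` X)"
      by (fastforce simp: contractions_def int)
  next
    fix T assume T: "T \<in> contractions (\<beta> ` V) (\<beta> ` X)"
    then obtain S where S: "S \<subseteq> X" "T = \<beta> ` S" by (auto simp: contractions_def subset_image_iff)
    have "S \<inter> V = {} \<or> (\<exists>i. S \<inter> V = {i})"
    proof (cases "S \<inter> V = {}")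
      case False
      then obtain i where i: "\<beta> ` (S \<inter> V) = {i}"
        using T S int[OF S(1)] by (auto simp: contractions_def)
      have "inj_on \<beta> (S \<inter> V)" using assms(1) S(1) by (auto intro: inj_on_subset)
      then have "card (S \<inter> V) = 1" using card_image[of \<beta> "S \<inter> V"] i by simp
      then show ?thesis by (auto simp: card_1_singleton_iff)
    qed simp
    then have "S \<in> contractions V X" using S T by (auto simp: contractions_def)
    then show "T \<in> (`) \<beta> ` contractions V X" using S by blast
  qed
  moreover have "inj_on ((`) \<beta>) (contractions V X)"
    by (rule inj_on_subset[OF inj_on_image_Pow[OF assms(1)]]) (auto simp: contractions_def)
  ultimately show ?thesis by (simp add: bij_betw_def)
qed

lemma rstar_ren:
  assumes f: "f \<in> tw_part P n d" and \<nu>: "length \<nu> = n" "distinct \<nu>" "set \<nu> \<subseteq> X" and X: "finite X"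
    and \<beta>: "inj_on \<beta> X"
  shows "ren X \<beta> (rstar f \<nu> X) = rstar f (map \<beta> \<nu>) (\<beta> ` X)"
proof -
  have "ren X \<beta> (rstar f \<nu> X) = (\<Sum>S\<in>contractions (set \<nu>) X. ren X \<beta> (rterm f \<nu> X S))"
    unfolding rstar_def by (rule additive_on_sum[OF additive_ren[OF X \<beta>] rterm_part[OF f \<nu> X]])
  also have "\<dots> = (\<Sum>S\<in>contractions (set \<nu>) X. rterm f (map \<beta> \<nu>) (\<beta> ` X) (\<beta> ` S))"
    by (rule sum.cong[OF refl rterm_ren[OF f \<nu> X \<beta>]])
  also have "\<dots> = rstar f (map \<beta> \<nu>) (\<beta> ` X)"
    unfolding rstar_def using sum.reindex_bij_betw[OF contractions_image[OF \<beta> \<nu>(3)]] by simp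
  finally show ?thesis .
qed

lemma lstar_ren:
  assumes f: "f \<in> tw_part P n d" and \<nu>: "length \<nu> = n" "distinct \<nu>" "set \<nu> \<subseteq> X"
    and X: "finite X" "0 \<notin> X" and \<beta>: "inj_on \<beta> X" "0 \<notin> \<beta> ` X"
  shows "ren X \<beta> (lstar f \<nu> X) = lstar f (map \<beta> \<nu>) (\<beta> ` X)"
proof -
  let ?A = "{S. set \<nu> \<subseteq> S \<and> S \<subseteq> X}"
  have "ren X \<beta> (lstar f \<nu> X) = (\<Sum>S\<in>?A. ren X \<beta> (lterm f \<nu> X S))"
    unfolding lstar_def
    by (rule additive_on_sum[OF additive_ren[OF X(1) \<beta>(1)]]) (use lterm_part[OF f \<nu>(1,2) _ X] in auto)
  also have "\<dots> = (\<Sum>S\<in>?A. lterm f (map \<beta> \<nu>) (\<beta> ` X) (\<beta> ` S))"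
    by (rule sum.cong[OF refl]) (use lterm_ren[OF f \<nu>(1,2) _ X \<beta>] in auto)
  also have "\<dots> = lstar f (map \<beta> \<nu>) (\<beta> ` X)"
    unfolding lstar_def
  proof (rule sum.reindex_bij_betw)
    have "inj_on ((`) \<beta>) ?A"
      by (rule inj_on_subset[OF inj_on_image_Pow[OF \<beta>(1)]]) auto
    moreover have "(`) \<beta> ` ?A = {S. set (map \<beta> \<nu>) \<subseteq> S \<and> S \<subseteq> \<beta> ` X}"
    proof (intro equalityI subsetI)
      fix T assume T: "T \<in> {S. set (map \<beta> \<nu>) \<subseteq> S \<and> S \<subseteq> \<beta> ` X}"
      then obtain S where S: "S \<subseteq> X" "T = \<beta> ` S" by (auto simp: subset_image_iff)
      have "set \<nu> \<subseteq> S"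
      proof
        fix x assume x: "x \<in> set \<nu>"
        then have "\<beta> x \<in> \<beta> ` S" using T S by auto
        then show "x \<in> S" using inj_on_image_mem_iff[OF \<beta>(1), of x S] x \<nu>(3) S(1) by auto
      qed
      then show "T \<in> (`) \<beta> ` ?A" using S by blast
    qed auto
    ultimately show "bij_betw ((`) \<beta>) ?A {S. set (map \<beta> \<nu>) \<subseteq> S \<and> S \<subseteq> \<beta> ` X}"
      by (simp add: bij_betw_def)
  qed
  finally show ?thesis .
qed

lemma tw_dif_on_ren:
  assumes f: "f \<in> tw_part P n d" and \<nu>: "length \<nu> = n" "distinct \<nu>" "set \<nu> \<subseteq> X"
    and X: "finite X" "0 \<notin> X" and \<beta>: "inj_on \<beta> X" "0 \<notin> \<beta> ` X"
  shows "ren X \<beta> (tw_dif_on d f \<nu> X) = tw_dif_on d f (map \<beta> \<nu>) (\<beta> ` X)"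
proof -
  let ?e = "d - 2 * int (card (X - set \<nu>))"
  note R = additive_ren[OF X(1) \<beta>(1), of "?e + 1"]
  have c: "card (\<beta> ` X) = card X" by (rule card_image[OF \<beta>(1)])
  have "\<beta> ` X - \<beta> ` set \<nu> = \<beta> ` (X - set \<nu>)"
    using inj_on_image_set_diff[OF \<beta>(1), of X "set \<nu>"] \<nu>(3) by auto
  moreover have "inj_on \<beta> (X - set \<nu>)" using \<beta>(1) by (rule inj_on_subset) auto
  ultimately have c': "card (\<beta> ` X - set (map \<beta> \<nu>)) = card (X - set \<nu>)" by (simp add: card_image)
  note p = dif_part[OF fam_part[OF f \<nu>(2,1) X(1) \<nu>(3)]] rstar_part[OF f \<nu> X(1)] lstar_part[OF f \<nu> X]
  have "ren X \<beta> (tw_dif_on d f \<nu> X) = ren X \<beta> (dif P (card X) ?e (fam f \<nu> X)) - sgn_pow d (ren X \<beta> (rstar f \<nu> X)) + ren X \<beta> (lstar f \<nu> X)"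
    unfolding tw_dif_on_def
    using additive_on_add[OF R subgroup_diff[OF subgroup_part p(1) subgroup_sgn_pow[OF subgroup_part p(2), of d]] p(3)]
      additive_on_diff[OF R p(1) subgroup_sgn_pow[OF subgroup_part p(2), of d]]
      additive_on_sgn_pow[OF R p(2), of d] by simp
  also have "\<dots> = tw_dif_on d f (map \<beta> \<nu>) (\<beta> ` X)"
    unfolding tw_dif_on_def c c' lstar_ren[OF f \<nu> X \<beta>] rstar_ren[OF f \<nu> X(1) \<beta>(1)]
      dif_ren[OF X(1) \<beta>(1) fam_part[OF f \<nu>(2,1) X(1) \<nu>(3)], symmetric] fam_ren[OF f \<nu> X(1) \<beta>(1)] ..
  finally show ?thesis .
qed

end

lemma sum_contractions:
  assumes "finite X" "V \<subseteq> X"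
  shows "sum h (contractions V X) =
    (\<Sum>S\<in>Pow (X - V) - {{}}. h S) + (\<Sum>i\<in>V. \<Sum>S\<in>Pow (X - V). h (insert i S))"
proof -
  let ?A = "Pow (X - V) - {{}}" and ?B = "(\<lambda>(i, S). insert i S) ` (V \<times> Pow (X - V))"
  have fV: "finite V" using assms finite_subset by blast
  have eq: "contractions V X = ?A \<union> ?B"
  proof (intro equalityI subsetI)
    fix S assume S: "S \<in> contractions V X"
    show "S \<in> ?A \<union> ?B"
    proof (cases "S \<inter> V = {}")
      case False
      then obtain i where i: "S \<inter> V = {i}" using S by (auto simp: contractions_def)
      then have "S = (\<lambda>(i, S). insert i S) (i, S - {i})" "(i, S - {i}) \<in> V \<times> Pow (X - V)"
        using S by (auto simp: contractions_def)
      then show ?thesis by blast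
    qed (use S in \<open>auto simp: contractions_def\<close>)
  qed (use assms in \<open>auto simp: contractions_def\<close>)
  have inj: "inj_on (\<lambda>(i, S). insert i S) (V \<times> Pow (X - V))"
  proof (rule inj_onI, clarify)
    fix i S j T assume "i \<in> V" "S \<subseteq> X - V" "j \<in> V" "T \<subseteq> X - V" "insert i S = insert j T"
    then have "insert i S \<inter> V = {i}" "insert j T \<inter> V = {j}" "insert i S - V = S" "insert j T - V = T"
      by auto
    with \<open>insert i S = insert j T\<close> show "i = j \<and> S = T" by auto
  qed
  have "sum h (contractions V X) = sum h ?A + sum h ?B"
    unfolding eq using assms fV by (intro sum.union_disjoint) auto
  also have "sum h ?B = (\<Sum>(i, S)\<in>V \<times> Pow (X - V). h (insert i S))"
    using sum.reindex[OF inj, of h] by (simp add: case_prod_unfold comp_def)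
  also have "\<dots> = (\<Sum>i\<in>V. \<Sum>S\<in>Pow (X - V). h (insert i S))"
    using fV assms by (simp add: sum.cartesian_product)
  finally show ?thesis .
qed

lemma sum_Pow_compl:
  "(\<Sum>S\<in>Pow B. h (B - S)) = (\<Sum>S\<in>Pow B. h S)"
  by (rule sum.reindex_bij_witness[where i = "\<lambda>S. B - S" and j = "\<lambda>S. B - S"]) auto

context mc_operad
begin

text \<open>
  The next three lemmas translate the three sums over shuffles in \<open>tw_dif\<close> into sums over sets of
  labels. The first one is the insertion of \<open>\<mu>\<close> into symmetric inputs of \<open>f\<close>.
\<close>
lemma tw_dif_insertion:
  fixes r :: nat
  assumes f: "f \<in> tw_part P n d"
  defines "X \<equiv> {1..r + n}" and "\<nu> \<equiv> [r + 1..<r + n + 1]"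
  shows "(\<Sum>p = 1..r. \<Sum>\<sigma>\<in>Sh p (r - p).
      relabel P (map \<sigma> [1..<p + 1] @ map \<sigma> [p + 1..<r + 1] @ [r + 1..<r + n + 1])
        (pcomp P (r - p + 1 + n) p 1 (f (r - p + 1)) (a p))) =
    (\<Sum>S\<in>Pow {1..r} - {{}}. rterm f \<nu> X S)"
proof -
  have "(\<Sum>p = 1..r. \<Sum>\<sigma>\<in>Sh p (r - p).
      relabel P (map \<sigma> [1..<p + 1] @ map \<sigma> [p + 1..<r + 1] @ [r + 1..<r + n + 1])
        (pcomp P (r - p + 1 + n) p 1 (f (r - p + 1)) (a p))) =
    (\<Sum>S\<in>Pow {1..r} - {{}}. relabel P (sorted_of S @ sorted_of ({1..r} - S) @ [r + 1..<r + n + 1])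
        (pcomp P (r - card S + 1 + n) (card S) 1 (f (r - card S + 1)) (a (card S))))"
    by (rule sum_Sh_nonempty[where G = "\<lambda>p xs ys. relabel P (xs @ ys @ [r + 1..<r + n + 1])
        (pcomp P (r - p + 1 + n) p 1 (f (r - p + 1)) (a p))"])
  also have "\<dots> = (\<Sum>S\<in>Pow {1..r} - {{}}. rterm f \<nu> X S)"
  proof (rule sum.cong[OF refl])
    fix S assume S: "S \<in> Pow {1..r} - {{}}"
    let ?ss = "sorted_of S" and ?zs = "sorted_of ({1..r} - S)"
    have fS: "finite S" using S finite_subset by auto
    have d: "distinct (?ss @ ?zs @ \<nu>)" and X: "X = set (?ss @ ?zs @ \<nu>)"
      using S fS by (auto simp: \<nu>_def X_def simp del: upt_Suc)
    have "arrangement (?ss @ ?zs @ \<nu>) (r + n)" using d X by (simp add: arrangement_def X_def)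
    from lab_arrangement[OF this]
    have "rterm f \<nu> X S = relabel P (?ss @ ?zs @ \<nu>)
      (pcomp P (length ?zs + 1 + n) (length ?ss) 1 (f (length ?zs + 1)) (a (length ?ss)))"
      using rterm_free[OF f _ d _ _ X, of S] S fS by (simp add: \<nu>_def del: upt_Suc)
    moreover have "length ?zs = r - card S" "length ?ss = card S"
      using S fS by (auto simp: card_Diff_subset)
    ultimately show "relabel P (?ss @ ?zs @ [r + 1..<r + n + 1])
        (pcomp P (r - card S + 1 + n) (card S) 1 (f (r - card S + 1)) (a (card S))) = rterm f \<nu> X S"
      by (simp add: \<nu>_def del: upt_Suc)
  qed
  finally show ?thesis .
qed

text \<open>
  A shuffle selects the labels of \<open>\<kappa>\<close>, whereas \<open>lstar\<close> is indexed by the labels of \<open>f\<close>; hence the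
  complements.
\<close>
lemma tw_pcomp_kappa_left:
  fixes r :: nat
  assumes f: "f \<in> tw_part P n d"
  defines "X \<equiv> {1..r + n}" and "\<nu> \<equiv> [r + 1..<r + n + 1]"
  shows "tw_pcomp P 1 n 1 (\<lambda>r. a (r + 1)) f r = lstar f \<nu> X"
proof -
  have sn: "set \<nu> = {r + 1..r + n}" by (auto simp: \<nu>_def simp del: upt_Suc)
  have "tw_pcomp P 1 n 1 (\<lambda>r. a (r + 1)) f r = (\<Sum>S\<in>Pow {1..r}. relabel P
     (sorted_of S @ [r + 1..<r + 1] @ sorted_of ({1..r} - S) @ [r + 1..<r + 1 + n] @ [r + 1 + n..<r + 1 + n])
     (pcomp P (card S + 1) (r - card S + n) (card S + 1) (a (card S + 1)) (f (r - card S))))"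
    unfolding tw_pcomp_def
    by (rule sum_Sh_all[where G = "\<lambda>p xs ys. relabel P
     (xs @ [r + 1..<r + 1] @ ys @ [r + 1..<r + 1 + n] @ [r + 1 + n..<r + 1 + n])
     (pcomp P (p + 1) (r - p + n) (p + 1) (a (p + 1)) (f (r - p)))"])
  also have "\<dots> = (\<Sum>S\<in>Pow {1..r}. lterm f \<nu> X (X - S))"
  proof (rule sum.cong[OF refl])
    fix S assume S: "S \<in> Pow {1..r}"
    let ?xs = "sorted_of S" and ?ss = "sorted_of ({1..r} - S)"
    have fS: "finite S" using S finite_subset by auto
    have d: "distinct (?xs @ ?ss @ \<nu>)" and X: "X = set (?xs @ ?ss @ \<nu>)" "X - S = set (?ss @ \<nu>)"
      and z: "0 \<notin> set (?xs @ ?ss @ \<nu>)"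
      using S fS sn by (auto simp: X_def \<nu>_def simp del: upt_Suc)
    have "arrangement (?xs @ ?ss @ \<nu>) (r + n)" using d X by (simp add: arrangement_def X_def)
    from lab_arrangement[OF this]
    have "lterm f \<nu> X (X - S) = relabel P (?xs @ ?ss @ \<nu>)
      (pcomp P (length ?xs + 1) (length ?ss + n) (length ?xs + 1) (a (length ?xs + 1)) (f (length ?ss)))"
      using lterm_lab[OF f _ d z X] by (simp add: \<nu>_def del: upt_Suc)
    moreover have "length ?ss = r - card S" "length ?xs = card S"
      using S fS by (auto simp: card_Diff_subset)
    moreover have "[r + 1..<r + 1 + n] = \<nu>" by (simp add: \<nu>_def del: upt_Suc)
    ultimately show "relabel P
     (sorted_of S @ [r + 1..<r + 1] @ sorted_of ({1..r} - S) @ [r + 1..<r + 1 + n] @ [r + 1 + n..<r + 1 + n])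
     (pcomp P (card S + 1) (r - card S + n) (card S + 1) (a (card S + 1)) (f (r - card S))) = lterm f \<nu> X (X - S)"
      by simp
  qed
  also have "\<dots> = lstar f \<nu> X"
    unfolding lstar_def
  proof (rule sum.reindex_bij_witness[where i = "\<lambda>T. X - T" and j = "\<lambda>T. X - T"])
    fix T assume "T \<in> {S. set \<nu> \<subseteq> S \<and> S \<subseteq> X}"
    then have T: "{r + 1..r + n} \<subseteq> T" "T \<subseteq> X" using sn by auto
    then show "X - (X - T) = T" by auto
    show "X - T \<in> Pow {1..r}"
    proof (intro PowI subsetI)
      fix x assume "x \<in> X - T"
      then have "x \<in> {1..r + n}" "x \<notin> {r + 1..r + n}" using T by (auto simp: X_def)
      then show "x \<in> {1..r}" by auto
    qed
  next
    fix S assume "S \<in> Pow {1..r}"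
    then show "X - (X - S) = S" "X - S \<in> {S. set \<nu> \<subseteq> S \<and> S \<subseteq> X}"
      unfolding sn by (auto simp: X_def)
  qed simp
  finally show ?thesis .
qed

text \<open>
  The input \<open>i\<close> of \<open>f\<close> has the label \<open>r + i\<close>, which passes to the non-symmetric input of \<open>\<kappa>\<close>, the last one of
  the inserted \<open>\<mu>\<close>. The other labels of this \<open>\<mu>\<close> are the complement of the set selected by the shuffle.
\<close>
lemma tw_pcomp_kappa_right:
  fixes r :: nat
  assumes f: "f \<in> tw_part P n d"
  defines "X \<equiv> {1..r + n}" and "\<nu> \<equiv> [r + 1..<r + n + 1]"
  assumes i: "i \<in> {1..n}"
  shows "tw_pcomp P n 1 i f (\<lambda>r. a (r + 1)) r = (\<Sum>S\<in>Pow {1..r}. rterm f \<nu> X (insert (r + i) S))"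
proof -
  let ?n1 = "[r + 1..<r + i]" and ?c = "r + i" and ?n2 = "[r + i + 1..<r + n + 1]"
  have sn: "set \<nu> = {r + 1..r + n}" by (auto simp: \<nu>_def simp del: upt_Suc)
  have \<nu>: "\<nu> = ?n1 @ ?c # ?n2"
  proof -
    have "[r + 1..<r + n + 1] = [r + 1..<r + i] @ [r + i..<r + n + 1]"
      using i upt_add_eq_append[of "r + 1" "r + i" "n + 1 - i"] by simp
    also have "[r + i..<r + n + 1] = ?c # ?n2" using i by (subst upt_conv_Cons) auto
    finally show ?thesis by (simp add: \<nu>_def)
  qed
  have ln: "length \<nu> = n" by (simp add: \<nu>_def del: upt_Suc)
  have "tw_pcomp P n 1 i f (\<lambda>r. a (r + 1)) r = (\<Sum>S\<in>Pow {1..r}. relabel P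
     (sorted_of S @ ?n1 @ sorted_of ({1..r} - S) @ [r + i..<r + i + 1] @ [r + i + 1..<r + n + 1])
     (pcomp P (card S + n) (r - card S + 1) (card S + i) (f (card S)) (a (r - card S + 1))))"
    unfolding tw_pcomp_def
    by (rule sum_Sh_all[where G = "\<lambda>p xs ys. relabel P
     (xs @ ?n1 @ ys @ [r + i..<r + i + 1] @ [r + i + 1..<r + n + 1])
     (pcomp P (p + n) (r - p + 1) (p + i) (f p) (a (r - p + 1)))"])
  also have "\<dots> = (\<Sum>S\<in>Pow {1..r}. rterm f \<nu> X (insert (r + i) ({1..r} - S)))"
  proof (rule sum.cong[OF refl])
    fix S assume S: "S \<in> Pow {1..r}"
    let ?zs = "sorted_of S" and ?ss = "sorted_of ({1..r} - S)"
    let ?L = "?zs @ ?n1 @ (?ss @ [?c]) @ ?n2"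
    have fS: "finite S" using S finite_subset by auto
    have d: "distinct (?ss @ ?zs @ \<nu>)" and X: "X = set (?ss @ ?zs @ \<nu>)"
      and T: "insert (r + i) ({1..r} - S) = set (?ss @ [?c])"
      using S fS sn by (auto simp: X_def \<nu>_def simp del: upt_Suc)
    have "distinct ?L" "set ?L = X" using d X unfolding \<nu> by auto
    then have "arrangement ?L (r + n)" by (simp add: arrangement_def X_def)
    from lab_arrangement[OF this]
    have "rterm f \<nu> X (insert (r + i) ({1..r} - S)) = relabel P ?L
      (pcomp P (length ?zs + n) (length ?ss + 1) (length ?zs + length ?n1 + 1) (f (length ?zs)) (a (length ?ss + 1)))"
      using rterm_bound[OF f ln \<nu> d T X] by (simp del: upt_Suc)
    moreover have "length ?ss = r - card S" "length ?zs = card S"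
      using S fS by (auto simp: card_Diff_subset)
    moreover have "length ?zs + length ?n1 + 1 = card S + i" using i fS by simp
    moreover have "[r + i..<r + i + 1] = [?c]" by simp
    ultimately show "relabel P
     (sorted_of S @ ?n1 @ sorted_of ({1..r} - S) @ [r + i..<r + i + 1] @ [r + i + 1..<r + n + 1])
     (pcomp P (card S + n) (r - card S + 1) (card S + i) (f (card S)) (a (r - card S + 1))) =
       rterm f \<nu> X (insert (r + i) ({1..r} - S))"
      by (simp del: upt_Suc)
  qed
  also have "\<dots> = (\<Sum>S\<in>Pow {1..r}. rterm f \<nu> X (insert (r + i) S))"
    by (rule sum_Pow_compl)
  finally show ?thesis .
qed

lemma fam_interval:
  assumes "f r \<in> part P (r + n) e"
  shows "fam f [r + 1..<r + n + 1] {1..r + n} = f r"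
proof -
  let ?X = "{1..r + n}" and ?\<nu> = "[r + 1..<r + n + 1]"
  have XV: "?X - set ?\<nu> = {1..r}" by auto
  have "sorted_of {1..r} @ ?\<nu> = [1..<r + n + 1]"
    using upt_add_eq_append[of 1 "r + 1" n] sorted_list_of_set_range[of 1 "r + 1"]
    by (simp add: atLeastLessThanSuc_atLeastAtMost del: upt_Suc)
  moreover have "lab P [1..<r + n + 1] (f r) = f r"
    using lab_sorted[of "{1..<r + n + 1}" "f r" e] assms by (simp del: upt_Suc)
  ultimately show ?thesis unfolding fam_def XV by (simp del: upt_Suc)
qed

lemma tw_dif_eq_tw_dif_on:
  assumes f: "f \<in> tw_part P n d"
  shows "tw_dif P a n d f r = tw_dif_on d f [r + 1..<r + n + 1] {1..r + n}"
proof -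
  let ?X = "{1..r + n}" and ?\<nu> = "[r + 1..<r + n + 1]"
  have sn: "set ?\<nu> = {r + 1..r + n}" by (auto simp del: upt_Suc)
  have XV: "?X - set ?\<nu> = {1..r}" unfolding sn by auto
  note fam = fam_interval[of f r n, OF tw_partD(1)[OF f]]
  have "rstar f ?\<nu> ?X = (\<Sum>S\<in>Pow {1..r} - {{}}. rterm f ?\<nu> ?X S) +
    (\<Sum>i\<in>{r + 1..r + n}. \<Sum>S\<in>Pow {1..r}. rterm f ?\<nu> ?X (insert i S))"
    unfolding rstar_def sn by (subst sum_contractions) (use XV sn in auto)
  also have "(\<Sum>i\<in>{r + 1..r + n}. \<Sum>S\<in>Pow {1..r}. rterm f ?\<nu> ?X (insert i S)) =
    (\<Sum>i=1..n. \<Sum>S\<in>Pow {1..r}. rterm f ?\<nu> ?X (insert (r + i) S))"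
    by (rule sum.reindex_bij_witness[where j = "\<lambda>i. i - r" and i = "\<lambda>i. r + i"]) auto
  also have "\<dots> = (\<Sum>i=1..n. tw_pcomp P n 1 i f (\<lambda>r. a (r + 1)) r)"
    by (rule sum.cong[OF refl]) (rule tw_pcomp_kappa_right[OF f, symmetric])
  finally have R: "rstar f ?\<nu> ?X = (\<Sum>S\<in>Pow {1..r} - {{}}. rterm f ?\<nu> ?X S) +
     (\<Sum>i=1..n. tw_pcomp P n 1 i f (\<lambda>r. a (r + 1)) r)" .
  have "tw_dif P a n d f r = dif P (r + n) (d - 2 * int r) (f r)
      - sgn_pow d (\<Sum>S\<in>Pow {1..r} - {{}}. rterm f ?\<nu> ?X S)
      + lstar f ?\<nu> ?X
      - sgn_pow d (\<Sum>i = 1..n. tw_pcomp P n 1 i f (\<lambda>r. a (r + 1)) r)"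
    unfolding tw_dif_def Let_def tw_dif_insertion[OF f] tw_pcomp_kappa_left[OF f] ..
  moreover have "card ?X = r + n" "card (?X - set ?\<nu>) = r" unfolding XV by simp_all
  ultimately show ?thesis
    unfolding tw_dif_on_def fam R sgn_pow_simps(1) by simp
qed

text \<open>
  A permutation of the symmetric inputs renames labels in \<open>{1..r}\<close> and leaves \<open>\<nu>\<close> alone, so that it preserves
  the differential by naturality.
\<close>
lemma tw_dif_part:
  assumes f: "f \<in> tw_part P n d"
  shows "tw_dif P a n d f \<in> tw_part P n (d + 1)"
  unfolding tw_part_def
proof (intro CollectI allI conjI impI)
  fix r
  let ?X = "{1..r + n}" and ?\<nu> = "[r + 1..<r + n + 1]"
  have sn: "set ?\<nu> = {r + 1..r + n}" by (auto simp del: upt_Suc)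
  have XV: "?X - set ?\<nu> = {1..r}" unfolding sn by auto
  have len: "length ?\<nu> = n" "distinct ?\<nu>" "set ?\<nu> \<subseteq> ?X" "finite ?X" "0 \<notin> ?X"
    using sn by (auto simp del: upt_Suc)
  have "tw_dif_on d f ?\<nu> ?X \<in> part P (card ?X) (d - 2 * int (card (?X - set ?\<nu>)) + 1)"
    by (rule tw_dif_on_part[OF f len])
  then show p: "tw_dif P a n d f r \<in> part P (r + n) (d + 1 - 2 * int r)"
    unfolding tw_dif_eq_tw_dif_on[OF f] XV by (simp add: algebra_simps del: upt_Suc)
  fix \<sigma> assume \<sigma>: "\<sigma> permutes {1..r}"
  then have \<sigma>': "\<sigma> permutes ?X" by (rule permutes_subset) auto
  have "act P (r + n) \<sigma> (tw_dif P a n d f r) = lab P (map \<sigma> [1..<r + n + 1]) (tw_dif P a n d f r)"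
    unfolding lab_arrangement[OF arrangement_permutes[OF \<sigma>']] by (rule act_conv_relabel[OF \<sigma>'])
  also have "[1..<r + n + 1] = sorted_of ?X"
    using sorted_list_of_set_range[of 1 "r + n + 1"]
    by (simp add: atLeastLessThanSuc_atLeastAtMost del: upt_Suc)
  also have "lab P (map \<sigma> (sorted_of ?X)) (tw_dif P a n d f r) = ren ?X \<sigma> (tw_dif_on d f ?\<nu> ?X)"
    unfolding ren_def tw_dif_eq_tw_dif_on[OF f] ..
  also have "\<dots> = tw_dif_on d f (map \<sigma> ?\<nu>) (\<sigma> ` ?X)"
    using permutes_image[OF \<sigma>'] by (intro tw_dif_on_ren[OF f len permutes_inj_on[OF \<sigma>']]) simp
  also have "map \<sigma> ?\<nu> = ?\<nu>"
    by (intro map_idI permutes_not_in[OF \<sigma>]) (use sn in auto)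
  also have "\<sigma> ` ?X = ?X" by (rule permutes_image[OF \<sigma>'])
  finally show "act P (r + n) \<sigma> (tw_dif P a n d f r) = tw_dif P a n d f r"
    unfolding tw_dif_eq_tw_dif_on[OF f] .
qed

text \<open>
  Iterated differentials can be computed on label sets: the sequence \<open>tw_dif P a n d f\<close> is defined by its
  values on the sets \<open>{1..r + n}\<close>, and an enumeration of \<open>X\<close> transports them to \<open>X\<close>.
\<close>
lemma fam_tw_dif:
  assumes f: "f \<in> tw_part P n d" and \<nu>: "length \<nu> = n" "distinct \<nu>" "set \<nu> \<subseteq> X"
    and X: "finite X" "0 \<notin> X"
  shows "fam (tw_dif P a n d f) \<nu> X = tw_dif_on d f \<nu> X"
proof -
  define zs where "zs = sorted_of (X - set \<nu>)"
  define r where "r = length zs"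
  have eq: "X = set (zs @ \<nu>)" and d: "distinct (zs @ \<nu>)" using \<nu> X by (auto simp: zs_def)
  define \<beta> where "\<beta> j = (zs @ \<nu>) ! (j - 1)" for j
  let ?Y = "{1..r + n}" and ?\<nu> = "[r + 1..<r + n + 1]"
  have sn: "set ?\<nu> = {r + 1..r + n}" by (auto simp del: upt_Suc)
  have len: "length ?\<nu> = n" "distinct ?\<nu>" "set ?\<nu> \<subseteq> ?Y" "finite ?Y" "0 \<notin> ?Y"
    using sn by (auto simp del: upt_Suc)
  have l: "length (zs @ \<nu>) = r + n" using \<nu> by (simp add: r_def)
  have m: "map \<beta> [1..<r + n + 1] = zs @ \<nu>"
    by (rule nth_equalityI) (use l in \<open>auto simp: \<beta>_def simp del: upt_Suc\<close>)
  have m': "map \<beta> ?\<nu> = \<nu>"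
    by (rule nth_equalityI) (use l \<nu> in \<open>auto simp: \<beta>_def r_def nth_append simp del: upt_Suc\<close>)
  have s: "[1..<r + n + 1] = sorted_of ?Y"
    using sorted_list_of_set_range[of 1 "r + n + 1"]
    by (simp add: atLeastLessThanSuc_atLeastAtMost del: upt_Suc)
  have s': "set [1..<r + n + 1] = ?Y" by auto
  have im: "\<beta> ` ?Y = X" using m s' eq by (metis set_map)
  have inj: "inj_on \<beta> ?Y" using m d s' by (metis distinct_map)
  have "fam (tw_dif P a n d f) \<nu> X = lab P (zs @ \<nu>) (tw_dif P a n d f r)"
    unfolding r_def by (rule fam_eq[OF tw_dif_part[OF f] d \<nu>(1) eq])
  also have "\<dots> = ren ?Y \<beta> (tw_dif_on d f ?\<nu> ?Y)"
    unfolding ren_def tw_dif_eq_tw_dif_on[OF f] s[symmetric] m ..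
  also have "\<dots> = tw_dif_on d f (map \<beta> ?\<nu>) (\<beta> ` ?Y)"
    using im X(2) by (intro tw_dif_on_ren[OF f len inj]) simp
  finally show ?thesis unfolding m' im .
qed

end

section \<open>The Maurer-Cartan equation on arbitrary label sets\<close>

context mc_operad
begin

lemma half_zero:
  assumes "(x :: 'a) = - x"
  shows "x = 0"
proof -
  have "scl P 2 x = scl P (1 + 1) x" by simp
  also have "\<dots> = x + x" by (simp only: scale_left_distrib scale_one)
  also have "\<dots> = 0" using assms by (metis add.right_inverse)
  finally show ?thesis by simp
qed

lemma a_part': "finite Y \<Longrightarrow> Y \<noteq> {} \<Longrightarrow> a (card Y) \<in> part P (card Y) (3 - 2 * int (card Y))"
  using a_part[of "card Y"] card_gt_0_iff[of Y] by simp

text \<open>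
  The family \<open>a\<close> is itself a twisted element, without non-symmetric inputs. So the reformulation of sums over
  shuffles and its naturality apply to the relation between the generators as well.
\<close>
definition lie_seq :: "nat \<Rightarrow> 'a" where
  "lie_seq r = (if r = 0 then 0 else a r)"

lemma lie_seq_tw_part: "lie_seq \<in> tw_part P 0 3"
  unfolding tw_part_def
proof (intro CollectI allI conjI impI)
  fix r
  show "lie_seq r \<in> part P (r + 0) (3 - 2 * int r)"
    using a_part[of r] subgroup_zero[OF subgroup_part] by (simp add: lie_seq_def)
  fix \<sigma> assume "\<sigma> permutes {1..r}"
  then show "act P (r + 0) \<sigma> (lie_seq r) = lie_seq r"
    using a_inv[of r \<sigma>] additive_on_zero[OF additive_act[of \<sigma> r 0]] by (cases "r = 0") (simp_all add: lie_seq_def)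
qed

lemma fam_lie_seq: "finite U \<Longrightarrow> U \<noteq> {} \<Longrightarrow> fam lie_seq [] U = a (card U)"
  using lab_sorted[of U "a (card U)"] a_part'[of U] by (simp add: fam_def lie_seq_def)

definition lie_term :: "nat \<Rightarrow> nat set \<Rightarrow> nat set \<Rightarrow> 'a" where
  "lie_term c U S = circ (U - S \<union> {c}) c S (a (card (U - S \<union> {c}))) (a (card S))"

lemma rterm_lie_seq:
  assumes U: "finite U" and S: "S \<subseteq> U" "c \<in> S"
  shows "rterm lie_seq [] U S = lie_term c U S"
proof -
  have fS: "finite S" "S \<noteq> {}" using S U finite_subset by auto
  let ?zs = "sorted_of (U - S)" and ?ss = "sorted_of S"
  have "lie_term c U S = circ (U - S \<union> {c}) c S (fam lie_seq [] (U - S \<union> {c})) (a (card S))"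
    unfolding lie_term_def by (subst fam_lie_seq) (use U in auto)
  also have "\<dots> = lab P (?ss @ ?zs @ []) (pcomp P (length ?zs + 1 + 0) (length ?ss) 1 (lie_seq (length ?zs + 1)) (a (length ?ss)))"
    by (rule circ_fam_a_free[OF lie_seq_tw_part]) (use U S fS in auto)
  also have "\<dots> = rterm lie_seq [] U S"
    by (rule rterm_free[OF lie_seq_tw_part, symmetric]) (use U S fS in auto)
  finally show ?thesis ..
qed

lemma maurer_cartan_interval:
  assumes "k \<ge> 1"
  shows "dif P k (3 - 2 * int k) (a k) = - rstar lie_seq [] {1..k}"
proof -
  have "(\<Sum>p = 1..k. \<Sum>\<sigma>\<in>Sh p (k - p). act P k \<sigma> (pcomp P (k - p + 1) p 1 (a (k - p + 1)) (a p))) =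
     (\<Sum>p = 1..k. \<Sum>\<sigma>\<in>Sh p (k - p).
      relabel P (map \<sigma> [1..<p + 1] @ map \<sigma> [p + 1..<k + 1] @ [k + 1..<k + 0 + 1])
        (pcomp P (k - p + 1 + 0) p 1 (lie_seq (k - p + 1)) (a p)))"
  proof (intro sum.cong refl)
    fix p \<sigma> assume p: "p \<in> {1..k}" and \<sigma>: "\<sigma> \<in> Sh p (k - p)"
    then have s: "\<sigma> permutes {1..k}" by (simp add: Sh_def)
    have "[1..<p + 1] @ [p + 1..<k + 1] = [1..<k + 1]"
      using p upt_add_eq_append[of 1 "p + 1" "k - p"] by simp
    then have "map \<sigma> [1..<p + 1] @ map \<sigma> [p + 1..<k + 1] @ [k + 1..<k + 0 + 1] = map \<sigma> [1..<k + 1]"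
      by (simp del: upt_Suc flip: map_append)
    then show "act P k \<sigma> (pcomp P (k - p + 1) p 1 (a (k - p + 1)) (a p)) =
      relabel P (map \<sigma> [1..<p + 1] @ map \<sigma> [p + 1..<k + 1] @ [k + 1..<k + 0 + 1])
        (pcomp P (k - p + 1 + 0) p 1 (lie_seq (k - p + 1)) (a p))"
      using act_conv_relabel[OF s, of "pcomp P (k - p + 1) p 1 (a (k - p + 1)) (a p)"]
      by (simp add: lie_seq_def del: upt_Suc)
  qed
  also have "\<dots> = (\<Sum>S\<in>Pow {1..k} - {{}}. rterm lie_seq [k + 1..<k + 0 + 1] {1..k + 0} S)"
    by (rule tw_dif_insertion[OF lie_seq_tw_part])
  also have "\<dots> = rstar lie_seq [] {1..k}"
    unfolding rstar_def by (intro sum.cong) (auto simp: contractions_def)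
  finally show ?thesis using a_dif[OF assms] by simp
qed

text \<open>
  The function \<open>c\<close> names the contracted points; it is left arbitrary, since in the computation of \<open>D\<^sup>2\<close> the
  points come from \<open>pt V\<close> in one place and from \<open>Min\<close> in another.
\<close>
lemma maurer_cartan:
  assumes U: "finite U" "U \<noteq> {}" and c: "\<And>S. S \<subseteq> U \<Longrightarrow> S \<noteq> {} \<Longrightarrow> c S \<in> S"
  shows "dif P (card U) (3 - 2 * int (card U)) (a (card U)) = - (\<Sum>S\<in>Pow U - {{}}. lie_term (c S) U S)"
proof -
  let ?k = "card U" and ?Y = "{1..card U}"
  define \<beta> where "\<beta> j = sorted_of U ! (j - 1)" for j
  have k: "?k \<ge> 1" using U card_gt_0_iff[of U] by simp
  have m: "map \<beta> [1..<?k + 1] = sorted_of U"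
    by (rule nth_equalityI) (auto simp: \<beta>_def simp del: upt_Suc)
  have s': "set [1..<?k + 1] = ?Y" by auto
  have im: "\<beta> ` ?Y = U" using m s' U by (metis set_map set_sorted_list_of_set)
  have inj: "inj_on \<beta> ?Y" using m s' distinct_sorted_list_of_set[of U] by (metis distinct_map)
  have ren: "ren ?Y \<beta> (a ?k) = a ?k"
    unfolding ren_def by (rule lab_a) (use inj k in \<open>auto simp: distinct_map\<close>)
  have "dif P ?k (3 - 2 * int ?k) (a ?k) = ren ?Y \<beta> (dif P ?k (3 - 2 * int ?k) (a ?k))"
    using dif_ren[of ?Y \<beta> "a ?k"] inj a_part[OF k] ren by simp
  also have "\<dots> = ren ?Y \<beta> (- rstar lie_seq [] ?Y)" by (simp add: maurer_cartan_interval[OF k])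
  also have "\<dots> = - ren ?Y \<beta> (rstar lie_seq [] ?Y)"
    by (rule additive_on_minus[OF additive_ren rstar_part[OF lie_seq_tw_part]]) (use inj in auto)
  also have "ren ?Y \<beta> (rstar lie_seq [] ?Y) = rstar lie_seq (map \<beta> []) (\<beta> ` ?Y)"
    by (rule rstar_ren[OF lie_seq_tw_part]) (use inj in auto)
  also have "\<dots> = rstar lie_seq [] U" using im by simp
  also have "\<dots> = (\<Sum>S\<in>Pow U - {{}}. lie_term (c S) U S)"
    unfolding rstar_def
  proof (rule sum.cong)
    show "contractions (set []) U = Pow U - {{}}" by (auto simp: contractions_def)
    fix S assume "S \<in> Pow U - {{}}"
    then show "rterm lie_seq [] U S = lie_term (c S) U S" using U c by (intro rterm_lie_seq) auto
  qed
  finally show ?thesis .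
qed

end

section \<open>The twisted differential squares to zero\<close>

lemma sum_pairs_split:
  assumes "finite A"
  shows "(\<Sum>(S, T)\<in>A. h S T) =
    (\<Sum>(S, T) | (S, T) \<in> A \<and> Q S T. h S T) + (\<Sum>(S, T) | (S, T) \<in> A \<and> \<not> Q S T. h S T)"
proof (subst sum.union_disjoint[symmetric])
  show "finite {(S, T). (S, T) \<in> A \<and> Q S T}" "finite {(S, T). (S, T) \<in> A \<and> \<not> Q S T}"
    using assms by (auto intro: finite_subset[rotated])
qed (auto intro!: sum.cong)

context mc_operad
begin

context
  fixes f :: "nat \<Rightarrow> 'a" and n :: nat and d :: int and \<nu> :: "nat list" and V :: "nat set"
  assumes f: "f \<in> tw_part P n d" and \<nu>: "length \<nu> = n" "distinct \<nu>" and V: "V = set \<nu>"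
begin

definition deg :: "nat set \<Rightarrow> int" where
  "deg X = d - 2 * int (card (X - V))"

lemma fam_part': "finite X \<Longrightarrow> V \<subseteq> X \<Longrightarrow> fam f \<nu> X \<in> part P (card X) (deg X)"
  using fam_part[OF f \<nu>(2,1)] unfolding deg_def by (simp add: V)

lemma sgn_deg: "sgn_pow (deg X) x = sgn_pow d x"
  by (simp add: sgn_pow_def deg_def)

lemma rterm_eq: "rterm f \<nu> X S = circ (quot V X S) (pt V S) S (fam f \<nu> (quot V X S)) (a (card S))"
  by (simp add: rterm_def V)

lemma lterm_eq: "finite X \<Longrightarrow> 0 \<notin> X \<Longrightarrow>
  lterm f \<nu> X S = circ (X - S \<union> {0}) 0 S (a (card (X - S \<union> {0}))) (fam f \<nu> S)"
  by (simp add: lterm_def)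

abbreviation rins :: "nat set \<Rightarrow> nat set \<Rightarrow> 'a \<Rightarrow> 'a" where
  "rins X S v \<equiv> circ (quot V X S) (pt V S) S v (a (card S))"

abbreviation lins :: "nat set \<Rightarrow> nat set \<Rightarrow> 'a \<Rightarrow> 'a" where
  "lins X S w \<equiv> circ (X - S \<union> {0}) 0 S (a (card (X - S \<union> {0}))) w"

lemma deg_quot:
  assumes "finite X" "V \<subseteq> X" "S \<in> contractions V X"
  shows "deg X + 1 = deg (quot V X S) + (3 - 2 * int (card S))"
  using quot_props(7)[OF assms] by (simp add: deg_def)

text \<open>
  The sign comes from exchanging two elements of odd degree.
\<close>
lemma insert_twice_parallel:
  assumes X: "finite X" "V \<subseteq> X"
    and S: "S \<in> contractions V X" and T: "T \<in> contractions V X" "S \<inter> T = {}"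
  shows "rins X S (rterm f \<nu> (quot V X S) T) =
    - rins X T (rterm f \<nu> (quot V X T) S)"
proof -
  note s = contractionsD[OF S X(1)] and t = contractionsD[OF T(1) X(1)]
  have T': "T \<in> contractions V (quot V X S)" "S \<in> contractions V (quot V X T)"
    using parallel_contraction[OF X(1)] S T by blast+
  let ?Q = "quot V (quot V X S) T"
  have Q: "quot V (quot V X T) S = ?Q" using s(4) t(4) T(2) by (auto simp: quot_def)
  note qs = quot_props[OF X S] and qt = quot_props[OF X T(1)]
  note q = quot_props[OF qs(1,2) T'(1)]
  have ne: "pt V S \<noteq> pt V T" using s(4) t(4) T(2) by auto
  have eqs: "?Q - {pt V T} \<union> T = quot V X S" "?Q - {pt V S} \<union> S = quot V X T"
  proof -
    have ps: "pt V S \<notin> T" and ptn: "pt V T \<notin> S" using s(4) t(4) T(2) by auto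
    have "?Q - {pt V T} = X - S \<union> {pt V S} - T"
      using t(4) ptn unfolding quot_def by auto
    then show "?Q - {pt V T} \<union> T = quot V X S"
      using t(1) T(2) unfolding quot_def by auto
    have "?Q - {pt V S} = X - T \<union> {pt V T} - S"
      using s(4) ps ptn unfolding quot_def by auto
    then show "?Q - {pt V S} \<union> S = quot V X T"
      using s(1) T(2) unfolding quot_def by auto
  qed
  have "circ (?Q - {pt V T} \<union> T) (pt V S) S (circ ?Q (pt V T) T (fam f \<nu> ?Q) (a (card T))) (a (card S)) =
    sgn_pow ((3 - 2 * int (card T)) * (3 - 2 * int (card S)))
     (circ (?Q - {pt V S} \<union> S) (pt V T) T (circ ?Q (pt V S) S (fam f \<nu> ?Q) (a (card S))) (a (card T)))"
  proof (rule circ_parallel[where d = "deg ?Q"])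
    show "pt V T \<in> ?Q" by (rule q(5))
    show "pt V S \<in> ?Q" using T(2) s(4) by (auto simp: quot_def)
    show "T \<inter> (?Q - {pt V T}) = {}" by (rule q(4))
    show "S \<inter> (?Q - {pt V S}) = {}" using t(4) T(2) by (auto simp: quot_def)
    show "T \<inter> S = {}" using T(2) by auto
    show "pt V T \<noteq> pt V S" using ne by simp
    show "fam f \<nu> ?Q \<in> part P (card ?Q) (deg ?Q)" by (rule fam_part'[OF q(1,2)])
  qed (rule q(1) s(2) t(2) a_part'[OF s(2,3)] a_part'[OF t(2,3)])+
  then show ?thesis unfolding eqs rterm_eq Q by (simp add: sgn_pow_def)
qed

lemma insert_twice_nested:
  assumes X: "finite X" "V \<subseteq> X"
    and S: "S \<in> contractions V X" and T: "T \<in> contractions V (quot V X S)" "pt V S \<in> T"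
  defines "U \<equiv> T - {pt V S} \<union> S"
  shows "rins X S (rterm f \<nu> (quot V X S) T) =
    circ (quot V X U) (pt V U) U (fam f \<nu> (quot V X U)) (lie_term (pt V S) U S)"
proof -
  note U = nested_contraction[OF X(1) S T, folded U_def]
  note s = contractionsD[OF S X(1)] and qs = quot_props[OF X S]
  note t = contractionsD[OF T(1) qs(1)] and q = quot_props[OF qs(1,2) T(1)]
  let ?Q = "quot V X U"
  have e: "?Q - {pt V T} \<union> T = quot V X S"
    using t(1,4) unfolding U(4)[symmetric] quot_def[of V _ T] by auto
  have "circ (?Q - {pt V T} \<union> T) (pt V S) S (circ ?Q (pt V T) T (fam f \<nu> ?Q) (a (card T))) (a (card S)) =
    circ ?Q (pt V T) (T - {pt V S} \<union> S) (fam f \<nu> ?Q) (circ T (pt V S) S (a (card T)) (a (card S)))"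
  proof (rule circ_nested[where d = "deg ?Q"])
    show "finite ?Q" "pt V T \<in> ?Q" "T \<inter> (?Q - {pt V T}) = {}"
      using q(1,4,5) unfolding U(4) by simp_all
    show "S \<inter> (?Q - {pt V T}) = {}" using U(2,3) quot_props(4)[OF X U(1)] by auto
    show "S \<inter> (T - {pt V S}) = {}" using t(1) by (auto simp: quot_def)
    show "fam f \<nu> ?Q \<in> part P (card ?Q) (deg ?Q)"
      using fam_part'[OF q(1,2)] unfolding U(4) .
  qed (rule s(2) t(2) T(2) a_part'[OF s(2,3)] a_part'[OF t(2,3)])+
  moreover have "T = U - S \<union> {pt V S}" using U(5) by (simp add: quot_def)
  ultimately show ?thesis
    unfolding e rterm_eq U(4) U(3) lie_term_def U_def[symmetric] by simp
qed

text \<open>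
  The identity \<open>(f \<star> \<mu>) \<star> \<mu> = f \<star> (\<mu> \<star> \<mu>)\<close>, with \<open>- \<partial> \<mu>\<close> in place of \<open>\<mu> \<star> \<mu>\<close>. The pairs \<open>(S, T)\<close> of
  successively contracted sets split into parallel ones, on which exchanging \<open>S\<close> and \<open>T\<close> reverses the
  sign, and nested ones, which correspond to pairs \<open>(U, S)\<close> with \<open>S \<subseteq> U\<close>.
\<close>
lemma insert_twice:
  assumes X: "finite X" "V \<subseteq> X" "0 \<notin> X"
  shows "(\<Sum>S\<in>contractions V X. rins X S (rstar f \<nu> (quot V X S))) =
    - (\<Sum>U\<in>contractions V X. circ (quot V X U) (pt V U) U (fam f \<nu> (quot V X U))
        (dif P (card U) (3 - 2 * int (card U)) (a (card U))))"
proof -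
  let ?J = "contractions V"
  let ?h = "\<lambda>S T. rins X S (rterm f \<nu> (quot V X S) T)"
  let ?g = "\<lambda>U S. circ (quot V X U) (pt V U) U (fam f \<nu> (quot V X U)) (lie_term (pt V S) U S)"
  have fJ: "finite (?J Y)" if "finite Y" for Y
    by (rule finite_subset[of _ "Pow Y"]) (use that in \<open>auto simp: contractions_def\<close>)
  have "(\<Sum>S\<in>?J X. rins X S (rstar f \<nu> (quot V X S))) =
      (\<Sum>S\<in>?J X. \<Sum>T\<in>?J (quot V X S). ?h S T)"
  proof (rule sum.cong[OF refl])
    fix S assume S: "S \<in> ?J X"
    note s = contractionsD[OF S X(1)] and qs = quot_props[OF X(1,2) S]
    show "rins X S (rstar f \<nu> (quot V X S)) =
        (\<Sum>T\<in>?J (quot V X S). ?h S T)"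
      unfolding rstar_def V[symmetric]
    proof (rule additive_on_sum[OF additive_circ_left])
      show "a (card S) \<in> part P (card S) (3 - 2 * int (card S))" by (rule a_part'[OF s(2,3)])
      show "rterm f \<nu> (quot V X S) T \<in> part P (card (quot V X S)) (deg (quot V X S) + 1)"
        if "T \<in> ?J (quot V X S)" for T
        using rterm_part[OF f \<nu> _ qs(1)] that qs(2) unfolding deg_def by (simp add: V)
    qed (rule qs(1,4,5) s(2))+
  qed
  also have "\<dots> = (\<Sum>(S, T)\<in>Sigma (?J X) (\<lambda>S. ?J (quot V X S)). ?h S T)"
    using fJ X(1) quot_props(1)[OF X(1,2)] by (subst sum.Sigma) auto
  also have "\<dots> = (\<Sum>(S, T) | (S, T) \<in> Sigma (?J X) (\<lambda>S. ?J (quot V X S)) \<and> pt V S \<in> T. ?h S T) +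
      (\<Sum>(S, T) | (S, T) \<in> Sigma (?J X) (\<lambda>S. ?J (quot V X S)) \<and> pt V S \<notin> T. ?h S T)"
    (is "_ = ?N + ?Pl")
    by (rule sum_pairs_split) (use fJ X(1) quot_props(1)[OF X(1,2)] in \<open>intro finite_SigmaI; auto\<close>)
  \<comment> \<open>exchanging \<open>S\<close> and \<open>T\<close> permutes the parallel pairs and reverses the sign\<close>
  also have "?Pl = 0"
  proof (rule half_zero)
    have eq: "{(S, T). (S, T) \<in> Sigma (?J X) (\<lambda>S. ?J (quot V X S)) \<and> pt V S \<notin> T} =
       {(S, T). S \<in> ?J X \<and> T \<in> ?J X \<and> S \<inter> T = {}}"
      using parallel_contraction[OF X(1), of _ V] by auto
    have "(\<Sum>(S, T) | S \<in> ?J X \<and> T \<in> ?J X \<and> S \<inter> T = {}. ?h S T) =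
        (\<Sum>(S, T) | S \<in> ?J X \<and> T \<in> ?J X \<and> S \<inter> T = {}. - ?h S T)"
    proof (rule sum.reindex_bij_witness[where i = "\<lambda>(S, T). (T, S)" and j = "\<lambda>(S, T). (T, S)"], goal_cases)
      case (5 z)
      then obtain S T where "z = (S, T)" "S \<in> ?J X" "T \<in> ?J X" "S \<inter> T = {}" by auto
      then show ?case using insert_twice_parallel[OF X(1,2), of S T] by simp
    qed auto
    then show "?Pl = - ?Pl" unfolding eq by (simp add: sum_negf case_prod_unfold)
  qed
  \<comment> \<open>a nested pair is determined by the union \<open>U\<close> and its subset \<open>S\<close>\<close>
  also have "?N = (\<Sum>(U, S)\<in>Sigma (?J X) (\<lambda>U. Pow U - {{}}). ?g U S)"
  proof (rule sum.reindex_bij_witness[where i = "\<lambda>(U, S). (S, quot V U S)"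
        and j = "\<lambda>(S, T). (T - {pt V S} \<union> S, S)"], goal_cases)
    case (1 z)
    then obtain S T where z: "z = (S, T)" "S \<in> ?J X" "T \<in> ?J (quot V X S)" "pt V S \<in> T" by auto
    then show ?case using nested_contraction(5)[OF X(1) z(2-4)] by simp
  next
    case (2 z)
    then obtain S T where z: "z = (S, T)" "S \<in> ?J X" "T \<in> ?J (quot V X S)" "pt V S \<in> T" by auto
    then show ?case
      using nested_contraction(1,2)[OF X(1) z(2-4)] contractionsD(3)[OF z(2) X(1)] by auto
  next
    case (3 z)
    then obtain U S where z: "z = (U, S)" "U \<in> ?J X" "S \<subseteq> U" "S \<noteq> {}" by auto
    then show ?case using contraction_of_nested(4)[OF X(1) z(2-4)] by simp
  next
    case (4 z)
    then obtain U S where z: "z = (U, S)" "U \<in> ?J X" "S \<subseteq> U" "S \<noteq> {}" by auto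
    then show ?case using contraction_of_nested(1-3)[OF X(1) z(2-4)] by simp
  next
    case (5 z)
    then obtain S T where z: "z = (S, T)" "S \<in> ?J X" "T \<in> ?J (quot V X S)" "pt V S \<in> T" by auto
    then show ?case using insert_twice_nested[OF X(1,2) z(2-4)] by simp
  qed
  also have "\<dots> = (\<Sum>U\<in>?J X. \<Sum>S\<in>Pow U - {{}}. ?g U S)"
    using fJ[OF X(1)] contractionsD(2)[OF _ X(1)] by (subst sum.Sigma) auto
  also have "\<dots> = (\<Sum>U\<in>?J X. - circ (quot V X U) (pt V U) U (fam f \<nu> (quot V X U))
        (dif P (card U) (3 - 2 * int (card U)) (a (card U))))"
  proof (rule sum.cong[OF refl])
    fix U assume U: "U \<in> ?J X"
    note u = contractionsD[OF U X(1)] and qu = quot_props[OF X(1,2) U]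
    have add: "additive_on (part P (card U) (4 - 2 * int (card U))) (circ (quot V X U) (pt V U) U (fam f \<nu> (quot V X U)))"
      by (rule additive_circ_right[where d = "deg (quot V X U)"]) (rule u(2) qu(1,4,5) fam_part'[OF qu(1,2)])+
    have mp: "lie_term (pt V S) U S \<in> part P (card U) (4 - 2 * int (card U))" if "S \<in> Pow U - {{}}" for S
    proof -
      have S: "S \<in> ?J X" using contraction_of_nested(1)[OF X(1) U] that by auto
      note s = contractionsD[OF S X(1)]
      have c: "card (U - S \<union> {pt V S}) + card S = card U + 1"
      proof -
        have "card (U - S \<union> {pt V S}) = card (U - S) + 1" using u(2) s(4) by simp
        then show ?thesis
          using that s(2) card_mono[OF u(2), of S] by (simp add: card_Diff_subset)
      qed
      have "lie_term (pt V S) U S \<in> part P (card (U - S \<union> {pt V S}) + card S - 1)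
          (3 - 2 * int (card (U - S \<union> {pt V S})) + (3 - 2 * int (card S)))"
        unfolding lie_term_def
      proof (rule circ_part)
        show "a (card (U - S \<union> {pt V S})) \<in> part P (card (U - S \<union> {pt V S}))
            (3 - 2 * int (card (U - S \<union> {pt V S})))"
          using u(2) by (intro a_part') auto
        show "a (card S) \<in> part P (card S) (3 - 2 * int (card S))" by (rule a_part'[OF s(2,3)])
      qed (use u(2) s(2) in auto)
      moreover have "3 - 2 * int (card (U - S \<union> {pt V S})) + (3 - 2 * int (card S)) = 4 - 2 * int (card U)"
        using c by linarith
      moreover have "card (U - S \<union> {pt V S}) + card S - 1 = card U" using c by simp
      ultimately show ?thesis by (simp only:)
    qed
    have pS: "pt V S \<in> S" if "S \<subseteq> U" "S \<noteq> {}" for S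
      using contraction_of_nested(1)[OF X(1) U that] contractionsD(4)[OF _ X(1)] by blast
    have "(\<Sum>S\<in>Pow U - {{}}. ?g U S) = circ (quot V X U) (pt V U) U (fam f \<nu> (quot V X U))
      (\<Sum>S\<in>Pow U - {{}}. lie_term (pt V S) U S)"
      by (rule additive_on_sum[OF add mp, symmetric])
    also have "(\<Sum>S\<in>Pow U - {{}}. lie_term (pt V S) U S) = - dif P (card U) (3 - 2 * int (card U)) (a (card U))"
      using maurer_cartan[OF u(2,3) pS] by simp
    also have "circ (quot V X U) (pt V U) U (fam f \<nu> (quot V X U)) \<dots> =
      - circ (quot V X U) (pt V U) U (fam f \<nu> (quot V X U)) (dif P (card U) (3 - 2 * int (card U)) (a (card U)))"
      using dif_part[OF a_part'[OF u(2,3)]] by (intro additive_on_minus[OF add]) (simp add: algebra_simps)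
    finally show "(\<Sum>S\<in>Pow U - {{}}. ?g U S) = - circ (quot V X U) (pt V U) U (fam f \<nu> (quot V X U))
        (dif P (card U) (3 - 2 * int (card U)) (a (card U)))" .
  qed
  finally show ?thesis by (simp add: sum_negf)
qed

text \<open>
  Both \<open>f\<close>, with labels \<open>T\<close>, and \<open>\<mu>\<close>, with labels \<open>W\<close>, are inserted into one \<open>\<mu>\<close>.
\<close>
definition parallel_term :: "nat set \<Rightarrow> nat set \<Rightarrow> nat set \<Rightarrow> 'a" where
  "parallel_term X T W =
    circ (X - W \<union> {Min W}) (Min W) W (lterm f \<nu> (X - W \<union> {Min W}) T) (a (card W))"

definition parallel_pairs :: "nat set \<Rightarrow> (nat set \<times> nat set) set" where
  "parallel_pairs X = {(T, W). V \<subseteq> T \<and> T \<subseteq> X \<and> W \<subseteq> X - T \<and> W \<noteq> {}}"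

lemma insert_into_lterm_nested:
  assumes X: "finite X" "V \<subseteq> X" "0 \<notin> X"
    and S: "S \<in> contractions V X" and T: "V \<subseteq> T" "T \<subseteq> quot V X S" "pt V S \<in> T"
  defines "U \<equiv> T - {pt V S} \<union> S"
  shows "rins X S (lterm f \<nu> (quot V X S) T) =
    lins X U (rterm f \<nu> U S)"
proof -
  note s = contractionsD[OF S X(1)] and qs = quot_props[OF X(1,2) S]
  have z: "0 \<notin> quot V X S" using qs(3) X(3) by auto
  have fT: "finite T" using T(2) qs(1) finite_subset by blast
  let ?B = "quot V X S - T \<union> {0}"
  have B: "?B = X - U \<union> {0}" using T s(1,4) unfolding U_def quot_def by auto
  have TU: "T = quot V U S" using T s(1,4) unfolding U_def quot_def by auto
  have e: "X - U \<union> {0} - {0} \<union> T = quot V X S" using z T(2) unfolding B[symmetric] by auto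
  have "circ (?B - {0} \<union> T) (pt V S) S (circ ?B 0 T (a (card ?B)) (fam f \<nu> T)) (a (card S)) =
    circ ?B 0 (T - {pt V S} \<union> S) (a (card ?B)) (circ T (pt V S) S (fam f \<nu> T) (a (card S)))"
  proof (rule circ_nested)
    show "T \<inter> (?B - {0}) = {}" by auto
    show "S \<inter> (?B - {0}) = {}" using T(3) by (auto simp: quot_def)
    show "S \<inter> (T - {pt V S}) = {}" using T(2) by (auto simp: quot_def)
    show "a (card ?B) \<in> part P (card ?B) (3 - 2 * int (card ?B))"
      using qs(1) by (intro a_part') auto
    show "fam f \<nu> T \<in> part P (card T) (deg T)" by (rule fam_part'[OF fT T(1)])
    show "a (card S) \<in> part P (card S) (3 - 2 * int (card S))" by (rule a_part'[OF s(2,3)])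
  qed (use qs(1) in simp, rule fT, rule s(2), simp, rule T(3))
  then show ?thesis
    unfolding e lterm_eq[OF qs(1) z] rterm_eq[of U S] TU[symmetric] B U_def[symmetric] .
qed

text \<open>
  The identity \<open>(\<mu> \<star> f) \<star> \<mu> = \<mu> \<star> (f \<star> \<mu>) + R\<close>: the contracted set \<open>S\<close> meets the labels \<open>T\<close> of \<open>f\<close> in its
  point or not at all. In the second case \<open>S\<close> contains no label of \<open>\<nu>\<close>, because all these belong to \<open>f\<close>.
\<close>
lemma insert_into_lstar:
  assumes X: "finite X" "V \<subseteq> X" "0 \<notin> X"
  shows "(\<Sum>S\<in>contractions V X. rins X S (lstar f \<nu> (quot V X S))) =
    (\<Sum>U | V \<subseteq> U \<and> U \<subseteq> X. lins X U (rstar f \<nu> U))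
    + (\<Sum>(T, W)\<in>parallel_pairs X. parallel_term X T W)"
proof -
  let ?J = "contractions V"
  let ?I = "\<lambda>Y. {T. V \<subseteq> T \<and> T \<subseteq> Y}"
  let ?h = "\<lambda>S T. rins X S (lterm f \<nu> (quot V X S) T)"
  let ?g = "\<lambda>U S. lins X U (rterm f \<nu> U S)"
  have fJ: "finite (?J Y)" "finite (?I Y)" if "finite Y" for Y
    by (rule finite_subset[of _ "Pow Y"]; use that in \<open>auto simp: contractions_def\<close>)+
  have "(\<Sum>S\<in>?J X. rins X S (lstar f \<nu> (quot V X S))) =
      (\<Sum>S\<in>?J X. \<Sum>T\<in>?I (quot V X S). ?h S T)"
  proof (rule sum.cong[OF refl])
    fix S assume S: "S \<in> ?J X"
    note s = contractionsD[OF S X(1)] and qs = quot_props[OF X(1,2) S]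
    have z: "0 \<notin> quot V X S" using qs(3) X(3) by auto
    show "rins X S (lstar f \<nu> (quot V X S)) =
        (\<Sum>T\<in>?I (quot V X S). ?h S T)"
      unfolding lstar_def V[symmetric]
    proof (rule additive_on_sum[OF additive_circ_left])
      show "a (card S) \<in> part P (card S) (3 - 2 * int (card S))" by (rule a_part'[OF s(2,3)])
      show "lterm f \<nu> (quot V X S) T \<in> part P (card (quot V X S)) (deg (quot V X S) + 1)"
        if "T \<in> ?I (quot V X S)" for T
        using lterm_part[OF f \<nu> _ qs(1) z] that unfolding deg_def by (simp add: V)
    qed (rule qs(1,4,5) s(2))+
  qed
  also have "\<dots> = (\<Sum>(S, T)\<in>Sigma (?J X) (\<lambda>S. ?I (quot V X S)). ?h S T)"
    using fJ X(1) quot_props(1)[OF X(1,2)] by (subst sum.Sigma) auto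
  also have "\<dots> = (\<Sum>(S, T) | (S, T) \<in> Sigma (?J X) (\<lambda>S. ?I (quot V X S)) \<and> pt V S \<in> T. ?h S T) +
      (\<Sum>(S, T) | (S, T) \<in> Sigma (?J X) (\<lambda>S. ?I (quot V X S)) \<and> pt V S \<notin> T. ?h S T)"
    (is "_ = ?N + ?Pl")
    by (rule sum_pairs_split) (use fJ X(1) quot_props(1)[OF X(1,2)] in \<open>intro finite_SigmaI; auto\<close>)
  \<comment> \<open>here \<open>S\<close> avoids \<open>\<nu>\<close>, so that \<open>pt V S = Min S\<close>\<close>
  also have "?Pl = (\<Sum>(T, W)\<in>parallel_pairs X. parallel_term X T W)"
  proof (rule sum.reindex_bij_witness[where i = "\<lambda>(T, W). (W, T)" and j = "\<lambda>(S, T). (T, S)"], goal_cases)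
    case (2 z)
    then obtain S T where z: "z = (S, T)" "S \<in> ?J X" "V \<subseteq> T" "T \<subseteq> quot V X S" "pt V S \<notin> T" by auto
    note s = contractionsD[OF z(2) X(1)]
    show ?case using z s(1,3) by (auto simp: parallel_pairs_def quot_def)
  next
    case (4 z)
    then obtain T W where z: "z = (T, W)" "V \<subseteq> T" "T \<subseteq> X" "W \<subseteq> X - T" "W \<noteq> {}"
      by (auto simp: parallel_pairs_def)
    then have W: "W \<in> ?J X" by (intro contractionsI) auto
    then show ?case using z contractionsD(4)[OF W X(1)] by (auto simp: quot_def)
  next
    case (5 z)
    then obtain S T where z: "z = (S, T)" "S \<in> ?J X" "V \<subseteq> T" "T \<subseteq> quot V X S" "pt V S \<notin> T" by auto
    note s = contractionsD[OF z(2) X(1)]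
    have "S \<inter> V = {}" using z(3,5) s(5) by auto
    then have "pt V S = Min S" by (rule s(6))
    then show ?case using z(1) by (simp add: parallel_term_def quot_def)
  qed auto
  also have "?N = (\<Sum>(U, S)\<in>Sigma (?I X) ?J. ?g U S)"
  proof (rule sum.reindex_bij_witness[where i = "\<lambda>(U, S). (S, quot V U S)"
        and j = "\<lambda>(S, T). (T - {pt V S} \<union> S, S)"], goal_cases)
    case (1 z)
    then obtain S T where z: "z = (S, T)" "S \<in> ?J X" "V \<subseteq> T" "T \<subseteq> quot V X S" "pt V S \<in> T" by auto
    note s = contractionsD[OF z(2) X(1)]
    show ?case using z(1,4,5) s(4) by (auto simp: quot_def)
  next
    case (2 z)
    then obtain S T where z: "z = (S, T)" "S \<in> ?J X" "V \<subseteq> T" "T \<subseteq> quot V X S" "pt V S \<in> T" by auto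
    note s = contractionsD[OF z(2) X(1)]
    have "S \<in> ?J (T - {pt V S} \<union> S)" using z(2) by (rule contractions_mono) auto
    moreover have "V \<subseteq> T - {pt V S} \<union> S" "T - {pt V S} \<union> S \<subseteq> X"
      using z(3,4) s(1,4) by (auto simp: quot_def)
    ultimately show ?case using z(1) by simp
  next
    case (3 z)
    then obtain U S where z: "z = (U, S)" "V \<subseteq> U" "U \<subseteq> X" "S \<in> ?J U" by auto
    have fU: "finite U" using z(3) X(1) finite_subset by blast
    note s = contractionsD[OF z(4) fU]
    show ?case using z(1) s(1,4) by (auto simp: quot_def)
  next
    case (4 z)
    then obtain U S where z: "z = (U, S)" "V \<subseteq> U" "U \<subseteq> X" "S \<in> ?J U" by auto
    have fU: "finite U" using z(3) X(1) finite_subset by blast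
    note s = contractionsD[OF z(4) fU]
    have "S \<in> ?J X" using z(4) by (rule contractions_mono) (use s(1) z(3) in auto)
    moreover have "V \<subseteq> quot V U S" using z(2) s(5) by (auto simp: quot_def)
    moreover have "quot V U S \<subseteq> quot V X S" "pt V S \<in> quot V U S" using z(3) by (auto simp: quot_def)
    ultimately show ?case using z(1) by simp
  next
    case (5 z)
    then obtain S T where z: "z = (S, T)" "S \<in> ?J X" "V \<subseteq> T" "T \<subseteq> quot V X S" "pt V S \<in> T" by auto
    then show ?case using insert_into_lterm_nested[OF X z(2-5)] by simp
  qed
  also have "\<dots> = (\<Sum>U\<in>?I X. \<Sum>S\<in>?J U. ?g U S)"
    using fJ X(1) finite_subset[OF _ X(1)] by (subst sum.Sigma) auto
  also have "\<dots> = (\<Sum>U\<in>?I X. lins X U (rstar f \<nu> U))"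
  proof (rule sum.cong[OF refl])
    fix U assume "U \<in> ?I X"
    then have U: "V \<subseteq> U" "U \<subseteq> X" by auto
    have fU: "finite U" using U(2) X(1) finite_subset by blast
    show "(\<Sum>S\<in>?J U. ?g U S) = lins X U (rstar f \<nu> U)"
      unfolding rstar_def V[symmetric]
    proof (rule additive_on_sum[OF additive_circ_right, symmetric])
      show "a (card (X - U \<union> {0})) \<in> part P (card (X - U \<union> {0})) (3 - 2 * int (card (X - U \<union> {0})))"
        using X(1) by (intro a_part') auto
      show "rterm f \<nu> U S \<in> part P (card U) (deg U + 1)" if "S \<in> ?J U" for S
        using rterm_part[OF f \<nu> _ fU] that U(1) unfolding deg_def by (simp add: V)
    qed (use X(1) fU in auto)
  qed
  finally show ?thesis .
qed

lemma a_nested_fam: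
  assumes X: "finite X" "0 \<notin> X" and S: "V \<subseteq> T" "T \<subseteq> S" "S \<subseteq> X"
  shows "lins X S (lterm f \<nu> S T) =
    circ (X - T \<union> {0}) 0 T (lie_term 0 (X - T \<union> {0}) (S - T \<union> {0})) (fam f \<nu> T)"
proof -
  have fS: "finite S" by (rule finite_subset[OF S(3) X(1)])
  note fin = fS finite_subset[OF S(2) fS]
  have z: "0 \<notin> S" using S X(2) by auto
  let ?A = "X - S \<union> {0}" and ?B = "S - T \<union> {0}"
  have "circ (?A - {0} \<union> ?B) 0 T (circ ?A 0 ?B (a (card ?A)) (a (card ?B))) (fam f \<nu> T) =
    circ ?A 0 (?B - {0} \<union> T) (a (card ?A)) (circ ?B 0 T (a (card ?B)) (fam f \<nu> T))"
  proof (rule circ_nested)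
    show fAB: "finite ?A" "finite ?B" using X(1) fin by simp_all
    show "a (card ?A) \<in> part P (card ?A) (3 - 2 * int (card ?A))" by (rule a_part'[OF fAB(1)]) simp
    show "a (card ?B) \<in> part P (card ?B) (3 - 2 * int (card ?B))" by (rule a_part'[OF fAB(2)]) simp
    show "fam f \<nu> T \<in> part P (card T) (deg T)" by (rule fam_part'[OF fin(2) S(1)])
    show "?B \<inter> (?A - {0}) = {}" "T \<inter> (?A - {0}) = {}" "T \<inter> (?B - {0}) = {}"
      using S(2) by auto
  qed (simp_all add: fin)
  moreover have "?A - {0} \<union> ?B = X - T \<union> {0}" using S(2,3) X(2) by auto
  moreover have "?B - {0} \<union> T = S" using S(2) z by auto
  moreover have "X - T \<union> {0} - ?B \<union> {0} = ?A" using S(2,3) z X(2) by auto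
  ultimately show ?thesis unfolding lterm_eq[OF fin(1) z] lie_term_def by (simp only:)
qed

lemma a_parallel_fam:
  assumes X: "finite X" "0 \<notin> X" and T: "V \<subseteq> T" "T \<subseteq> X" and W: "W \<subseteq> X - T" "W \<noteq> {}"
  shows "circ (X - T \<union> {0}) 0 T (lie_term (Min W) (X - T \<union> {0}) W) (fam f \<nu> T) =
    sgn_pow d (parallel_term X T W)"
proof -
  have fW: "finite W" by (rule finite_subset[OF W(1)]) (use X(1) in simp)
  note fin = fW finite_subset[OF T(2) X(1)]
  have m: "Min W \<in> W" using fin W by simp
  have z: "0 \<notin> W" "0 \<notin> T" "Min W \<noteq> 0" using W T X(2) m by auto
  let ?A = "X - T \<union> {0} - W \<union> {Min W}" and ?Y = "X - W \<union> {Min W}"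
  have "circ (?A - {Min W} \<union> W) 0 T (circ ?A (Min W) W (a (card ?A)) (a (card W))) (fam f \<nu> T) =
    sgn_pow ((3 - 2 * int (card W)) * deg T)
      (circ (?A - {0} \<union> T) (Min W) W (circ ?A 0 T (a (card ?A)) (fam f \<nu> T)) (a (card W)))"
  proof (rule circ_parallel)
    show fA: "finite ?A" using X(1) by simp
    show "a (card ?A) \<in> part P (card ?A) (3 - 2 * int (card ?A))" by (rule a_part'[OF fA]) simp
    show "a (card W) \<in> part P (card W) (3 - 2 * int (card W))" by (rule a_part'[OF fin(1) W(2)])
    show "fam f \<nu> T \<in> part P (card T) (deg T)" by (rule fam_part'[OF fin(2) T(1)])
    show "T \<inter> (?A - {0}) = {}" "W \<inter> T = {}" using W(1) m by auto
    show "W \<inter> (?A - {Min W}) = {}" by auto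
    show "0 \<in> ?A" using z by simp
    show "Min W \<noteq> 0" by (rule z(3))
  qed (simp_all add: fin)
  moreover have "?A - {Min W} \<union> W = X - T \<union> {0}" using W(1) m z by auto
  moreover have "?A - {0} \<union> T = ?Y" using T(2) W(1) m z X(2) by auto
  moreover have "?Y - T \<union> {0} = ?A" using W(1) m z by auto
  moreover have "lterm f \<nu> ?Y T = circ (?Y - T \<union> {0}) 0 T (a (card (?Y - T \<union> {0}))) (fam f \<nu> T)"
    using X z by (intro lterm_eq) auto
  moreover have "sgn_pow ((3 - 2 * int (card W)) * deg T) x = sgn_pow d x" for x :: 'a
    by (simp add: sgn_pow_def deg_def)
  ultimately show ?thesis unfolding parallel_term_def lie_term_def by (simp only:)
qed

text \<open>
  The identity \<open>(\<mu> \<star> \<mu>) \<star> f = \<mu> \<star> (\<mu> \<star> f) + (-1)^|f| R\<close>, with \<open>- \<partial> \<mu>\<close> in place of \<open>\<mu> \<star> \<mu>\<close>. The inner \<open>\<mu>\<close>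
  carries a set \<open>W\<close> of labels of the outer one; \<open>f\<close> is inserted into the inner or into the outer \<open>\<mu>\<close>,
  according to whether \<open>W\<close> contains its place 0.
\<close>
lemma dif_a_fam:
  assumes X: "finite X" "V \<subseteq> X" "0 \<notin> X"
  shows "(\<Sum>T | V \<subseteq> T \<and> T \<subseteq> X. circ (X - T \<union> {0}) 0 T
      (dif P (card (X - T \<union> {0})) (3 - 2 * int (card (X - T \<union> {0}))) (a (card (X - T \<union> {0})))) (fam f \<nu> T)) =
    - (\<Sum>S | V \<subseteq> S \<and> S \<subseteq> X. lins X S (lstar f \<nu> S))
    - sgn_pow d (\<Sum>(T, W)\<in>parallel_pairs X. parallel_term X T W)"
proof -
  let ?I = "\<lambda>Y. {T. V \<subseteq> T \<and> T \<subseteq> Y}"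
  let ?Y = "\<lambda>T. X - T \<union> {0}"
  let ?m = "\<lambda>T W. circ (?Y T) 0 T (lie_term (Min W) (?Y T) W) (fam f \<nu> T)"
  let ?b = "\<lambda>S T. lins X S (lterm f \<nu> S T)"
  have fI: "finite (?I Y)" if "finite Y" for Y
    by (rule finite_subset[of _ "Pow Y"]) (use that in auto)
  have one: "circ (?Y T) 0 T (dif P (card (?Y T)) (3 - 2 * int (card (?Y T))) (a (card (?Y T)))) (fam f \<nu> T) =
     - (\<Sum>S | T \<subseteq> S \<and> S \<subseteq> X. ?b S T) - (\<Sum>W\<in>Pow (X - T) - {{}}. sgn_pow d (parallel_term X T W))"
    if T: "V \<subseteq> T" "T \<subseteq> X" for T
  proof -
    have fT: "finite T" by (rule finite_subset[OF T(2) X(1)])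
    have fY: "finite (?Y T)" "?Y T \<noteq> {}" using X(1) by auto
    have Tz: "T \<inter> (?Y T - {0}) = {}" by auto
    have fW: "finite W" if "W \<subseteq> ?Y T" for W by (rule finite_subset[OF that fY(1)])
    have c: "Min W \<in> W" if "W \<subseteq> ?Y T" "W \<noteq> {}" for W using fW[OF that(1)] that(2) by simp
    have add: "additive_on (part P (card (?Y T)) (4 - 2 * int (card (?Y T)))) (\<lambda>v. circ (?Y T) 0 T v (fam f \<nu> T))"
      by (rule additive_circ_left[OF fY(1) fT _ Tz fam_part'[OF fT T(1)]]) simp
    have mp: "lie_term (Min W) (?Y T) W \<in> part P (card (?Y T)) (4 - 2 * int (card (?Y T)))"
      if "W \<in> Pow (?Y T) - {{}}" for W
    proof -
      have W: "W \<subseteq> ?Y T" "W \<noteq> {}" using that by auto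
      have "finite (?Y T - W \<union> {Min W})" using fY(1) by simp
      note aa = a_part'[OF this] a_part'[OF fW[OF W(1)] W(2)]
      have cc: "card (?Y T - W \<union> {Min W}) + card W = card (?Y T) + 1"
      proof -
        have "card (?Y T - W \<union> {Min W}) = card (?Y T - W) + 1" using fY(1) c[OF W] by simp
        then show ?thesis
          using W(1) fW[OF W(1)] card_mono[OF fY(1) W(1)] by (simp add: card_Diff_subset)
      qed
      have "lie_term (Min W) (?Y T) W \<in> part P (card (?Y T - W \<union> {Min W}) + card W - 1)
          (3 - 2 * int (card (?Y T - W \<union> {Min W})) + (3 - 2 * int (card W)))"
        unfolding lie_term_def by (rule circ_part) (use aa fW[OF W(1)] fY(1) in auto)
      moreover have "3 - 2 * int (card (?Y T - W \<union> {Min W})) + (3 - 2 * int (card W)) = 4 - 2 * int (card (?Y T))"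
        using cc by linarith
      moreover have "card (?Y T - W \<union> {Min W}) + card W - 1 = card (?Y T)" using cc by simp
      ultimately show ?thesis by (simp only:)
    qed
    have mc: "dif P (card (?Y T)) (3 - 2 * int (card (?Y T))) (a (card (?Y T))) =
        - (\<Sum>W\<in>Pow (?Y T) - {{}}. lie_term (Min W) (?Y T) W)"
      by (rule maurer_cartan[OF fY c])
    have "circ (?Y T) 0 T (dif P (card (?Y T)) (3 - 2 * int (card (?Y T))) (a (card (?Y T)))) (fam f \<nu> T) =
      - circ (?Y T) 0 T (\<Sum>W\<in>Pow (?Y T) - {{}}. lie_term (Min W) (?Y T) W) (fam f \<nu> T)"
      unfolding mc by (rule additive_on_minus[OF add subgroup_sum[OF subgroup_part mp]])
    also have "circ (?Y T) 0 T (\<Sum>W\<in>Pow (?Y T) - {{}}. lie_term (Min W) (?Y T) W) (fam f \<nu> T) =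
      (\<Sum>W\<in>Pow (?Y T) - {{}}. ?m T W)"
      by (rule additive_on_sum[OF add mp])
    \<comment> \<open>\<open>f\<close> is inserted into the inner \<open>\<mu>\<close> if \<open>0 \<in> W\<close>, and into the outer one otherwise\<close>
    also have "Pow (?Y T) - {{}} = {W. W \<subseteq> ?Y T \<and> 0 \<in> W} \<union> (Pow (X - T) - {{}})"
      using X(3) by auto
    also have "(\<Sum>W\<in>{W. W \<subseteq> ?Y T \<and> 0 \<in> W} \<union> (Pow (X - T) - {{}}). ?m T W) =
      (\<Sum>W | W \<subseteq> ?Y T \<and> 0 \<in> W. ?m T W) + (\<Sum>W\<in>Pow (X - T) - {{}}. ?m T W)"
    proof (rule sum.union_disjoint)
      show "finite {W. W \<subseteq> ?Y T \<and> 0 \<in> W}"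
        by (rule finite_subset[of _ "Pow (?Y T)"]) (use fY(1) in auto)
    qed (use X in auto)
    also have "(\<Sum>W | W \<subseteq> ?Y T \<and> 0 \<in> W. ?m T W) = (\<Sum>S | T \<subseteq> S \<and> S \<subseteq> X. ?b S T)"
    proof (rule sum.reindex_bij_witness[where i = "\<lambda>S. S - T \<union> {0}" and j = "\<lambda>W. T \<union> (W - {0})"])
      fix W assume W: "W \<in> {W. W \<subseteq> ?Y T \<and> 0 \<in> W}"
      show 1: "T \<union> (W - {0}) - T \<union> {0} = W" using W X(3) by auto
      show "T \<union> (W - {0}) \<in> {S. T \<subseteq> S \<and> S \<subseteq> X}" using W T(2) by auto
      have "Min W = 0" using W fW[of W] by (intro Min_eqI) auto
      then show "?b (T \<union> (W - {0})) T = ?m T W"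
        using a_nested_fam[OF X(1,3) T(1), of "T \<union> (W - {0})"] W T(2) unfolding 1 by auto
    next
      fix S assume S: "S \<in> {S. T \<subseteq> S \<and> S \<subseteq> X}"
      then show "T \<union> (S - T \<union> {0} - {0}) = S" using X(3) by auto
      show "S - T \<union> {0} \<in> {W. W \<subseteq> ?Y T \<and> 0 \<in> W}" using S by auto
    qed
    also have "(\<Sum>W\<in>Pow (X - T) - {{}}. ?m T W) = (\<Sum>W\<in>Pow (X - T) - {{}}. sgn_pow d (parallel_term X T W))"
      by (rule sum.cong[OF refl]) (use a_parallel_fam[OF X(1,3) T] in auto)
    finally show ?thesis by simp
  qed
  have "(\<Sum>T\<in>?I X. circ (?Y T) 0 T
      (dif P (card (?Y T)) (3 - 2 * int (card (?Y T))) (a (card (?Y T)))) (fam f \<nu> T)) =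
    (\<Sum>T\<in>?I X. - (\<Sum>S | T \<subseteq> S \<and> S \<subseteq> X. ?b S T) - (\<Sum>W\<in>Pow (X - T) - {{}}. sgn_pow d (parallel_term X T W)))"
    by (rule sum.cong[OF refl]) (use one in auto)
  also have "\<dots> = - (\<Sum>T\<in>?I X. \<Sum>S | T \<subseteq> S \<and> S \<subseteq> X. ?b S T)
      - (\<Sum>T\<in>?I X. \<Sum>W\<in>Pow (X - T) - {{}}. sgn_pow d (parallel_term X T W))"
    by (simp add: sum_subtractf sum_negf)
  also have "(\<Sum>T\<in>?I X. \<Sum>W\<in>Pow (X - T) - {{}}. sgn_pow d (parallel_term X T W)) =
      sgn_pow d (\<Sum>(T, W)\<in>parallel_pairs X. parallel_term X T W)"
  proof -
    have "(\<Sum>T\<in>?I X. \<Sum>W\<in>Pow (X - T) - {{}}. sgn_pow d (parallel_term X T W)) =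
      (\<Sum>(T, W)\<in>Sigma (?I X) (\<lambda>T. Pow (X - T) - {{}}). sgn_pow d (parallel_term X T W))"
      using fI[OF X(1)] X(1) by (subst sum.Sigma) auto
    also have "Sigma (?I X) (\<lambda>T. Pow (X - T) - {{}}) = parallel_pairs X"
      by (auto simp: parallel_pairs_def)
    finally show ?thesis by (simp add: sgn_pow_sum case_prod_unfold)
  qed
  also have "(\<Sum>T\<in>?I X. \<Sum>S | T \<subseteq> S \<and> S \<subseteq> X. ?b S T) = (\<Sum>S\<in>?I X. \<Sum>T\<in>?I S. ?b S T)"
  proof -
    have fS: "finite S" if "S \<in> ?I X" for S
      by (rule finite_subset[OF _ X(1)]) (use that in auto)
    have fU: "finite {S. T \<subseteq> S \<and> S \<subseteq> X}" for T
      by (rule finite_subset[of _ "Pow X"]) (use X(1) in auto)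
    have "(\<Sum>T\<in>?I X. \<Sum>S | T \<subseteq> S \<and> S \<subseteq> X. ?b S T) =
        (\<Sum>(T, S)\<in>Sigma (?I X) (\<lambda>T. {S. T \<subseteq> S \<and> S \<subseteq> X}). ?b S T)"
      using fI[OF X(1)] fU by (subst sum.Sigma) auto
    also have "\<dots> = (\<Sum>(S, T)\<in>Sigma (?I X) ?I. ?b S T)"
      by (rule sum.reindex_bij_witness[where i = "\<lambda>(S, T). (T, S)" and j = "\<lambda>(T, S). (S, T)"]) auto
    also have "\<dots> = (\<Sum>S\<in>?I X. \<Sum>T\<in>?I S. ?b S T)"
      using fI[OF X(1)] fI fS by (subst sum.Sigma) auto
    finally show ?thesis .
  qed
  also have "\<dots> = (\<Sum>S\<in>?I X. lins X S (lstar f \<nu> S))"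
  proof (rule sum.cong[OF refl])
    fix S assume "S \<in> ?I X"
    then have S: "V \<subseteq> S" "S \<subseteq> X" by auto
    have fS: "finite S" by (rule finite_subset[OF S(2) X(1)])
    have z: "0 \<notin> S" using S X(3) by auto
    show "(\<Sum>T\<in>?I S. ?b S T) = lins X S (lstar f \<nu> S)"
      unfolding lstar_def V[symmetric]
    proof (rule additive_on_sum[OF additive_circ_right, symmetric])
      show "a (card (X - S \<union> {0})) \<in> part P (card (X - S \<union> {0})) (3 - 2 * int (card (X - S \<union> {0})))"
        using X(1) by (intro a_part') auto
      show "lterm f \<nu> S T \<in> part P (card S) (deg S + 1)" if "T \<in> ?I S" for T
        using lterm_part[OF f \<nu> _ fS z] that unfolding deg_def by (simp add: V)
    qed (use X(1) fS in auto)
  qed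
  finally show ?thesis .
qed

lemma dif_rstar:
  assumes X: "finite X" "V \<subseteq> X"
  shows "dif P (card X) (deg X + 1) (rstar f \<nu> X) =
    (\<Sum>S\<in>contractions V X. rins X S (dif P (card (quot V X S)) (deg (quot V X S)) (fam f \<nu> (quot V X S))))
    + sgn_pow d (\<Sum>S\<in>contractions V X. circ (quot V X S) (pt V S) S (fam f \<nu> (quot V X S))
        (dif P (card S) (3 - 2 * int (card S)) (a (card S))))"
proof -
  have "dif P (card X) (deg X + 1) (rstar f \<nu> X) =
     (\<Sum>S\<in>contractions V X. dif P (card X) (deg X + 1) (rterm f \<nu> X S))"
    unfolding rstar_def V[symmetric]
    by (rule additive_on_sum[OF additive_dif])
      (use rterm_part[OF f \<nu> _ X(1)] X(2) in \<open>simp add: deg_def, simp add: V\<close>)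
  also have "\<dots> = (\<Sum>S\<in>contractions V X. rins X S (dif P (card (quot V X S)) (deg (quot V X S)) (fam f \<nu> (quot V X S)))
     + sgn_pow d (circ (quot V X S) (pt V S) S (fam f \<nu> (quot V X S))
        (dif P (card S) (3 - 2 * int (card S)) (a (card S)))))"
  proof (rule sum.cong[OF refl])
    fix S assume S: "S \<in> contractions V X"
    note s = contractionsD[OF S X(1)] and q = quot_props[OF X S]
    note e = deg_quot[OF X S]
    show "dif P (card X) (deg X + 1) (rterm f \<nu> X S) = rins X S (dif P (card (quot V X S)) (deg (quot V X S)) (fam f \<nu> (quot V X S)))
     + sgn_pow d (circ (quot V X S) (pt V S) S (fam f \<nu> (quot V X S))
        (dif P (card S) (3 - 2 * int (card S)) (a (card S))))"
      using dif_circ[OF q(1) s(2) q(5,4) fam_part'[OF q(1,2)] a_part'[OF s(2,3)]]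
      unfolding rterm_eq q(6) sgn_deg e .
  qed
  finally show ?thesis by (simp add: sum.distrib sgn_pow_sum)
qed

lemma deg_split:
  assumes X: "finite X" "0 \<notin> X" and S: "V \<subseteq> S" "S \<subseteq> X"
  shows "deg X + 1 = 3 - 2 * int (card (X - S \<union> {0})) + deg S"
  using split_card(2,3)[OF X S] by (simp add: deg_def)

lemma dif_lstar:
  assumes X: "finite X" "V \<subseteq> X" "0 \<notin> X"
  shows "dif P (card X) (deg X + 1) (lstar f \<nu> X) =
    (\<Sum>T | V \<subseteq> T \<and> T \<subseteq> X. circ (X - T \<union> {0}) 0 T
      (dif P (card (X - T \<union> {0})) (3 - 2 * int (card (X - T \<union> {0}))) (a (card (X - T \<union> {0})))) (fam f \<nu> T))
    - (\<Sum>T | V \<subseteq> T \<and> T \<subseteq> X. lins X T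
        (dif P (card T) (deg T) (fam f \<nu> T)))"
proof -
  have "dif P (card X) (deg X + 1) (lstar f \<nu> X) =
     (\<Sum>T | V \<subseteq> T \<and> T \<subseteq> X. dif P (card X) (deg X + 1) (lterm f \<nu> X T))"
    unfolding lstar_def V[symmetric]
    by (rule additive_on_sum[OF additive_dif])
      (use lterm_part[OF f \<nu> _ X(1,3)] in \<open>simp add: deg_def, simp add: V\<close>)
  also have "\<dots> = (\<Sum>T | V \<subseteq> T \<and> T \<subseteq> X. circ (X - T \<union> {0}) 0 T
      (dif P (card (X - T \<union> {0})) (3 - 2 * int (card (X - T \<union> {0}))) (a (card (X - T \<union> {0})))) (fam f \<nu> T)
    - lins X T (dif P (card T) (deg T) (fam f \<nu> T)))"
  proof (rule sum.cong[OF refl])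
    fix T assume "T \<in> {T. V \<subseteq> T \<and> T \<subseteq> X}"
    then have T: "V \<subseteq> T" "T \<subseteq> X" by auto
    have fT: "finite T" by (rule finite_subset[OF T(2) X(1)])
    let ?B = "X - T \<union> {0}"
    have B: "finite ?B" "?B \<noteq> {}" "0 \<in> ?B" "T \<inter> (?B - {0}) = {}" using X(1) by auto
    have s: "sgn_pow (3 - 2 * int (card ?B)) x = - x" for x :: 'a by (simp add: sgn_pow_def)
    show "dif P (card X) (deg X + 1) (lterm f \<nu> X T) = circ ?B 0 T
      (dif P (card ?B) (3 - 2 * int (card ?B)) (a (card ?B))) (fam f \<nu> T)
      - circ ?B 0 T (a (card ?B)) (dif P (card T) (deg T) (fam f \<nu> T))"
      using dif_circ[OF B(1) fT B(3,4) a_part'[OF B(1,2)] fam_part'[OF fT T(1)]]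
      unfolding lterm_eq[OF X(1,3)] split_card(1)[OF X(1,3) T] deg_split[OF X(1,3) T] s by simp
  qed
  finally show ?thesis by (simp add: sum_subtractf)
qed

lemma fam_tw_dif':
  assumes X: "finite X" "V \<subseteq> X" "0 \<notin> X"
  shows "fam (tw_dif P a n d f) \<nu> X =
    dif P (card X) (deg X) (fam f \<nu> X) - sgn_pow d (rstar f \<nu> X) + lstar f \<nu> X"
  using fam_tw_dif[OF f \<nu> _ X(1,3)] X(2) unfolding tw_dif_on_def deg_def by (simp add: V)

lemma rstar_tw_dif:
  assumes X: "finite X" "V \<subseteq> X" "0 \<notin> X"
  shows "rstar (tw_dif P a n d f) \<nu> X =
    (\<Sum>S\<in>contractions V X. rins X S (dif P (card (quot V X S)) (deg (quot V X S)) (fam f \<nu> (quot V X S))))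
    - sgn_pow d (\<Sum>S\<in>contractions V X. rins X S (rstar f \<nu> (quot V X S)))
    + (\<Sum>S\<in>contractions V X. rins X S (lstar f \<nu> (quot V X S)))"
proof -
  have "rterm (tw_dif P a n d f) \<nu> X S = rins X S (dif P (card (quot V X S)) (deg (quot V X S)) (fam f \<nu> (quot V X S)))
    - sgn_pow d (rins X S (rstar f \<nu> (quot V X S)))
    + rins X S (lstar f \<nu> (quot V X S))"
    if S: "S \<in> contractions V X" for S
  proof -
    note s = contractionsD[OF S X(1)] and q = quot_props[OF X(1,2) S]
    let ?Q = "quot V X S"
    have z: "0 \<notin> ?Q" using q(3) X(3) by auto
    have VQ: "set \<nu> \<subseteq> ?Q" using q(2) V by simp
    note add = additive_circ_left[OF q(1) s(2) q(5,4) a_part'[OF s(2,3)], of "deg ?Q + 1"]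
    have p: "dif P (card ?Q) (deg ?Q) (fam f \<nu> ?Q) \<in> part P (card ?Q) (deg ?Q + 1)"
      by (rule dif_part[OF fam_part'[OF q(1,2)]])
    have p2: "rstar f \<nu> ?Q \<in> part P (card ?Q) (deg ?Q + 1)"
      using rstar_part[OF f \<nu> VQ q(1)] unfolding deg_def by (simp add: V)
    have p3: "lstar f \<nu> ?Q \<in> part P (card ?Q) (deg ?Q + 1)"
      using lstar_part[OF f \<nu> VQ q(1) z] unfolding deg_def by (simp add: V)
    have p4: "sgn_pow d (rstar f \<nu> ?Q) \<in> part P (card ?Q) (deg ?Q + 1)"
      by (rule subgroup_sgn_pow[OF subgroup_part p2])
    note fam_tw_dif'[OF q(1,2) z]
    then show ?thesis
      using additive_on_add[OF add subgroup_diff[OF subgroup_part p p4] p3]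
        additive_on_diff[OF add p p4] additive_on_sgn_pow[OF add p2, of d]
      by (simp add: rterm_def V)
  qed
  then show ?thesis
    unfolding rstar_def[of "tw_dif P a n d f"] V[symmetric]
    by (simp add: sum.distrib sum_subtractf sgn_pow_sum)
qed

lemma lstar_tw_dif:
  assumes X: "finite X" "V \<subseteq> X" "0 \<notin> X"
  shows "lstar (tw_dif P a n d f) \<nu> X =
    (\<Sum>T | V \<subseteq> T \<and> T \<subseteq> X. lins X T
        (dif P (card T) (deg T) (fam f \<nu> T)))
    - sgn_pow d (\<Sum>T | V \<subseteq> T \<and> T \<subseteq> X. lins X T (rstar f \<nu> T))
    + (\<Sum>T | V \<subseteq> T \<and> T \<subseteq> X. lins X T (lstar f \<nu> T))"
proof -
  have "lterm (tw_dif P a n d f) \<nu> X T = lins X T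
        (dif P (card T) (deg T) (fam f \<nu> T))
    - sgn_pow d (lins X T (rstar f \<nu> T))
    + lins X T (lstar f \<nu> T)"
    if T: "V \<subseteq> T" "T \<subseteq> X" for T
  proof -
    have fT: "finite T" by (rule finite_subset[OF T(2) X(1)])
    let ?B = "X - T \<union> {0}"
    have B: "finite ?B" "?B \<noteq> {}" "0 \<in> ?B" "T \<inter> (?B - {0}) = {}" using X(1) by auto
    have z: "0 \<notin> T" using T(2) X(3) by auto
    have VT: "set \<nu> \<subseteq> T" using T(1) V by simp
    note add = additive_circ_right[OF B(1) fT B(3,4) a_part'[OF B(1,2)], of "deg T + 1"]
    have p: "dif P (card T) (deg T) (fam f \<nu> T) \<in> part P (card T) (deg T + 1)"
      by (rule dif_part[OF fam_part'[OF fT T(1)]])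
    have p2: "rstar f \<nu> T \<in> part P (card T) (deg T + 1)"
      using rstar_part[OF f \<nu> VT fT] unfolding deg_def by (simp add: V)
    have p3: "lstar f \<nu> T \<in> part P (card T) (deg T + 1)"
      using lstar_part[OF f \<nu> VT fT z] unfolding deg_def by (simp add: V)
    have p4: "sgn_pow d (rstar f \<nu> T) \<in> part P (card T) (deg T + 1)"
      by (rule subgroup_sgn_pow[OF subgroup_part p2])
    note fm = fam_tw_dif'[OF fT T(1) z]
    have "lterm (tw_dif P a n d f) \<nu> X T = circ ?B 0 T (a (card ?B)) (fam (tw_dif P a n d f) \<nu> T)"
      using X(1,3) by (simp add: lterm_def)
    then show ?thesis
      using additive_on_add[OF add subgroup_diff[OF subgroup_part p p4] p3]
        additive_on_diff[OF add p p4] additive_on_sgn_pow[OF add p2, of d] unfolding fm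
      by simp
  qed
  then show ?thesis
    unfolding lstar_def[of "tw_dif P a n d f"] V[symmetric]
    by (simp add: sum.distrib sum_subtractf sgn_pow_sum)
qed

text \<open>
  After expansion, the terms with \<open>\<partial> f\<close> cancel by the Leibniz rule, and the others by the three identities.
\<close>
lemma tw_dif_on_tw_dif:
  assumes X: "finite X" "V \<subseteq> X" "0 \<notin> X"
  shows "tw_dif_on (d + 1) (tw_dif P a n d f) \<nu> X = 0"
proof -
  have VX: "set \<nu> \<subseteq> X" using X(2) V by simp
  let ?D = "dif P (card X) (deg X + 1)"
  have p1: "fam f \<nu> X \<in> part P (card X) (deg X)" by (rule fam_part'[OF X(1,2)])
  note p = dif_part[OF p1]
  have p2: "rstar f \<nu> X \<in> part P (card X) (deg X + 1)"
    using rstar_part[OF f \<nu> VX X(1)] unfolding deg_def by (simp add: V)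
  have p3: "lstar f \<nu> X \<in> part P (card X) (deg X + 1)"
    using lstar_part[OF f \<nu> VX X(1,3)] unfolding deg_def by (simp add: V)
  have p4: "sgn_pow d (rstar f \<nu> X) \<in> part P (card X) (deg X + 1)"
    by (rule subgroup_sgn_pow[OF subgroup_part p2])
  note fm = fam_tw_dif'[OF X]
  have D: "?D (fam (tw_dif P a n d f) \<nu> X) = - sgn_pow d (?D (rstar f \<nu> X)) + ?D (lstar f \<nu> X)"
    using additive_on_add[OF additive_dif subgroup_diff[OF subgroup_part p p4] p3]
      additive_on_diff[OF additive_dif p p4] additive_on_sgn_pow[OF additive_dif p2, of d] dif_dif[OF p1]
    unfolding fm by simp
  have dg: "d + 1 - 2 * int (card (X - set \<nu>)) = deg X + 1" unfolding deg_def by (simp add: V)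
  show ?thesis
    unfolding tw_dif_on_def dg D rstar_tw_dif[OF X] lstar_tw_dif[OF X] dif_rstar[OF X(1,2)] dif_lstar[OF X]
      insert_twice[OF X] insert_into_lstar[OF X] dif_a_fam[OF X]
    by (simp add: sgn_pow_simps)
qed

end

theorem tw_dif_square:
  assumes f: "f \<in> tw_part P n d"
  shows "tw_dif P a n (d + 1) (tw_dif P a n d f) r = 0"
  unfolding tw_dif_eq_tw_dif_on[OF tw_dif_part[OF f]]
  by (rule tw_dif_on_tw_dif[OF f]) auto

end

section \<open>Quasi-isomorphisms and acyclic cones\<close>

definition cohomologous_in :: "(int \<Rightarrow> 'a set) \<Rightarrow> (int \<Rightarrow> 'a \<Rightarrow> 'a :: ab_group_add) \<Rightarrow> int \<Rightarrow> ('a \<times> 'a) set" where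
  "cohomologous_in C \<delta> d = {(x, y). x \<in> {x \<in> C d. \<delta> d x = 0} \<and> y \<in> {x \<in> C d. \<delta> d x = 0} \<and>
     x - y \<in> \<delta> (d - 1) ` C (d - 1)}"

text \<open>
  Exactness of the mapping cone of \<open>F\<close>, whose differential sends \<open>(v, w)\<close> to \<open>(\<delta> v, F v - \<epsilon> w)\<close>.
\<close>
definition cone_acyclic ::
  "(int \<Rightarrow> 'a set) \<Rightarrow> (int \<Rightarrow> 'a \<Rightarrow> 'a :: ab_group_add) \<Rightarrow>
   (int \<Rightarrow> 'b set) \<Rightarrow> (int \<Rightarrow> 'b \<Rightarrow> 'b :: ab_group_add) \<Rightarrow> ('a \<Rightarrow> 'b) \<Rightarrow> bool" where
  "cone_acyclic C \<delta> D \<epsilon> F \<longleftrightarrow> (\<forall>d. \<forall>v\<in>C (d + 1). \<forall>w\<in>D d. \<delta> (d + 1) v = 0 \<longrightarrow> F v = \<epsilon> d w \<longrightarrow>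
     (\<exists>v'\<in>C d. \<exists>w'\<in>D (d - 1). v = \<delta> d v' \<and> w = F v' - \<epsilon> (d - 1) w'))"

text \<open>
  A map of cochain complexes, with the homogeneous parts as subgroups of ambient groups.
\<close>
locale cochain_map =
  fixes C :: "int \<Rightarrow> 'a :: ab_group_add set" and \<delta> :: "int \<Rightarrow> 'a \<Rightarrow> 'a"
    and D :: "int \<Rightarrow> 'b :: ab_group_add set" and \<epsilon> :: "int \<Rightarrow> 'b \<Rightarrow> 'b"
    and F :: "'a \<Rightarrow> 'b"
  assumes additive_d: "additive_on (C d) (\<delta> d)" and additive_d': "additive_on (D d) (\<epsilon> d)"
    and additive_F: "additive_on (C d) F"
    and d_closed: "x \<in> C d \<Longrightarrow> \<delta> d x \<in> C (d + 1)" and d'_closed: "y \<in> D d \<Longrightarrow> \<epsilon> d y \<in> D (d + 1)"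
    and F_closed: "x \<in> C d \<Longrightarrow> F x \<in> D d"
    and d_d: "x \<in> C d \<Longrightarrow> \<delta> (d + 1) (\<delta> d x) = 0" and d'_d': "y \<in> D d \<Longrightarrow> \<epsilon> (d + 1) (\<epsilon> d y) = 0"
    and F_d: "x \<in> C d \<Longrightarrow> F (\<delta> d x) = \<epsilon> d (F x)"
begin

lemma subgroups: "subgroup_of (C d)" "subgroup_of (D d)"
  using additive_d[of d] additive_d'[of d] by (simp_all add: additive_on_def)

definition injective_in where
  "injective_in d \<longleftrightarrow> (\<forall>x\<in>C d. \<delta> d x = 0 \<longrightarrow> F x \<in> \<epsilon> (d - 1) ` D (d - 1) \<longrightarrow> x \<in> \<delta> (d - 1) ` C (d - 1))"

definition surjective_in where
  "surjective_in d \<longleftrightarrow> (\<forall>y\<in>D d. \<epsilon> d y = 0 \<longrightarrow>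
     (\<exists>x\<in>C d. \<delta> d x = 0 \<and> F x - y \<in> \<epsilon> (d - 1) ` D (d - 1)))"

lemma boundaries_subgroup:
  "subgroup_of (\<delta> d ` C d)" "subgroup_of (\<epsilon> d ` D d)"
proof -
  have "h 0 = 0 \<Longrightarrow> subgroup_of (h ` A)" if "additive_on A h" for A and h :: "'c :: ab_group_add \<Rightarrow> 'd :: ab_group_add"
    unfolding subgroup_of_def
  proof (intro conjI ballI)
    have A: "subgroup_of A" using that by (simp add: additive_on_def)
    show "0 \<in> h ` A" using additive_on_zero[OF that] subgroup_zero[OF A] by (metis imageI)
    fix x y assume "x \<in> h ` A" "y \<in> h ` A"
    then obtain u v where "u \<in> A" "v \<in> A" "x = h u" "y = h v" by auto
    then show "x - y \<in> h ` A"
      using additive_on_diff[OF that, of u v] subgroup_diff[OF A, of u v] by (metis imageI)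
  qed
  note * = this
  show "subgroup_of (\<delta> d ` C d)" by (rule *[OF additive_d additive_on_zero[OF additive_d]])
  show "subgroup_of (\<epsilon> d ` D d)" by (rule *[OF additive_d' additive_on_zero[OF additive_d']])
qed

lemma cocycles_subgroup: "subgroup_of {x \<in> C d. \<delta> d x = 0}"
  unfolding subgroup_of_def
  using subgroups(1)[of d] additive_on_zero[OF additive_d[of d]] additive_on_diff[OF additive_d[of d]]
  by (auto intro: subgroup_zero subgroup_diff)

lemma equiv_classes:
  "equiv {x \<in> C d. \<delta> d x = 0} (cohomologous_in C \<delta> d)" "equiv {y \<in> D d. \<epsilon> d y = 0} (cohomologous_in D \<epsilon> d)"
proof -
  have *: "equiv Z {(x, y). x \<in> Z \<and> y \<in> Z \<and> x - y \<in> B}" if B: "subgroup_of B" for Z B :: "'c :: ab_group_add set"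
  proof (rule equivI)
    show "{(x, y). x \<in> Z \<and> y \<in> Z \<and> x - y \<in> B} \<subseteq> Z \<times> Z" by auto
    show "refl_on Z {(x, y). x \<in> Z \<and> y \<in> Z \<and> x - y \<in> B}"
      using subgroup_zero[OF B] by (auto simp: refl_on_def)
    show "sym {(x, y). x \<in> Z \<and> y \<in> Z \<and> x - y \<in> B}"
    proof (rule symI)
      fix x y assume xy: "(x, y) \<in> {(x, y). x \<in> Z \<and> y \<in> Z \<and> x - y \<in> B}"
      then have "y - x \<in> B" using subgroup_minus[OF B, of "x - y"] by simp
      then show "(y, x) \<in> {(x, y). x \<in> Z \<and> y \<in> Z \<and> x - y \<in> B}" using xy by simp
    qed
    show "trans {(x, y). x \<in> Z \<and> y \<in> Z \<and> x - y \<in> B}"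
    proof (rule transI)
      fix x y z assume xyz: "(x, y) \<in> {(x, y). x \<in> Z \<and> y \<in> Z \<and> x - y \<in> B}"
        "(y, z) \<in> {(x, y). x \<in> Z \<and> y \<in> Z \<and> x - y \<in> B}"
      then have "x - z \<in> B" using subgroup_add[OF B, of "x - y" "y - z"] by simp
      then show "(x, z) \<in> {(x, y). x \<in> Z \<and> y \<in> Z \<and> x - y \<in> B}" using xyz by simp
    qed
  qed
  show "equiv {x \<in> C d. \<delta> d x = 0} (cohomologous_in C \<delta> d)" "equiv {y \<in> D d. \<epsilon> d y = 0} (cohomologous_in D \<epsilon> d)"
    unfolding cohomologous_in_def by (rule *[OF boundaries_subgroup(1)], rule *[OF boundaries_subgroup(2)])
qed

lemma F_cocycle: "x \<in> {x \<in> C d. \<delta> d x = 0} \<Longrightarrow> F x \<in> {y \<in> D d. \<epsilon> d y = 0}"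
  using F_closed[of x d] F_d[of x d] additive_on_zero[OF additive_F[of "d + 1"]] by simp

lemma F_boundary: "x \<in> \<delta> (d - 1) ` C (d - 1) \<Longrightarrow> F x \<in> \<epsilon> (d - 1) ` D (d - 1)"
  using F_d F_closed by auto

lemma induced_class:
  assumes x: "x \<in> {x \<in> C d. \<delta> d x = 0}"
  shows "cohomologous_in D \<epsilon> d `` (F ` (cohomologous_in C \<delta> d `` {x})) = cohomologous_in D \<epsilon> d `` {F x}"
proof -
  have "(F x, F y) \<in> cohomologous_in D \<epsilon> d" if "(x, y) \<in> cohomologous_in C \<delta> d" for y
  proof -
    have y: "y \<in> {x \<in> C d. \<delta> d x = 0}" "x - y \<in> \<delta> (d - 1) ` C (d - 1)"
      using that by (auto simp: cohomologous_in_def)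
    have "F x - F y = F (x - y)" using x y additive_on_diff[OF additive_F[of d]] by auto
    then show ?thesis
      using F_cocycle[OF x] F_cocycle[OF y(1)] F_boundary[OF y(2)] by (simp add: cohomologous_in_def)
  qed
  then have "cohomologous_in D \<epsilon> d `` {F y} = cohomologous_in D \<epsilon> d `` {F x}" if "y \<in> cohomologous_in C \<delta> d `` {x}" for y
    using that equiv_class_eq[OF equiv_classes(2), of "F x" "F y" d] by auto
  moreover have "x \<in> cohomologous_in C \<delta> d `` {x}" by (rule equiv_class_self[OF equiv_classes(1) x])
  ultimately show ?thesis by blast
qed

text \<open>
  Injectivity and surjectivity in cohomology, unwound to statements about cocycles.
\<close>
lemma bij_betw_cohomology_iff:
  "bij_betw (\<lambda>X. cohomologous_in D \<epsilon> d `` (F ` X))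
     ({x \<in> C d. \<delta> d x = 0} // cohomologous_in C \<delta> d) ({y \<in> D d. \<epsilon> d y = 0} // cohomologous_in D \<epsilon> d) \<longleftrightarrow>
   injective_in d \<and> surjective_in d" (is "bij_betw ?h (?Z // _) (?Z' // _) \<longleftrightarrow> _")
proof (intro iffI conjI)
  have Z0: "0 \<in> ?Z" using subgroup_zero[OF cocycles_subgroup] .
  have F0: "F 0 = 0" by (rule additive_on_zero[OF additive_F])
  {
    assume b: "bij_betw ?h (?Z // cohomologous_in C \<delta> d) (?Z' // cohomologous_in D \<epsilon> d)"
    show "injective_in d"
      unfolding injective_in_def
    proof (intro ballI impI)
      fix x assume x: "x \<in> C d" "\<delta> d x = 0" "F x \<in> \<epsilon> (d - 1) ` D (d - 1)"
      then have xZ: "x \<in> ?Z" by simp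
      have "(F x, F 0) \<in> cohomologous_in D \<epsilon> d"
        using F_cocycle[OF xZ] F_cocycle[OF Z0] x(3) by (simp add: cohomologous_in_def F0)
      then have "?h (cohomologous_in C \<delta> d `` {x}) = ?h (cohomologous_in C \<delta> d `` {0})"
        unfolding induced_class[OF xZ] induced_class[OF Z0] by (rule equiv_class_eq[OF equiv_classes(2)])
      then have "cohomologous_in C \<delta> d `` {x} = cohomologous_in C \<delta> d `` {0}"
        using quotientI[OF xZ] quotientI[OF Z0] by (rule inj_onD[OF bij_betw_imp_inj_on[OF b]])
      then have "(x, 0) \<in> cohomologous_in C \<delta> d"
        using eq_equiv_class_iff[OF equiv_classes(1) xZ Z0] by blast
      then show "x \<in> \<delta> (d - 1) ` C (d - 1)" by (simp add: cohomologous_in_def)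
    qed
    show "surjective_in d"
      unfolding surjective_in_def
    proof (intro ballI impI)
      fix y assume y: "y \<in> D d" "\<epsilon> d y = 0"
      then have yZ: "y \<in> ?Z'" by simp
      then have "cohomologous_in D \<epsilon> d `` {y} \<in> ?Z' // cohomologous_in D \<epsilon> d" by (rule quotientI)
      then obtain X where X: "X \<in> ?Z // cohomologous_in C \<delta> d" "?h X = cohomologous_in D \<epsilon> d `` {y}"
        using b by (metis (no_types, lifting) bij_betw_imp_surj_on imageE)
      then obtain x where x: "x \<in> ?Z" "X = cohomologous_in C \<delta> d `` {x}" by (auto elim: quotientE)
      then have "cohomologous_in D \<epsilon> d `` {F x} = cohomologous_in D \<epsilon> d `` {y}" using X induced_class[OF x(1)] by simp
      then have "(F x, y) \<in> cohomologous_in D \<epsilon> d"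
        using eq_equiv_class_iff[OF equiv_classes(2) F_cocycle[OF x(1)] yZ] by blast
      then show "\<exists>x\<in>C d. \<delta> d x = 0 \<and> F x - y \<in> \<epsilon> (d - 1) ` D (d - 1)"
        using x by (auto simp: cohomologous_in_def)
    qed
  }
  assume inj_surj: "injective_in d \<and> surjective_in d"
  show "bij_betw ?h (?Z // cohomologous_in C \<delta> d) (?Z' // cohomologous_in D \<epsilon> d)"
    unfolding bij_betw_def
  proof
    show "inj_on ?h (?Z // cohomologous_in C \<delta> d)"
    proof (rule inj_onI)
      fix X Y assume XY: "X \<in> ?Z // cohomologous_in C \<delta> d" "Y \<in> ?Z // cohomologous_in C \<delta> d" "?h X = ?h Y"
      then obtain x y where x: "x \<in> ?Z" "X = cohomologous_in C \<delta> d `` {x}" and y: "y \<in> ?Z" "Y = cohomologous_in C \<delta> d `` {y}"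
        by (auto elim!: quotientE)
      have "cohomologous_in D \<epsilon> d `` {F x} = cohomologous_in D \<epsilon> d `` {F y}"
        using XY(3) induced_class[OF x(1)] induced_class[OF y(1)] x y by simp
      then have "(F x, F y) \<in> cohomologous_in D \<epsilon> d"
        using eq_equiv_class_iff[OF equiv_classes(2) F_cocycle[OF x(1)] F_cocycle[OF y(1)]] by blast
      then have "F (x - y) \<in> \<epsilon> (d - 1) ` D (d - 1)"
        using x y additive_on_diff[OF additive_F[of d]] by (simp add: cohomologous_in_def)
      moreover have xy: "x - y \<in> ?Z" by (rule subgroup_diff[OF cocycles_subgroup x(1) y(1)])
      ultimately have "x - y \<in> \<delta> (d - 1) ` C (d - 1)" using inj_surj by (auto simp: injective_in_def)
      then have "(x, y) \<in> cohomologous_in C \<delta> d" using x y by (simp add: cohomologous_in_def)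
      then show "X = Y" unfolding x y by (rule equiv_class_eq[OF equiv_classes(1)])
    qed
    show "?h ` (?Z // cohomologous_in C \<delta> d) = ?Z' // cohomologous_in D \<epsilon> d"
    proof (intro equalityI subsetI)
      fix Y assume "Y \<in> ?h ` (?Z // cohomologous_in C \<delta> d)"
      then obtain x where x: "x \<in> ?Z" "Y = ?h (cohomologous_in C \<delta> d `` {x})" by (auto elim!: quotientE)
      then show "Y \<in> ?Z' // cohomologous_in D \<epsilon> d"
        unfolding x(2) induced_class[OF x(1)] by (intro quotientI F_cocycle)
    next
      fix Y assume "Y \<in> ?Z' // cohomologous_in D \<epsilon> d"
      then obtain y where y: "y \<in> ?Z'" "Y = cohomologous_in D \<epsilon> d `` {y}" by (auto elim!: quotientE)
      then obtain x where x: "x \<in> ?Z" "F x - y \<in> \<epsilon> (d - 1) ` D (d - 1)"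
        using inj_surj by (auto simp: surjective_in_def)
      have "(F x, y) \<in> cohomologous_in D \<epsilon> d" using x y F_cocycle[OF x(1)] by (simp add: cohomologous_in_def)
      then have "?h (cohomologous_in C \<delta> d `` {x}) = Y"
        unfolding induced_class[OF x(1)] y(2) by (rule equiv_class_eq[OF equiv_classes(2)])
      then show "Y \<in> ?h ` (?Z // cohomologous_in C \<delta> d)" using quotientI[OF x(1), of "cohomologous_in C \<delta> d"] by blast
    qed
  qed
qed

text \<open>
  The long exact sequence of the cone in elementary form: injectivity writes \<open>v\<close> as \<open>\<delta> u\<close>, and
  surjectivity corrects \<open>u\<close> by a cocycle so that \<open>w - F u\<close> becomes a coboundary.
\<close>
lemma cone_acyclic_iff:
  "cone_acyclic C \<delta> D \<epsilon> F \<longleftrightarrow> (\<forall>d. injective_in d \<and> surjective_in d)"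
proof
  assume A: "cone_acyclic C \<delta> D \<epsilon> F"
  show "\<forall>d. injective_in d \<and> surjective_in d"
  proof (intro allI conjI)
    fix d
    show "injective_in d"
      unfolding injective_in_def
    proof (intro ballI impI)
      fix x assume x: "x \<in> C d" "\<delta> d x = 0" "F x \<in> \<epsilon> (d - 1) ` D (d - 1)"
      then obtain w where w: "w \<in> D (d - 1)" "F x = \<epsilon> (d - 1) w" by auto
      have "\<exists>v'\<in>C (d - 1). \<exists>w'\<in>D (d - 1 - 1). x = \<delta> (d - 1) v' \<and> w = F v' - \<epsilon> (d - 1 - 1) w'"
        using A[unfolded cone_acyclic_def, rule_format, of x "d - 1" w] x w by simp
      then show "x \<in> \<delta> (d - 1) ` C (d - 1)" by auto
    qed
    show "surjective_in d"
      unfolding surjective_in_def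
    proof (intro ballI impI)
      fix y assume y: "y \<in> D d" "\<epsilon> d y = 0"
      have z: "0 \<in> C (d + 1)" by (rule subgroup_zero[OF subgroups(1)])
      obtain v' w' where vw: "v' \<in> C d" "w' \<in> D (d - 1)" "0 = \<delta> d v'" "y = F v' - \<epsilon> (d - 1) w'"
        using A[unfolded cone_acyclic_def, rule_format, OF z y(1)] y
          additive_on_zero[OF additive_d] additive_on_zero[OF additive_F] by metis
      have "F v' - y = \<epsilon> (d - 1) w'" using vw(4) by simp
      then show "\<exists>x\<in>C d. \<delta> d x = 0 \<and> F x - y \<in> \<epsilon> (d - 1) ` D (d - 1)"
        using vw by (intro bexI[of _ v']) auto
    qed
  qed
next
  assume A: "\<forall>d. injective_in d \<and> surjective_in d"
  show "cone_acyclic C \<delta> D \<epsilon> F"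
    unfolding cone_acyclic_def
  proof (intro allI ballI impI)
    fix d v w assume v: "v \<in> C (d + 1)" "\<delta> (d + 1) v = 0" and w: "w \<in> D d" "F v = \<epsilon> d w"
    have "v \<in> \<delta> d ` C d" using A[rule_format, of "d + 1"] v w by (auto simp: injective_in_def)
    then obtain u where u: "u \<in> C d" "v = \<delta> d u" by auto
    have Fu: "F u \<in> D d" by (rule F_closed[OF u(1)])
    have "w - F u \<in> D d" by (rule subgroup_diff[OF subgroups(2) w(1) Fu])
    moreover have "\<epsilon> d (w - F u) = 0"
      using additive_on_diff[OF additive_d' w(1) Fu] w(2) F_d[OF u(1)] u(2) by simp
    ultimately obtain x where x: "x \<in> C d" "\<delta> d x = 0" "F x - (w - F u) \<in> \<epsilon> (d - 1) ` D (d - 1)"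
      using A[rule_format, of d] unfolding surjective_in_def by blast
    then obtain y where y: "y \<in> D (d - 1)" "F x - (w - F u) = \<epsilon> (d - 1) y" by auto
    show "\<exists>v'\<in>C d. \<exists>w'\<in>D (d - 1). v = \<delta> d v' \<and> w = F v' - \<epsilon> (d - 1) w'"
    proof (intro bexI conjI)
      show "u + x \<in> C d" by (rule subgroup_add[OF subgroups(1) u(1) x(1)])
      show "y \<in> D (d - 1)" by (rule y(1))
      show "v = \<delta> d (u + x)" using additive_on_add[OF additive_d u(1) x(1)] u x by simp
      show "w = F (u + x) - \<epsilon> (d - 1) y"
        using additive_on_add[OF additive_F u(1) x(1)] y(2)[symmetric] by simp
    qed
  qed
qed

end

section \<open>Complete filtrations\<close>

text \<open>
  Total complexes \<open>\<Delta>\<close>, \<open>\<Delta>'\<close> on sequences, filtered by the number of leading zeros. The assumptions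
  \<open>locality\<close> and \<open>leading\<close> say that their differentials are triangular with diagonal entries \<open>\<delta>\<close>, \<open>\<epsilon>\<close>.
  The shift of the degree by \<open>2 * r\<close> is the one of the twisted operad.
\<close>
locale filtered_cochain_map =
  fixes K :: "nat \<Rightarrow> int \<Rightarrow> 'a :: ab_group_add set" and \<delta> :: "nat \<Rightarrow> int \<Rightarrow> 'a \<Rightarrow> 'a"
    and K' :: "nat \<Rightarrow> int \<Rightarrow> 'b :: ab_group_add set" and \<epsilon> :: "nat \<Rightarrow> int \<Rightarrow> 'b \<Rightarrow> 'b"
    and F :: "nat \<Rightarrow> 'a \<Rightarrow> 'b"
    and \<Delta> :: "int \<Rightarrow> (nat \<Rightarrow> 'a) \<Rightarrow> nat \<Rightarrow> 'a" and \<Delta>' :: "int \<Rightarrow> (nat \<Rightarrow> 'b) \<Rightarrow> nat \<Rightarrow> 'b"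
  assumes graded: "\<And>r. cochain_map (K r) (\<delta> r) (K' r) (\<epsilon> r) (F r)"
    and total: "cochain_map (\<lambda>d. {f. \<forall>r. f r \<in> K r (d - 2 * int r)}) \<Delta>
      (\<lambda>d. {f. \<forall>r. f r \<in> K' r (d - 2 * int r)}) \<Delta>' (\<lambda>f r. F r (f r))"
    and locality: "\<And>f g d r. (\<And>s. s \<le> r \<Longrightarrow> f s = g s) \<Longrightarrow> \<Delta> d f r = \<Delta> d g r"
    and locality': "\<And>f g d r. (\<And>s. s \<le> r \<Longrightarrow> f s = g s) \<Longrightarrow> \<Delta>' d f r = \<Delta>' d g r"
    and leading: "\<And>f d r. (\<And>s. f s \<in> K s (d - 2 * int s)) \<Longrightarrow> (\<And>s. s < r \<Longrightarrow> f s = 0) \<Longrightarrow>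
      \<Delta> d f r = \<delta> r (d - 2 * int r) (f r)"
    and leading': "\<And>f d r. (\<And>s. f s \<in> K' s (d - 2 * int s)) \<Longrightarrow> (\<And>s. s < r \<Longrightarrow> f s = 0) \<Longrightarrow>
      \<Delta>' d f r = \<epsilon> r (d - 2 * int r) (f r)"
begin

abbreviation T where "T d \<equiv> {f. \<forall>r. f r \<in> K r (d - 2 * int r)}"
abbreviation T' where "T' d \<equiv> {f. \<forall>r. f r \<in> K' r (d - 2 * int r)}"

interpretation total: cochain_map T \<Delta> T' \<Delta>' "\<lambda>f r. F r (f r)"
  by (rule total)

text \<open>
  The defect \<open>(e, g)\<close> of the approximate primitive \<open>(p, q)\<close> is a cocycle of the total cone that vanishes
  below \<open>r\<close>, hence its component in \<open>r\<close> is a cocycle of the cone of the graded piece. A primitive of this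
  component, placed in position \<open>r\<close>, removes the defect there and does not disturb smaller components.
\<close>
lemma approximation_step:
  assumes v: "v \<in> T (d + 1)" "\<Delta> (d + 1) v = 0" and w: "w \<in> T' d" "(\<lambda>r. F r (v r)) = \<Delta>' d w"
    and p: "p \<in> T d" and q: "q \<in> T' (d - 1)"
    and eq: "\<And>s. s < r \<Longrightarrow> \<Delta> d p s = v s" "\<And>s. s < r \<Longrightarrow> F s (p s) - \<Delta>' (d - 1) q s = w s"
    and acyclic: "cone_acyclic (K r) (\<delta> r) (K' r) (\<epsilon> r) (F r)"
  obtains p' q' where "p' \<in> T d" "q' \<in> T' (d - 1)"
    "\<And>s. s < Suc r \<Longrightarrow> \<Delta> d p' s = v s" "\<And>s. s < Suc r \<Longrightarrow> F s (p' s) - \<Delta>' (d - 1) q' s = w s"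
    "\<And>s. s < r \<Longrightarrow> p' s = p s" "\<And>s. s < r \<Longrightarrow> q' s = q s"
proof -
  note add = total.additive_d[of d] total.additive_d'[of "d - 1"]
  have Fp: "(\<lambda>r. F r (p r)) \<in> T' d" by (rule total.F_closed[OF p])
  have Dp: "\<Delta> d p \<in> T (d + 1)" by (rule total.d_closed[OF p])
  have Dq: "\<Delta>' (d - 1) q \<in> T' d" using total.d'_closed[OF q] by simp
  \<comment> \<open>the defect of \<open>(p, q)\<close>\<close>
  define e where "e = v - \<Delta> d p"
  define g where "g = w - (\<lambda>r. F r (p r)) + \<Delta>' (d - 1) q"
  have e: "e \<in> T (d + 1)" unfolding e_def by (rule subgroup_diff[OF total.subgroups(1) v(1) Dp])
  have wF: "w - (\<lambda>r. F r (p r)) \<in> T' d" by (rule subgroup_diff[OF total.subgroups(2) w(1) Fp])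
  have g: "g \<in> T' d" unfolding g_def by (rule subgroup_add[OF total.subgroups(2) wF Dq])
  have De: "\<Delta> (d + 1) e = 0"
    unfolding e_def using additive_on_diff[OF total.additive_d v(1) Dp] v(2) total.d_d[OF p] by simp
  have "\<Delta>' d g = \<Delta>' d w - \<Delta>' d (\<lambda>r. F r (p r)) + \<Delta>' d (\<Delta>' (d - 1) q)"
    unfolding g_def
    using additive_on_add[OF total.additive_d' wF Dq] additive_on_diff[OF total.additive_d' w(1) Fp] by simp
  also have "\<dots> = \<Delta>' d w - (\<lambda>r. F r (\<Delta> d p r))"
    using total.d'_d'[OF q] total.F_d[OF p] by simp
  also have "\<dots> = (\<lambda>r. F r (e r))"
    using additive_on_diff[OF total.additive_F v(1) Dp] w(2) unfolding e_def by simp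
  finally have Dg: "\<Delta>' d g = (\<lambda>r. F r (e r))" .
  have e0: "e s = 0" and g0: "g s = 0" if "s < r" for s
    using eq(1)[OF that] by (simp_all add: e_def g_def eq(2)[OF that, symmetric])
  have er: "e r \<in> K r (d - 2 * int r + 1)" using e by (auto simp: algebra_simps)
  have gr: "g r \<in> K' r (d - 2 * int r)" using g by auto
  have "\<delta> r (d - 2 * int r + 1) (e r) = \<Delta> (d + 1) e r"
    using leading[of e "d + 1" r] e e0 by (simp add: algebra_simps)
  then have 1: "\<delta> r (d - 2 * int r + 1) (e r) = 0" by (simp add: De)
  have "\<epsilon> r (d - 2 * int r) (g r) = \<Delta>' d g r"
    using leading'[of g d r] g g0 by simp
  then have 2: "F r (e r) = \<epsilon> r (d - 2 * int r) (g r)" by (simp add: Dg)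
  obtain x y where xy: "x \<in> K r (d - 2 * int r)" "y \<in> K' r (d - 2 * int r - 1)"
    "e r = \<delta> r (d - 2 * int r) x" "g r = F r x - \<epsilon> r (d - 2 * int r - 1) y"
    using acyclic[unfolded cone_acyclic_def, rule_format, OF er gr 1 2] by auto
  \<comment> \<open>the correction, concentrated in position \<open>r\<close>\<close>
  define x' where "x' s = (if s = r then x else 0)" for s
  define y' where "y' s = (if s = r then y else 0)" for s
  have K0: "0 \<in> K s k" "0 \<in> K' s k" for s k
    using cochain_map.subgroups[OF graded, of s k] by (auto intro: subgroup_zero)
  have x': "x' \<in> T d" using xy(1) K0 by (auto simp: x'_def)
  have y': "y' \<in> T' (d - 1)" using xy(2) K0 by (auto simp: y'_def algebra_simps)
  have Dx': "\<Delta> d x' s = 0" if "s < r" for s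
    using locality[of s x' 0 d] additive_on_zero[OF add(1)] that by (simp add: x'_def)
  have Dy': "\<Delta>' (d - 1) y' s = 0" if "s < r" for s
    using locality'[of s y' 0 "d - 1"] additive_on_zero[OF add(2)] that by (simp add: y'_def)
  have Dxr: "\<Delta> d x' r = e r" using leading[of x' d r] x' xy(3) by (simp add: x'_def)
  have Dyr: "\<Delta>' (d - 1) y' r = \<epsilon> r (d - 2 * int r - 1) y"
    using leading'[of y' "d - 1" r] y' by (simp add: y'_def algebra_simps)
  have F0: "F s 0 = 0" for s
    by (rule additive_on_zero[OF cochain_map.additive_F[OF graded, of s]])
  have Dpx: "\<Delta> d (p + x') s = \<Delta> d p s + \<Delta> d x' s" for s
    using additive_on_add[OF add(1) p x'] by simp
  have Dqy: "\<Delta>' (d - 1) (q + y') s = \<Delta>' (d - 1) q s + \<Delta>' (d - 1) y' s" for s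
    using additive_on_add[OF add(2) q y'] by simp
  have Fpx: "F s (p s + x' s) = F s (p s) + F s (x' s)" for s
    using fun_cong[OF additive_on_add[OF total.additive_F p x'], of s] by simp
  show thesis
  proof (rule that[of "p + x'" "q + y'"])
    show "p + x' \<in> T d" by (rule subgroup_add[OF total.subgroups(1) p x'])
    show "q + y' \<in> T' (d - 1)" by (rule subgroup_add[OF total.subgroups(2) q y'])
    fix s
    show "\<Delta> d (p + x') s = v s" if "s < Suc r"
    proof (cases "s = r")
      case True
      then show ?thesis using Dpx[of r] Dxr by (simp add: e_def)
    next
      case False
      then show ?thesis using that Dpx[of s] Dx'[of s] eq(1)[of s] by simp
    qed
    show "F s ((p + x') s) - \<Delta>' (d - 1) (q + y') s = w s" if "s < Suc r"
    proof (cases "s = r")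
      case True
      then show ?thesis using Dqy[of r] Dyr xy(4) Fpx[of r] by (simp add: g_def x'_def algebra_simps)
    next
      case False
      then show ?thesis using that Dqy[of s] Dy'[of s] eq(2)[of s] by (simp add: x'_def)
    qed
    show "(p + x') s = p s" "(q + y') s = q s" if "s < r" using that by (simp_all add: x'_def y'_def)
  qed
qed

text \<open>
  Each component of the approximate primitives is changed only once, so they have a limit, whose
  boundary can be computed componentwise by locality.
\<close>
theorem cone_acyclic_total:
  assumes acyclic: "\<And>r. cone_acyclic (K r) (\<delta> r) (K' r) (\<epsilon> r) (F r)"
  shows "cone_acyclic T \<Delta> T' \<Delta>' (\<lambda>f r. F r (f r))"
  unfolding cone_acyclic_def
proof (intro allI ballI impI)
  fix d v w assume v: "v \<in> T (d + 1)" and w: "w \<in> T' d"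
    and Dv: "\<Delta> (d + 1) v = 0" and Fv: "(\<lambda>r. F r (v r)) = \<Delta>' d w"
  \<comment> \<open>\<open>good r\<close>: an approximate primitive that is correct in the components below \<open>r\<close>\<close>
  define good where "good r z \<longleftrightarrow> fst z \<in> T d \<and> snd z \<in> T' (d - 1) \<and>
    (\<forall>s<r. \<Delta> d (fst z) s = v s \<and> F s (fst z s) - \<Delta>' (d - 1) (snd z) s = w s)" for r z
  define agree where "agree r z z' \<longleftrightarrow> (\<forall>s<r. fst z' s = fst z s \<and> snd z' s = snd z s)"
    for r :: nat and z z' :: "(nat \<Rightarrow> 'a) \<times> (nat \<Rightarrow> 'b)"
  have "\<exists>z. \<forall>r. good r (z r) \<and> agree r (z r) (z (Suc r))"
  proof (rule dependent_nat_choice)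
    show "\<exists>z. good 0 z"
      using subgroup_zero[OF total.subgroups(1), of d] subgroup_zero[OF total.subgroups(2), of "d - 1"]
      by (intro exI[of _ "(0, 0)"]) (simp add: good_def)
    fix z r assume z: "good r z"
    obtain p q where "p \<in> T d" "q \<in> T' (d - 1)"
      "\<And>s. s < Suc r \<Longrightarrow> \<Delta> d p s = v s" "\<And>s. s < Suc r \<Longrightarrow> F s (p s) - \<Delta>' (d - 1) q s = w s"
      "\<And>s. s < r \<Longrightarrow> p s = fst z s" "\<And>s. s < r \<Longrightarrow> q s = snd z s"
      by (rule approximation_step[OF v Dv w Fv, of "fst z" "snd z" r])
        (use z acyclic in \<open>auto simp: good_def\<close>)
    then show "\<exists>z'. good (Suc r) z' \<and> agree r z z'"
      by (intro exI[of _ "(p, q)"]) (simp add: good_def agree_def)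
  qed
  then obtain z where z: "\<And>r. good r (z r)" "\<And>r. agree r (z r) (z (Suc r))" by blast
  have stable: "fst (z (Suc r + k)) s = fst (z (Suc r)) s \<and> snd (z (Suc r + k)) s = snd (z (Suc r)) s"
    if "s \<le> r" for r k s
  proof (induction k)
    case (Suc k)
    have "s < Suc r + k" using that by simp
    then show ?case using Suc z(2)[of "Suc r + k"] by (simp add: agree_def)
  qed simp
  define p where "p r = fst (z (Suc r)) r" for r
  define q where "q r = snd (z (Suc r)) r" for r
  have pq: "p s = fst (z (Suc r)) s" "q s = snd (z (Suc r)) s" if "s \<le> r" for s r
    using stable[of s s "r - s"] that by (simp_all add: p_def q_def)
  have "p \<in> T d" "q \<in> T' (d - 1)"
    using z(1) by (auto simp: good_def p_def q_def)
  moreover have "\<Delta> d p r = v r" for r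
    using locality[of r p "fst (z (Suc r))" d] pq(1) z(1)[of "Suc r"] by (simp add: good_def)
  moreover have "F r (p r) - \<Delta>' (d - 1) q r = w r" for r
    using locality'[of r q "snd (z (Suc r))" "d - 1"] pq(2) pq(1)[of r r] z(1)[of "Suc r"]
    by (simp add: good_def)
  ultimately show "\<exists>v'\<in>T d. \<exists>w'\<in>T' (d - 1). v = \<Delta> d v' \<and> w = (\<lambda>r. F r (v' r)) - \<Delta>' (d - 1) w'"
    by (intro bexI[of _ p] bexI[of _ q]) (auto simp: fun_eq_iff)
qed

end

section \<open>Invariants and averaging\<close>

definition invariants :: "('k, 'a, 'z) goperad_scheme \<Rightarrow> nat \<Rightarrow> nat \<Rightarrow> int \<Rightarrow> 'a set" where
  "invariants P m r d = {v \<in> part P m d. \<forall>\<sigma>. \<sigma> permutes {1..r} \<longrightarrow> act P m \<sigma> v = v}"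

definition average :: "('k :: field_char_0, 'a :: ab_group_add, 'z) goperad_scheme \<Rightarrow> nat \<Rightarrow> nat \<Rightarrow> 'a \<Rightarrow> 'a" where
  "average P m r v = scl P (1 / fact r) (\<Sum>\<sigma> | \<sigma> permutes {1..r}. act P m \<sigma> v)"

context graded_operad
begin

lemma scl_part: "v \<in> part P m d \<Longrightarrow> scl P c v \<in> part P m d"
  by (rule subspace_scale[OF part_subspace])

lemma permutes_initial: "\<sigma> permutes {1..r} \<Longrightarrow> r \<le> m \<Longrightarrow> \<sigma> permutes {1..m :: nat}"
  by (erule permutes_subset) auto

lemma sum_act_part:
  assumes "r \<le> m" "v \<in> part P m d"
  shows "(\<Sum>\<sigma> | \<sigma> permutes {1..r}. act P m \<sigma> v) \<in> part P m d"
  by (rule subgroup_sum[OF subgroup_part]) (use act_part permutes_initial assms in blast)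

lemma average_invariant:
  assumes r: "r \<le> m" and v: "v \<in> part P m d"
  shows "average P m r v \<in> invariants P m r d"
  unfolding invariants_def
proof (intro CollectI conjI allI impI)
  show "average P m r v \<in> part P m d"
    unfolding average_def by (rule scl_part[OF sum_act_part[OF r v]])
  fix \<tau> assume \<tau>: "\<tau> permutes {1..r}"
  have t: "\<tau> permutes {1..m}" by (rule permutes_initial[OF \<tau> r])
  have "act P m \<tau> (\<Sum>\<sigma> | \<sigma> permutes {1..r}. act P m \<sigma> v) =
      (\<Sum>\<sigma> | \<sigma> permutes {1..r}. act P m \<tau> (act P m \<sigma> v))"
    by (rule additive_on_sum[OF additive_act[OF t]]) (use act_part permutes_initial[OF _ r] v in blast)
  also have "\<dots> = (\<Sum>\<sigma> | \<sigma> permutes {1..r}. act P m (\<tau> \<circ> \<sigma>) v)"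
    by (rule sum.cong[OF refl]) (use act_comp[OF t permutes_initial[OF _ r] v] in simp)
  also have "\<dots> = (\<Sum>\<sigma> | \<sigma> permutes {1..r}. act P m \<sigma> v)"
    by (rule setum_permutations_compose_left[OF \<tau>, symmetric])
  finally show "act P m \<tau> (average P m r v) = average P m r v"
    unfolding average_def using act_scl[OF t sum_act_part[OF r v]] by simp
qed

lemma average_of_invariant:
  assumes "v \<in> invariants P m r d"
  shows "average P m r v = v"
proof -
  have "(\<Sum>\<sigma> | \<sigma> permutes {1..r}. act P m \<sigma> v) = (\<Sum>\<sigma> | \<sigma> permutes {1..r}. v)"
    by (rule sum.cong[OF refl]) (use assms in \<open>simp add: invariants_def\<close>)
  also have "\<dots> = scl P (fact r) v"
    by (subst sum_constant_scale) (simp add: card_permutations[of _ r])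
  finally show ?thesis by (simp add: average_def)
qed

text \<open>
  To be applied with the differential and with \<open>F\<close> as the map \<open>h\<close>.
\<close>
lemma average_commute:
  assumes r: "r \<le> m" and v: "v \<in> part P m d" and h: "additive_on (part P m d) h"
    and h_scl: "\<And>c x. x \<in> part P m d \<Longrightarrow> h (scl P c x) = scl Q c (h x)"
    and h_act: "\<And>\<sigma>. \<sigma> permutes {1..m} \<Longrightarrow> h (act P m \<sigma> v) = act Q m \<sigma> (h v)"
  shows "h (average P m r v) = average Q m r (h v)"
proof -
  have "h (average P m r v) = scl Q (1 / fact r) (h (\<Sum>\<sigma> | \<sigma> permutes {1..r}. act P m \<sigma> v))"
    unfolding average_def by (rule h_scl[OF sum_act_part[OF r v]])
  also have "h (\<Sum>\<sigma> | \<sigma> permutes {1..r}. act P m \<sigma> v) = (\<Sum>\<sigma> | \<sigma> permutes {1..r}. h (act P m \<sigma> v))"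
    by (rule additive_on_sum[OF h]) (use act_part permutes_initial[OF _ r] v in blast)
  also have "\<dots> = (\<Sum>\<sigma> | \<sigma> permutes {1..r}. act Q m \<sigma> (h v))"
    by (rule sum.cong[OF refl]) (use h_act permutes_initial[OF _ r] in simp)
  finally show ?thesis by (simp add: average_def)
qed

lemma invariants_subgroup: 
  assumes "r \<le> m"
  shows "subgroup_of (invariants P m r d)"
  unfolding subgroup_of_def invariants_def
  using subgroup_part[of m d] additive_on_zero[OF additive_act[OF permutes_initial[OF _ assms], of _ d]]
    additive_on_diff[OF additive_act[OF permutes_initial[OF _ assms]], of _ _ d]
  by (auto intro: subgroup_zero subgroup_diff)

lemma tw_part_invariants:
  "tw_part P n d = {f. \<forall>r. f r \<in> invariants P (r + n) r (d - 2 * int r)}"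
  by (auto simp: tw_part_def invariants_def)

lemma subgroup_tw_part: "subgroup_of (tw_part P n d)"
  unfolding tw_part_invariants subgroup_of_def
  using invariants_subgroup[of _ "_ + n"] by (auto intro: subgroup_zero subgroup_diff)

end

lemma additive_on_subset: "additive_on C h \<Longrightarrow> subgroup_of B \<Longrightarrow> B \<subseteq> C \<Longrightarrow> additive_on B h"
  unfolding additive_on_def by blast

lemma
  assumes "graded_map P Q F"
  shows graded_map_part: "x \<in> part P n d \<Longrightarrow> F n x \<in> part Q n d"
    and graded_map_add: "x \<in> part P n d \<Longrightarrow> y \<in> part P n d \<Longrightarrow> F n (x + y) = F n x + F n y"
    and graded_map_scl: "x \<in> part P n d \<Longrightarrow> F n (scl P c x) = scl Q c (F n x)"
    and graded_map_act: "\<sigma> permutes {1..n} \<Longrightarrow> x \<in> part P n d \<Longrightarrow> F n (act P n \<sigma> x) = act Q n \<sigma> (F n x)"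
    and graded_map_pcomp: "i \<in> {1..n} \<Longrightarrow> x \<in> part P n d \<Longrightarrow> y \<in> part P m e \<Longrightarrow>
      F (n + m - 1) (pcomp P n m i x y) = pcomp Q n m i (F n x) (F m y)"
    and graded_map_unt: "F 1 (unt P) = unt Q"
proof -
  note h = assms[unfolded graded_map_def]
  show "x \<in> part P n d \<Longrightarrow> F n x \<in> part Q n d"
    using h[THEN conjunct1] by blast
  show "x \<in> part P n d \<Longrightarrow> y \<in> part P n d \<Longrightarrow> F n (x + y) = F n x + F n y"
    using h[THEN conjunct2, THEN conjunct1] by blast
  show "x \<in> part P n d \<Longrightarrow> F n (scl P c x) = scl Q c (F n x)"
    using h[THEN conjunct2, THEN conjunct2, THEN conjunct1] by blast
  show "\<sigma> permutes {1..n} \<Longrightarrow> x \<in> part P n d \<Longrightarrow> F n (act P n \<sigma> x) = act Q n \<sigma> (F n x)"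
    using h[THEN conjunct2, THEN conjunct2, THEN conjunct2, THEN conjunct1] by blast
  show "i \<in> {1..n} \<Longrightarrow> x \<in> part P n d \<Longrightarrow> y \<in> part P m e \<Longrightarrow>
      F (n + m - 1) (pcomp P n m i x y) = pcomp Q n m i (F n x) (F m y)"
    using h[THEN conjunct2, THEN conjunct2, THEN conjunct2, THEN conjunct2, THEN conjunct1] by blast
  show "F 1 (unt P) = unt Q"
    using h[THEN conjunct2, THEN conjunct2, THEN conjunct2, THEN conjunct2, THEN conjunct2] .
qed

lemma dg_map_dif: "dg_map P Q F \<Longrightarrow> x \<in> part P n d \<Longrightarrow> F n (dif P n d x) = dif Q n d (F n x)"
  unfolding dg_map_def by blast

lemma dg_map_graded: "dg_map P Q F \<Longrightarrow> graded_map P Q F"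
  unfolding dg_map_def by blast

locale dg_operad_map = source: dg_operad P + target: dg_operad Q
  for P :: "('k :: field_char_0, 'a :: ab_group_add, 'y) dgoperad_scheme"
    and Q :: "('k, 'b :: ab_group_add, 'z) dgoperad_scheme" +
  fixes F :: "nat \<Rightarrow> 'a \<Rightarrow> 'b"
  assumes F: "dg_map P Q F"
begin

lemmas Fg = dg_map_graded[OF F]

lemma additive_F: "additive_on (part P n d) (F n)"
  unfolding additive_on_def using source.subgroup_part graded_map_add[OF Fg] by blast

lemma F_relabel:
  assumes "arrangement js n" "v \<in> part P n d"
  shows "F n (relabel P js v) = relabel Q js (F n v)"
  using graded_map_act[OF Fg position_perm_permutes[OF assms(1)] assms(2)] arrangement_length[OF assms(1)]
  by (simp add: relabel_conv)

lemma full_cochain_map: "cochain_map (part P m) (dif P m) (part Q m) (dif Q m) (F m)"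
  by unfold_locales
    (auto intro: source.additive_dif target.additive_dif additive_F source.dif_part target.dif_part
      graded_map_part[OF Fg] source.dif_dif target.dif_dif dg_map_dif[OF F])

lemma invariants_cochain_map:
  assumes r: "r \<le> m"
  shows "cochain_map (invariants P m r) (dif P m) (invariants Q m r) (dif Q m) (F m)"
proof
  fix d
  have sub: "invariants P m r d \<subseteq> part P m d" "invariants Q m r d \<subseteq> part Q m d"
    by (auto simp: invariants_def)
  show "additive_on (invariants P m r d) (dif P m d)"
    by (rule additive_on_subset[OF source.additive_dif source.invariants_subgroup[OF r] sub(1)])
  show "additive_on (invariants Q m r d) (dif Q m d)"
    by (rule additive_on_subset[OF target.additive_dif target.invariants_subgroup[OF r] sub(2)])
  show "additive_on (invariants P m r d) (F m)"
    by (rule additive_on_subset[OF additive_F source.invariants_subgroup[OF r] sub(1)])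
  fix x assume x: "x \<in> invariants P m r d"
  then have xp: "x \<in> part P m d" and xi: "\<And>\<sigma>. \<sigma> permutes {1..r} \<Longrightarrow> act P m \<sigma> x = x"
    by (auto simp: invariants_def)
  show "dif P m d x \<in> invariants P m r (d + 1)"
    unfolding invariants_def
    using source.dif_part[OF xp] source.dif_act[OF source.permutes_initial[OF _ r] xp] xi by simp
  show "F m x \<in> invariants Q m r d"
    unfolding invariants_def
    using graded_map_part[OF Fg xp] graded_map_act[OF Fg source.permutes_initial[OF _ r] xp] xi by simp
  show "dif P m (d + 1) (dif P m d x) = 0" by (rule source.dif_dif[OF xp])
  show "F m (dif P m d x) = dif Q m d (F m x)" by (rule dg_map_dif[OF F xp])
next
  fix d y assume y: "y \<in> invariants Q m r d"
  then have yp: "y \<in> part Q m d" and yi: "\<And>\<sigma>. \<sigma> permutes {1..r} \<Longrightarrow> act Q m \<sigma> y = y"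
    by (auto simp: invariants_def)
  show "dif Q m d y \<in> invariants Q m r (d + 1)"
    unfolding invariants_def
    using target.dif_part[OF yp] target.dif_act[OF target.permutes_initial[OF _ r] yp] yi by simp
  show "dif Q m (d + 1) (dif Q m d y) = 0" by (rule target.dif_dif[OF yp])
qed

text \<open>
  Averaging a primitive of an invariant cocycle of the cone gives an invariant primitive.
\<close>
lemma cone_acyclic_invariants:
  assumes A: "cone_acyclic (part P m) (dif P m) (part Q m) (dif Q m) (F m)" and r: "r \<le> m"
  shows "cone_acyclic (invariants P m r) (dif P m) (invariants Q m r) (dif Q m) (F m)"
  unfolding cone_acyclic_def
proof (intro allI ballI impI)
  fix d v w assume v: "v \<in> invariants P m r (d + 1)" and w: "w \<in> invariants Q m r d"
    and eq: "dif P m (d + 1) v = 0" "F m v = dif Q m d w"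
  have vw: "v \<in> part P m (d + 1)" "w \<in> part Q m d" using v w by (auto simp: invariants_def)
  obtain x y where x: "x \<in> part P m d" and y: "y \<in> part Q m (d - 1)"
    and xy: "v = dif P m d x" "w = F m x - dif Q m (d - 1) y"
    using A[unfolded cone_acyclic_def, rule_format, OF vw eq] by blast
  let ?A = "average P m r" and ?B = "average Q m r"
  have dy: "dif Q m (d - 1) y \<in> part Q m d" using target.dif_part[OF y] by simp
  have Fx: "F m x \<in> part Q m d" by (rule graded_map_part[OF Fg x])
  have "dif P m d (?A x) = ?A (dif P m d x)"
    by (rule source.average_commute[OF r x source.additive_dif source.dif_scl source.dif_act[OF _ x]])
  also have "\<dots> = v" using source.average_of_invariant[OF v] xy(1) by simp
  finally have 1: "v = dif P m d (?A x)" ..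
  have 2: "F m (?A x) = ?B (F m x)"
    by (rule source.average_commute[OF r x additive_F graded_map_scl[OF Fg] graded_map_act[OF Fg _ x]])
  have 3: "dif Q m (d - 1) (?B y) = ?B (dif Q m (d - 1) y)"
    by (rule target.average_commute[OF r y target.additive_dif target.dif_scl target.dif_act[OF _ y]])
  have "w = ?B w" by (rule target.average_of_invariant[OF w, symmetric])
  also have "\<dots> = ?B (F m x) - ?B (dif Q m (d - 1) y)"
  proof -
    have "(\<Sum>\<sigma> | \<sigma> permutes {1..r}. act Q m \<sigma> (F m x - dif Q m (d - 1) y)) =
      (\<Sum>\<sigma> | \<sigma> permutes {1..r}. act Q m \<sigma> (F m x) - act Q m \<sigma> (dif Q m (d - 1) y))"
      by (rule sum.cong[OF refl])
        (use additive_on_diff[OF target.additive_act[OF target.permutes_initial[OF _ r]] Fx dy] in simp)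
    then show ?thesis unfolding xy(2) average_def
      by (simp add: sum_subtractf target.scale_right_diff_distrib)
  qed
  finally have "w = F m (?A x) - dif Q m (d - 1) (?B y)" using 2 3 by simp
  with 1 show "\<exists>v'\<in>invariants P m r d. \<exists>w'\<in>invariants Q m r (d - 1).
      v = dif P m d v' \<and> w = F m v' - dif Q m (d - 1) w'"
    using source.average_invariant[OF r x] target.average_invariant[OF r y] by blast
qed

end

section \<open>Functoriality of twisting\<close>

abbreviation composition_list ::
  "(nat \<Rightarrow> nat) \<Rightarrow> nat \<Rightarrow> nat \<Rightarrow> nat \<Rightarrow> nat \<Rightarrow> nat \<Rightarrow> nat list" where
  "composition_list \<sigma> p r n m i \<equiv> map \<sigma> [1..<p + 1] @ [r + 1..<r + i] @ map \<sigma> [p + 1..<r + 1] @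
     [r + i..<r + i + m] @ [r + i + m..<r + n + m]"

lemma Sh_set:
  assumes "\<sigma> \<in> Sh p (r - p)" "p \<le> r"
  obtains S where "S \<subseteq> {1..r}" "finite S" "map \<sigma> [1..<p + 1] = sorted_of S" "map \<sigma> [p + 1..<r + 1] = sorted_of ({1..r} - S)"
proof -
  have pr: "p + (r - p) = r" using assms(2) by simp
  from Sh_blocks[OF assms(1), unfolded pr] show ?thesis
    by (intro that[of "\<sigma> ` {1..p}"]) (auto intro: finite_subset)
qed

lemma arrangement_tw_pcomp:
  assumes "\<sigma> \<in> Sh p (r - p)" "p \<le> r" "i \<in> {1..n}"
  shows "arrangement (composition_list \<sigma> p r n m i) (r + (n + m - 1))"
proof -
  obtain S where S: "S \<subseteq> {1..r}" "finite S" "map \<sigma> [1..<p + 1] = sorted_of S"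
    "map \<sigma> [p + 1..<r + 1] = sorted_of ({1..r} - S)" by (rule Sh_set[OF assms(1,2)])
  let ?L = "sorted_of S @ [r + 1..<r + i] @ sorted_of ({1..r} - S) @ [r + i..<r + i + m] @ [r + i + m..<r + n + m]"
  have S': "x \<le> r" if "x \<in> S" for x using S(1) that by auto
  have "distinct ?L" using S(1,2) S' assms(3) by (fastforce simp del: upt_Suc)
  moreover have "set ?L = {1..r} \<union> {r + 1..<r + i} \<union> {r + i..<r + i + m} \<union> {r + i + m..<r + n + m}"
    using S(1,2) by (auto simp del: upt_Suc)
  moreover have "\<dots> = {1..r + (n + m - 1)}" using assms(3) by auto
  ultimately show ?thesis unfolding S(3,4) arrangement_def by simp
qed

context graded_operad
begin

lemma tw_pcomp_term_part:
  assumes "f \<in> tw_part P n d" "g \<in> tw_part P m e" "i \<in> {1..n}" "p \<le> r"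
  shows "pcomp P (p + n) (r - p + m) (p + i) (f p) (g (r - p)) \<in> part P (r + (n + m - 1)) (d + e - 2 * int r)"
proof -
  have "pcomp P (p + n) (r - p + m) (p + i) (f p) (g (r - p)) \<in>
    part P (p + n + (r - p + m) - 1) (d - 2 * int p + (e - 2 * int (r - p)))"
    using assms by (intro pcomp_part tw_partD(1)) auto
  moreover have "p + n + (r - p + m) - 1 = r + (n + m - 1)" using assms(3,4) by auto
  moreover have "d - 2 * int p + (e - 2 * int (r - p)) = d + e - 2 * int r" using assms(4) by (simp add: of_nat_diff)
  ultimately show ?thesis by (simp only:)
qed

lemma pcomp_zero:
  "i \<in> {1..n} \<Longrightarrow> y \<in> part P m e \<Longrightarrow> pcomp P n m i 0 y = 0"
  "i \<in> {1..n} \<Longrightarrow> x \<in> part P n d \<Longrightarrow> pcomp P n m i x 0 = 0"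
  using additive_on_zero[OF additive_pcomp_left] additive_on_zero[OF additive_pcomp_right] by blast+

end

context mc_operad
begin

lemma additive_fam:
  assumes \<nu>: "length \<nu> = n" "distinct \<nu>" and X: "finite X"
  shows "additive_on (tw_part P n d) (\<lambda>f. fam f \<nu> X)"
  unfolding additive_on_def
proof (intro conjI ballI subgroup_tw_part)
  fix f g assume fg: "f \<in> tw_part P n d" "g \<in> tw_part P n d"
  let ?L = "sorted_of (X - set \<nu>) @ \<nu>" and ?k = "card (X - set \<nu>)"
  have "distinct ?L" "length ?L = ?k + n" using \<nu> X by auto
  then show "fam (f + g) \<nu> X = fam f \<nu> X + fam g \<nu> X"
    using additive_on_add[OF additive_lab, of ?L "f ?k" "d - 2 * int ?k" "g ?k"]
      tw_partD(1)[OF fg(1)] tw_partD(1)[OF fg(2)] by (simp add: fam_def)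
qed

lemma additive_rterm:
  assumes \<nu>: "length \<nu> = n" "distinct \<nu>" "set \<nu> \<subseteq> X" and X: "finite X"
    and S: "S \<in> contractions (set \<nu>) X"
  shows "additive_on (tw_part P n d) (\<lambda>f. rterm f \<nu> X S)"
proof -
  note s = contractionsD[OF S X] and q = quot_props[OF X \<nu>(3) S]
  show ?thesis unfolding rterm_def
    by (rule additive_on_comp[OF additive_fam[OF \<nu>(1,2) q(1)]
          additive_circ_left[OF q(1) s(2) q(5,4) a_part[OF s(7)]] fam_part[OF _ \<nu>(2,1) q(1,2)]])
qed

lemma additive_lterm:
  assumes \<nu>: "length \<nu> = n" "distinct \<nu>" "set \<nu> \<subseteq> S" and X: "finite X" "0 \<notin> X" and S: "S \<subseteq> X"
  shows "additive_on (tw_part P n d) (\<lambda>f. lterm f \<nu> X S)"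
proof -
  let ?B = "X - S \<union> {0}"
  have fS: "finite S" by (rule finite_subset[OF S X(1)])
  have c: "card (X - S) + 1 = card ?B" using X by simp
  have B: "finite ?B" "0 \<in> ?B" "S \<inter> (?B - {0}) = {}" using X(1) by auto
  show ?thesis unfolding lterm_def c
    by (rule additive_on_comp[OF additive_fam[OF \<nu>(1,2) fS]
          additive_circ_right[OF B(1) fS B(2,3) a_part] fam_part[OF _ \<nu>(2,1) fS \<nu>(3)]])
      (use c in linarith)
qed

lemma additive_tw_dif: "additive_on (tw_part P n d) (tw_dif P a n d)"
  unfolding additive_on_def
proof (intro conjI ballI subgroup_tw_part ext)
  fix f g r assume f: "f \<in> tw_part P n d" and g: "g \<in> tw_part P n d"
  let ?X = "{1..r + n}" and ?\<nu> = "[r + 1..<r + n + 1]"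
  have \<nu>: "length ?\<nu> = n" "distinct ?\<nu>" "set ?\<nu> \<subseteq> ?X" and X: "finite ?X" "0 \<notin> ?X" by auto
  note fg = subgroup_add[OF subgroup_tw_part f g]
  have "fam (f + g) ?\<nu> ?X = fam f ?\<nu> ?X + fam g ?\<nu> ?X"
    by (rule additive_on_add[OF additive_fam[OF \<nu>(1,2) X(1)] f g])
  moreover have "rstar (f + g) ?\<nu> ?X = rstar f ?\<nu> ?X + rstar g ?\<nu> ?X"
    unfolding rstar_def
    by (rule additive_on_add[OF additive_on_sum_fun[OF subgroup_tw_part additive_rterm[OF \<nu> X(1)]] f g])
  moreover have "lstar (f + g) ?\<nu> ?X = lstar f ?\<nu> ?X + lstar g ?\<nu> ?X"
    unfolding lstar_def
    by (rule additive_on_add[OF additive_on_sum_fun[OF subgroup_tw_part additive_lterm[OF \<nu>(1,2) _ X]] f g])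
      auto
  ultimately show "tw_dif P a n d (f + g) r = (tw_dif P a n d f + tw_dif P a n d g) r"
    unfolding plus_fun_apply[of "tw_dif P a n d f"] tw_dif_eq_tw_dif_on[OF f] tw_dif_eq_tw_dif_on[OF g]
      tw_dif_eq_tw_dif_on[OF fg] tw_dif_on_def
    using additive_on_add[OF additive_dif fam_part[OF f \<nu>(2,1) X(1) \<nu>(3)] fam_part[OF g \<nu>(2,1) X(1) \<nu>(3)]]
    by (simp add: sgn_pow_simps)
qed

lemma tw_dif_local:
  assumes "\<And>s. s \<le> r \<Longrightarrow> f s = g s"
  shows "tw_dif P a n d f r = tw_dif P a n d g r"
  unfolding tw_dif_def Let_def tw_pcomp_def
  by (intro arg_cong2[where f = "(+)"] arg_cong2[where f = "(-)"] arg_cong[where f = "sgn_pow d"] sum.cong refl)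
    (use assms in auto)

text \<open>
  Apart from the internal differential, a term of \<open>tw_dif\<close> that involves \<open>f r\<close> contains \<open>a 1 = 0\<close>.
\<close>
lemma tw_dif_leading:
  assumes f: "f \<in> tw_part P n d" and z: "\<And>s. s < r \<Longrightarrow> f s = 0"
  shows "tw_dif P a n d f r = dif P (r + n) (d - 2 * int r) (f r)"
proof -
  let ?X = "{1..r + n}" and ?\<nu> = "[r + 1..<r + n + 1]"
  have \<nu>: "length ?\<nu> = n" "distinct ?\<nu>" "set ?\<nu> \<subseteq> ?X" and X: "finite ?X" "0 \<notin> ?X" by auto
  have XV: "?X - set ?\<nu> = {1..r}" by auto
  have fam0: "fam f ?\<nu> Y = 0" if "card (Y - set ?\<nu>) < r" "finite Y" for Y
  proof -
    have "distinct (sorted_of (Y - set ?\<nu>) @ ?\<nu>)" using that(2) by auto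
    from additive_on_zero[OF additive_lab[OF this]] show ?thesis unfolding fam_def z[OF that(1)] .
  qed
  have "rterm f ?\<nu> ?X S = 0" if S: "S \<in> contractions (set ?\<nu>) ?X" for S
  proof -
    note s = contractionsD[OF S X(1)] and q = quot_props[OF X(1) \<nu>(3) S]
    note ap = a_part[OF s(7)] and fp = fam_part[OF f \<nu>(2,1) q(1,2)]
    show ?thesis
    proof (cases "card S = 1")
      case True
      then show ?thesis unfolding rterm_def
        using additive_on_zero[OF additive_circ_right[OF q(1) s(2) q(5,4) fp]] a_one by (simp del: upt_Suc)
    next
      case False
      then have "card (quot (set ?\<nu>) ?X S - set ?\<nu>) < r" using q(7) s(7) unfolding XV by simp
      from fam0[OF this q(1)] show ?thesis unfolding rterm_def
        using additive_on_zero[OF additive_circ_left[OF q(1) s(2) q(5,4) ap]] by (simp del: upt_Suc)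
    qed
  qed
  then have "rstar f ?\<nu> ?X = 0" unfolding rstar_def by (intro sum.neutral) blast
  moreover have "lterm f ?\<nu> ?X S = 0" if S: "set ?\<nu> \<subseteq> S" "S \<subseteq> ?X" for S
  proof -
    let ?B = "?X - S \<union> {0}"
    have fS: "finite S" by (rule finite_subset[OF S(2) X(1)])
    have B: "finite ?B" "0 \<in> ?B" "S \<inter> (?B - {0}) = {}" by auto
    note c = split_card[OF X S] and fp = fam_part[OF f \<nu>(2,1) fS S(1)]
    show ?thesis
    proof (cases "card (?X - S) = 0")
      case True
      have "additive_on (part P (card ?B) 0) (\<lambda>v. circ ?B 0 S v (fam f ?\<nu> S))"
        by (rule additive_circ_left[OF B(1) fS B(2,3) fp])
      from additive_on_zero[OF this] show ?thesis unfolding lterm_def True using a_one by simp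
    next
      case False
      moreover have "card (?X - set ?\<nu>) = r" unfolding XV by simp
      ultimately have "card (S - set ?\<nu>) < r" using c(3) by linarith
      note fam0 = fam0[OF this fS]
      have "a (card ?B) \<in> part P (card ?B) (3 - 2 * int (card ?B))"
        by (rule a_part) (use c(2) in linarith)
      from additive_on_zero[OF additive_circ_right[OF B(1) fS B(2,3) this]]
      show ?thesis unfolding lterm_def fam0 c(2)[symmetric] .
    qed
  qed
  then have "lstar f ?\<nu> ?X = 0" unfolding lstar_def by (intro sum.neutral) blast
  ultimately show ?thesis
    unfolding tw_dif_eq_tw_dif_on[OF f] tw_dif_on_def XV fam_interval[OF tw_partD(1)[OF f]]
    by (simp add: sgn_pow_simps del: upt_Suc)
qed

end

context dg_operad_map
begin

lemma Tw_map_part: "f \<in> tw_part P n d \<Longrightarrow> Tw_map F n f \<in> tw_part Q n d"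
  unfolding source.tw_part_invariants target.tw_part_invariants Tw_map_def
  using cochain_map.F_closed[OF invariants_cochain_map] by auto

lemma F_tw_pcomp:
  assumes f: "f \<in> tw_part P n d" and g: "g \<in> tw_part P m e" and i: "i \<in> {1..n}"
  shows "F (r + (n + m - 1)) (tw_pcomp P n m i f g r) = tw_pcomp Q n m i (Tw_map F n f) (Tw_map F m g) r"
proof -
  let ?N = "r + (n + m - 1)"
  let ?u = "\<lambda>p. pcomp P (p + n) (r - p + m) (p + i) (f p) (g (r - p))"
  have part: "relabel P (composition_list \<sigma> p r n m i) (?u p) \<in> part P ?N (d + e - 2 * int r)"
    if "p \<in> {0..r}" "\<sigma> \<in> Sh p (r - p)" for p \<sigma>
    by (rule source.relabel_part[OF arrangement_tw_pcomp source.tw_pcomp_term_part[OF f g]])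
      (use that i in auto)
  have "F ?N (tw_pcomp P n m i f g r) = (\<Sum>p = 0..r. F ?N (\<Sum>\<sigma>\<in>Sh p (r - p). relabel P (composition_list \<sigma> p r n m i) (?u p)))"
    unfolding tw_pcomp_def
    by (rule additive_on_sum[OF additive_F[of _ "d + e - 2 * int r"] subgroup_sum[OF source.subgroup_part part]])
  also have "\<dots> = (\<Sum>p = 0..r. \<Sum>\<sigma>\<in>Sh p (r - p). F ?N (relabel P (composition_list \<sigma> p r n m i) (?u p)))"
    by (intro sum.cong refl additive_on_sum[OF additive_F[of _ "d + e - 2 * int r"] part])
  also have "\<dots> = tw_pcomp Q n m i (Tw_map F n f) (Tw_map F m g) r"
    unfolding tw_pcomp_def
  proof (intro sum.cong refl)
    fix p \<sigma> assume p: "p \<in> {0..r}" and \<sigma>: "\<sigma> \<in> Sh p (r - p)"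
    then have pr: "p \<le> r" by simp
    have N: "?N = p + n + (r - p + m) - 1" using i pr by auto
    have "F ?N (relabel P (composition_list \<sigma> p r n m i) (?u p)) = relabel Q (composition_list \<sigma> p r n m i) (F ?N (?u p))"
      by (rule F_relabel[OF arrangement_tw_pcomp[OF \<sigma> pr i] source.tw_pcomp_term_part[OF f g i pr]])
    also have "F ?N (?u p) = pcomp Q (p + n) (r - p + m) (p + i) (F (p + n) (f p)) (F (r - p + m) (g (r - p)))"
      unfolding N
      by (rule graded_map_pcomp[OF Fg _ source.tw_partD(1)[OF f] source.tw_partD(1)[OF g]]) (use i in auto)
    finally show "F ?N (relabel P (composition_list \<sigma> p r n m i) (?u p)) = relabel Q (composition_list \<sigma> p r n m i)
        (pcomp Q (p + n) (r - p + m) (p + i) (Tw_map F n f p) (Tw_map F m g (r - p)))"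
      by (simp only: Tw_map_def)
  qed
  finally show ?thesis .
qed

end

text \<open>
  A map of operads that carries the family \<open>a\<close> to \<open>b\<close>, that is, a morphism under \<open>\<Lambda>Lie_\<infinity>\<close>.
\<close>
locale mc_operad_map = dg_operad_map P Q F + source: mc_operad P a + target: mc_operad Q b
  for P :: "('k :: field_char_0, 'a :: ab_group_add, 'y) dgoperad_scheme"
    and Q :: "('k, 'b :: ab_group_add, 'z) dgoperad_scheme" and F a b +
  assumes F_a: "k \<ge> 1 \<Longrightarrow> F k (a k) = b k"
begin

lemma F_lab:
  assumes "distinct xs" "v \<in> part P (length xs) d"
  shows "F (length xs) (lab P xs v) = lab Q xs (F (length xs) v)"
  unfolding lab_def by (rule F_relabel[OF arrangement_map_rank[OF assms(1)] assms(2)])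

lemma F_circ:
  assumes X: "finite X" "finite Y" "x \<in> X" "Y \<inter> (X - {x}) = {}"
    and v: "v \<in> part P (card X) d" and w: "w \<in> part P (card Y) e" and N: "N = card X + card Y - 1"
  shows "F N (source.circ X x Y v w) = target.circ X x Y (F (card X) v) (F (card Y) w)"
proof -
  note L = source.circ_list[OF X] and r = rank_bounds[OF X(1,3)]
  show ?thesis
    unfolding source.circ_def target.circ_def N
    using F_lab[OF L(1), unfolded L(3), OF source.pcomp_part[OF r v w]] graded_map_pcomp[OF Fg r v w]
    by simp
qed

lemma F_fam:
  assumes f: "f \<in> tw_part P n d" and \<nu>: "length \<nu> = n" "distinct \<nu>" "set \<nu> \<subseteq> X" and X: "finite X"
  shows "F (card X) (source.fam f \<nu> X) = target.fam (Tw_map F n f) \<nu> X"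
proof -
  let ?L = "sorted_of (X - set \<nu>) @ \<nu>" and ?k = "card (X - set \<nu>)"
  have "distinct ?L" "set ?L = X" using \<nu> X by auto
  then have L: "distinct ?L" "length ?L = card X" "length ?L = ?k + n"
    using distinct_card[of ?L] \<nu>(1) by auto
  show ?thesis
    using F_lab[OF L(1), of "f ?k" "d - 2 * int ?k"] source.tw_partD(1)[OF f, of ?k] L(2,3)
    by (simp add: source.fam_def target.fam_def Tw_map_def)
qed

text \<open>
  As \<open>F\<close> commutes with labelling and composition, it carries every summand to the corresponding one.
\<close>
lemma Tw_map_dif:
  assumes f: "f \<in> tw_part P n d"
  shows "Tw_map F n (tw_dif P a n d f) = tw_dif Q b n d (Tw_map F n f)"
proof
  fix r
  let ?X = "{1..r + n}" and ?\<nu> = "[r + 1..<r + n + 1]" and ?g = "Tw_map F n f"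
  let ?e = "d - 2 * int (card (?X - set ?\<nu>))"
  have \<nu>: "length ?\<nu> = n" "distinct ?\<nu>" "set ?\<nu> \<subseteq> ?X" and X: "finite ?X" "0 \<notin> ?X" by auto
  note A = additive_F[of "card ?X" "?e + 1"] and sub = source.subgroup_part[of "card ?X" "?e + 1"]
  note fp = source.fam_part[OF f \<nu>(2,1) X(1) \<nu>(3)]
  note p1 = source.dif_part[OF fp] and p2 = source.rstar_part[OF f \<nu> X(1)]
    and p3 = source.lstar_part[OF f \<nu> X]
  have "F (card ?X) (source.rterm f ?\<nu> ?X S) = target.rterm ?g ?\<nu> ?X S"
    if S: "S \<in> contractions (set ?\<nu>) ?X" for S
  proof -
    note s = contractionsD[OF S X(1)] and q = quot_props[OF X(1) \<nu>(3) S]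
    show ?thesis
      unfolding source.rterm_def target.rterm_def
        F_circ[OF q(1) s(2) q(5,4) source.fam_part[OF f \<nu>(2,1) q(1,2)] source.a_part[OF s(7)] q(6)[symmetric]]
        F_fam[OF f \<nu>(1,2) q(2,1)] F_a[OF s(7)] ..
  qed
  moreover have "F (card ?X) (source.rstar f ?\<nu> ?X) =
      (\<Sum>S\<in>contractions (set ?\<nu>) ?X. F (card ?X) (source.rterm f ?\<nu> ?X S))"
    unfolding source.rstar_def by (rule additive_on_sum[OF A source.rterm_part[OF f \<nu> X(1)]])
  ultimately have e2: "F (card ?X) (source.rstar f ?\<nu> ?X) = target.rstar ?g ?\<nu> ?X"
    unfolding target.rstar_def by simp
  have "F (card ?X) (source.lterm f ?\<nu> ?X S) = target.lterm ?g ?\<nu> ?X S"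
    if S: "set ?\<nu> \<subseteq> S" "S \<subseteq> ?X" for S
  proof -
    let ?B = "?X - S \<union> {0}"
    have fS: "finite S" by (rule finite_subset[OF S(2) X(1)])
    have B: "finite ?B" "0 \<in> ?B" "S \<inter> (?B - {0}) = {}" by auto
    note c = split_card[OF X S]
    have k: "card ?B \<ge> 1" using c(2) by linarith
    show ?thesis
      unfolding source.lterm_def target.lterm_def c(2)[symmetric]
        F_circ[OF B(1) fS B(2,3) source.a_part[OF k] source.fam_part[OF f \<nu>(2,1) fS S(1)] c(1)[symmetric]]
        F_fam[OF f \<nu>(1,2) S(1) fS] F_a[OF k] ..
  qed
  moreover have "F (card ?X) (source.lstar f ?\<nu> ?X) =
      (\<Sum>S | set ?\<nu> \<subseteq> S \<and> S \<subseteq> ?X. F (card ?X) (source.lterm f ?\<nu> ?X S))"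
    unfolding source.lstar_def
    by (rule additive_on_sum[OF A]) (use source.lterm_part[OF f \<nu>(1,2) _ X] in blast)
  ultimately have e3: "F (card ?X) (source.lstar f ?\<nu> ?X) = target.lstar ?g ?\<nu> ?X"
    unfolding target.lstar_def by simp
  note p2' = subgroup_sgn_pow[OF sub p2, of d]
  have "Tw_map F n (tw_dif P a n d f) r = F (card ?X) (source.tw_dif_on d f ?\<nu> ?X)"
    unfolding Tw_map_def source.tw_dif_eq_tw_dif_on[OF f] by simp
  also have "\<dots> = target.tw_dif_on d ?g ?\<nu> ?X"
    unfolding source.tw_dif_on_def target.tw_dif_on_def
      additive_on_add[OF A subgroup_diff[OF sub p1 p2'] p3] additive_on_diff[OF A p1 p2']
      additive_on_sgn_pow[OF A p2] e2 e3 dg_map_dif[OF F fp] F_fam[OF f \<nu> X(1)] ..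
  also have "\<dots> = tw_dif Q b n d ?g r"
    by (rule target.tw_dif_eq_tw_dif_on[OF Tw_map_part[OF f], symmetric])
  finally show "Tw_map F n (tw_dif P a n d f) r = tw_dif Q b n d ?g r" .
qed

lemma Tw_cochain_map:
  "cochain_map (tw_part P n) (tw_dif P a n) (tw_part Q n) (tw_dif Q b n) (Tw_map F n)"
proof
  fix d
  show "additive_on (tw_part P n d) (tw_dif P a n d)" "additive_on (tw_part Q n d) (tw_dif Q b n d)"
    by (rule source.additive_tw_dif, rule target.additive_tw_dif)
  show "additive_on (tw_part P n d) (Tw_map F n)"
    unfolding additive_on_def
  proof (intro conjI ballI source.subgroup_tw_part ext)
    fix f g r assume f: "f \<in> tw_part P n d" and g: "g \<in> tw_part P n d"
    show "Tw_map F n (f + g) r = (Tw_map F n f + Tw_map F n g) r"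
      using additive_on_add[OF additive_F source.tw_partD(1)[OF f] source.tw_partD(1)[OF g]]
      by (simp add: Tw_map_def)
  qed
  fix f assume f: "f \<in> tw_part P n d"
  show "tw_dif P a n d f \<in> tw_part P n (d + 1)" by (rule source.tw_dif_part[OF f])
  show "Tw_map F n f \<in> tw_part Q n d" by (rule Tw_map_part[OF f])
  show "tw_dif P a n (d + 1) (tw_dif P a n d f) = 0"
    by (rule ext) (simp add: source.tw_dif_square[OF f])
  show "Tw_map F n (tw_dif P a n d f) = tw_dif Q b n d (Tw_map F n f)" by (rule Tw_map_dif[OF f])
next
  fix d f assume f: "f \<in> tw_part Q n d"
  show "tw_dif Q b n d f \<in> tw_part Q n (d + 1)" by (rule target.tw_dif_part[OF f])
  show "tw_dif Q b n (d + 1) (tw_dif Q b n d f) = 0"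
    by (rule ext) (simp add: target.tw_dif_square[OF f])
qed

lemma cone_acyclic_Tw:
  assumes "\<And>m. cone_acyclic (part P m) (dif P m) (part Q m) (dif Q m) (F m)"
  shows "cone_acyclic (tw_part P n) (tw_dif P a n) (tw_part Q n) (tw_dif Q b n) (Tw_map F n)"
proof -
  have eqP: "tw_part P n = (\<lambda>d. {f. \<forall>r. f r \<in> invariants P (r + n) r (d - 2 * int r)})"
    and eqQ: "tw_part Q n = (\<lambda>d. {f. \<forall>r. f r \<in> invariants Q (r + n) r (d - 2 * int r)})"
    by (rule ext, rule source.tw_part_invariants, rule ext, rule target.tw_part_invariants)
  have eqF: "Tw_map F n = (\<lambda>f r. F (r + n) (f r))" by (intro ext) (simp add: Tw_map_def)
  interpret filtered_cochain_map "\<lambda>r. invariants P (r + n) r" "\<lambda>r. dif P (r + n)"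
    "\<lambda>r. invariants Q (r + n) r" "\<lambda>r. dif Q (r + n)" "\<lambda>r. F (r + n)" "tw_dif P a n" "tw_dif Q b n"
  proof (rule filtered_cochain_map.intro)
    show "cochain_map (invariants P (r + n) r) (dif P (r + n)) (invariants Q (r + n) r) (dif Q (r + n)) (F (r + n))" for r
      by (rule invariants_cochain_map) simp
    show "cochain_map (\<lambda>d. {f. \<forall>r. f r \<in> invariants P (r + n) r (d - 2 * int r)}) (tw_dif P a n)
      (\<lambda>d. {f. \<forall>r. f r \<in> invariants Q (r + n) r (d - 2 * int r)}) (tw_dif Q b n) (\<lambda>f r. F (r + n) (f r))"
      using Tw_cochain_map[of n] unfolding eqP eqQ eqF .
  next
    fix f g :: "nat \<Rightarrow> 'a" and d r assume "\<And>s. s \<le> r \<Longrightarrow> f s = g s"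
    then show "tw_dif P a n d f r = tw_dif P a n d g r" by (rule source.tw_dif_local)
  next
    fix f g :: "nat \<Rightarrow> 'b" and d r assume "\<And>s. s \<le> r \<Longrightarrow> f s = g s"
    then show "tw_dif Q b n d f r = tw_dif Q b n d g r" by (rule target.tw_dif_local)
  next
    fix f d r assume f: "\<And>s. f s \<in> invariants P (s + n) s (d - 2 * int s)" and z: "\<And>s. s < r \<Longrightarrow> f s = 0"
    have "f \<in> tw_part P n d" unfolding eqP using f by simp
    from source.tw_dif_leading[OF this z]
    show "tw_dif P a n d f r = dif P (r + n) (d - 2 * int r) (f r)" .
  next
    fix f d r assume f: "\<And>s. f s \<in> invariants Q (s + n) s (d - 2 * int s)" and z: "\<And>s. s < r \<Longrightarrow> f s = 0"
    have "f \<in> tw_part Q n d" unfolding eqQ using f by simp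
    from target.tw_dif_leading[OF this z]
    show "tw_dif Q b n d f r = dif Q (r + n) (d - 2 * int r) (f r)" .
  qed
  show ?thesis
    unfolding eqP eqQ eqF by (rule cone_acyclic_total) (rule cone_acyclic_invariants[OF assms], simp)
qed

lemma Tw_dg_map: "dg_map (Tw P a) (Tw Q b) (Tw_map F)"
  unfolding dg_map_def graded_map_def
proof (intro conjI allI ballI impI)
  fix n d f assume "f \<in> part (Tw P a) n d"
  then have f: "f \<in> tw_part P n d" by (simp add: Tw_def)
  show "Tw_map F n f \<in> part (Tw Q b) n d" using Tw_map_part[OF f] by (simp add: Tw_def)
  show "Tw_map F n (dif (Tw P a) n d f) = dif (Tw Q b) n d (Tw_map F n f)"
    using Tw_map_dif[OF f] by (simp add: Tw_def)
  show "Tw_map F n (scl (Tw P a) c f) = scl (Tw Q b) c (Tw_map F n f)" for c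
    using graded_map_scl[OF Fg source.tw_partD(1)[OF f]] by (simp add: Tw_def Tw_map_def fun_eq_iff)
  show "Tw_map F n (act (Tw P a) n \<tau> f) = act (Tw Q b) n \<tau> (Tw_map F n f)" if \<tau>: "\<tau> permutes {1..n}" for \<tau>
  proof
    fix r
    let ?\<tau> = "\<lambda>j. if j \<le> r then j else r + \<tau> (j - r)"
    have "bij_betw ?\<tau> {1..r + n} {1..r + n}"
    proof (rule bij_betwI[where g = "\<lambda>j. if j \<le> r then j else r + inv \<tau> (j - r)"])
      have b: "\<tau> k \<in> {1..n}" "inv \<tau> k \<in> {1..n}" if "k \<in> {1..n}" for k
        using permutes_in_image[OF \<tau>, of k] permutes_in_image[OF permutes_inv[OF \<tau>], of k] that by simp_all
      have shift: "(\<lambda>j. if j \<le> r then j else r + \<rho> (j - r)) \<in> {1..r + n} \<rightarrow> {1..r + n}"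
        if \<rho>: "\<And>k. k \<in> {1..n} \<Longrightarrow> \<rho> k \<in> {1..n}" for \<rho> :: "nat \<Rightarrow> nat"
      proof
        fix j assume j: "j \<in> {1..r + n}"
        show "(if j \<le> r then j else r + \<rho> (j - r)) \<in> {1..r + n}"
        proof (cases "j \<le> r")
          case False
          then have "j - r \<in> {1..n}" using j by auto
          from \<rho>[OF this] show ?thesis using False by simp
        qed (use j in simp)
      qed
      show "?\<tau> \<in> {1..r + n} \<rightarrow> {1..r + n}" by (rule shift[OF b(1)])
      show "(\<lambda>j. if j \<le> r then j else r + inv \<tau> (j - r)) \<in> {1..r + n} \<rightarrow> {1..r + n}"
        by (rule shift[OF b(2)])
      fix x assume x: "x \<in> {1..r + n}"
      have "(\<lambda>j. if j \<le> r then j else r + inv \<tau> (j - r)) (?\<tau> x) = x \<and>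
        ?\<tau> ((\<lambda>j. if j \<le> r then j else r + inv \<tau> (j - r)) x) = x"
      proof (cases "x \<le> r")
        case False
        then have "x - r \<in> {1..n}" using x by auto
        from b[OF this] show ?thesis using False permutes_inverses[OF \<tau>] by simp
      qed simp
      then show "(\<lambda>j. if j \<le> r then j else r + inv \<tau> (j - r)) (?\<tau> x) = x"
        "?\<tau> ((\<lambda>j. if j \<le> r then j else r + inv \<tau> (j - r)) x) = x" by blast+
    qed
    then have "?\<tau> permutes {1..r + n}"
    proof (rule bij_imp_permutes)
      fix x assume "x \<notin> {1..r + n}"
      then have "x \<le> r \<or> x - r \<notin> {1..n} \<and> r + (x - r) = x" by auto
      then show "?\<tau> x = x" using permutes_not_in[OF \<tau>, of "x - r"] by auto
    qed
    from graded_map_act[OF Fg this source.tw_partD(1)[OF f]]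
    show "Tw_map F n (act (Tw P a) n \<tau> f) r = act (Tw Q b) n \<tau> (Tw_map F n f) r"
      by (simp add: Tw_def Tw_map_def tw_act_def)
  qed
  show "Tw_map F n (f + g) = Tw_map F n f + Tw_map F n g" if "g \<in> part (Tw P a) n d" for g
    using additive_on_add[OF cochain_map.additive_F[OF Tw_cochain_map], of f n d g] f that
    by (simp add: Tw_def)
  show "Tw_map F (n + m - 1) (pcomp (Tw P a) n m i f g) = pcomp (Tw Q b) n m i (Tw_map F n f) (Tw_map F m g)"
    if "i \<in> {1..n}" "g \<in> part (Tw P a) m e" for i m g e
  proof
    fix r
    have "g \<in> tw_part P m e" using that(2) by (simp add: Tw_def)
    from F_tw_pcomp[OF f this that(1), of r]
    show "Tw_map F (n + m - 1) (pcomp (Tw P a) n m i f g) r =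
        pcomp (Tw Q b) n m i (Tw_map F n f) (Tw_map F m g) r"
      by (simp add: Tw_def Tw_map_def)
  qed
next
  show "Tw_map F 1 (unt (Tw P a)) = unt (Tw Q b)"
  proof
    fix r
    have "F (r + 1) 0 = 0" by (rule additive_on_zero[OF additive_F])
    then show "Tw_map F 1 (unt (Tw P a)) r = unt (Tw Q b) r"
      using graded_map_unt[OF Fg] by (simp add: Tw_def Tw_map_def)
  qed
qed

end

section \<open>Twisting preserves quasi-isomorphisms\<close>

lemma bij_betw_cohomology_conv:
  "bij_betw (cohomology_map Q F n d) (cohomology P n d) (cohomology Q n d) \<longleftrightarrow>
   bij_betw (\<lambda>X. cohomologous_in (part Q n) (dif Q n) d `` (F n ` X))
     ({x \<in> part P n d. dif P n d x = 0} // cohomologous_in (part P n) (dif P n) d)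
     ({y \<in> part Q n d. dif Q n d y = 0} // cohomologous_in (part Q n) (dif Q n) d)"
  by (simp add: cohomology_map_def[abs_def] cohomology_def cohomologous_def cohomologous_in_def cocycles_def coboundaries_def)

lemma (in mc_operad_map) quasi_iso_Tw:
  assumes "quasi_iso P Q F"
  shows "quasi_iso (Tw P a) (Tw Q b) (Tw_map F)"
proof -
  have "cone_acyclic (part P m) (dif P m) (part Q m) (dif Q m) (F m)" for m
    using assms cochain_map.cone_acyclic_iff[OF full_cochain_map]
      cochain_map.bij_betw_cohomology_iff[OF full_cochain_map]
    unfolding quasi_iso_def bij_betw_cohomology_conv by blast
  from cone_acyclic_Tw[OF this]
  have "bij_betw (cohomology_map (Tw Q b) (Tw_map F) n d) (cohomology (Tw P a) n d) (cohomology (Tw Q b) n d)" for n d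
    using cochain_map.cone_acyclic_iff[OF Tw_cochain_map, of n]
      cochain_map.bij_betw_cohomology_iff[OF Tw_cochain_map, of n d]
    unfolding bij_betw_cohomology_conv by (simp add: Tw_def)
  then show ?thesis using Tw_dg_map by (simp add: quasi_iso_def)
qed

text \<open>
  The summands for \<open>p = 1\<close> and \<open>p = k\<close>, which are absent from the differential of the generators, vanish
  because they contain \<open>a 1\<close>.
\<close>
lemma mc_operad_lie_elems:
  assumes L: "is_LambdaLie_inf L lam" and u: "under_object L P \<phi>"
  shows "mc_operad P (lie_elems lam \<phi>)"
proof -
  interpret dg_operad P using u by (simp add: under_object_def)
  interpret L: dg_operad L using L by (simp add: is_LambdaLie_inf_def)
  have \<phi>: "dg_map L P \<phi>" using u by (simp add: under_object_def)
  note \<phi>g = dg_map_graded[OF \<phi>]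
  interpret phi: dg_operad_map L P \<phi> by unfold_locales (rule \<phi>)
  let ?a = "lie_elems lam \<phi>"
  have lam: "lam k \<in> part L k (3 - 2 * int k)" "\<sigma> permutes {1..k} \<Longrightarrow> act L k \<sigma> (lam k) = lam k"
    if "k \<ge> 2" for k \<sigma>
    using L that by (auto simp: is_LambdaLie_inf_def lie_family_def)
  have dlam: "dif L k (3 - 2 * int k) (lam k) = - (\<Sum>p = 2..k - 1. \<Sum>\<sigma>\<in>Sh p (k - p).
          act L k \<sigma> (pcomp L (k - p + 1) p 1 (lam (k - p + 1)) (lam p)))" if "k \<ge> 2" for k
    using L that by (simp add: is_LambdaLie_inf_def)
  have part: "?a k \<in> part P k (3 - 2 * int k)" for k
    using graded_map_part[OF \<phi>g lam(1)] subgroup_zero[OF subgroup_part] by (simp add: lie_elems_def)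
  have perm: "\<sigma> permutes {1..k}" if "\<sigma> \<in> Sh p (k - p)" "p \<le> k" for \<sigma> p k
    using that by (simp add: Sh_def)
  show ?thesis
  proof
    fix k :: nat assume k: "k \<ge> 1"
    show "?a k \<in> part P k (3 - 2 * int k)" by (rule part)
    show "act P k \<sigma> (?a k) = ?a k" if \<sigma>: "\<sigma> permutes {1..k}" for \<sigma>
      using graded_map_act[OF \<phi>g \<sigma> lam(1)] lam(2)[OF _ \<sigma>] additive_on_zero[OF additive_act[OF \<sigma>]]
      by (auto simp: lie_elems_def)
    let ?t = "\<lambda>p. \<Sum>\<sigma>\<in>Sh p (k - p). act P k \<sigma> (pcomp P (k - p + 1) p 1 (?a (k - p + 1)) (?a p))"
    have t0: "?t p = 0" if p: "p \<in> {1..k}" "p = 1 \<or> p = k" for p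
    proof (intro sum.neutral ballI)
      fix \<sigma> assume \<sigma>: "\<sigma> \<in> Sh p (k - p)"
      have i: "1 \<in> {1..k - p + 1}" by simp
      have "pcomp P (k - p + 1) p 1 (?a (k - p + 1)) (?a p) = 0"
        using p(2)
      proof
        assume "p = 1"
        then have "?a p = 0" by (simp add: lie_elems_def)
        then show ?thesis using pcomp_zero(2)[OF i part] by simp
      next
        assume "p = k"
        then have "?a (k - p + 1) = 0" by (simp add: lie_elems_def)
        then show ?thesis using pcomp_zero(1)[OF i part] by simp
      qed
      then show "act P k \<sigma> (pcomp P (k - p + 1) p 1 (?a (k - p + 1)) (?a p)) = 0"
      proof -
        have "\<sigma> permutes {1..k}" by (rule perm[OF \<sigma>]) (use p in simp)
        from additive_on_zero[OF additive_act[OF this]]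
        show ?thesis using \<open>pcomp P (k - p + 1) p 1 (?a (k - p + 1)) (?a p) = 0\<close> by simp
      qed
    qed
    show "dif P k (3 - 2 * int k) (?a k) = - (\<Sum>p = 1..k. ?t p)"
    proof (cases "k = 1")
      case True
      then show ?thesis
        using t0[of 1] additive_on_zero[OF additive_dif] by (simp add: lie_elems_def)
    next
      case False
      then have k2: "k \<ge> 2" using k by simp
      let ?s = "\<lambda>p \<sigma>. act L k \<sigma> (pcomp L (k - p + 1) p 1 (lam (k - p + 1)) (lam p))"
      have pc: "pcomp L (k - p + 1) p 1 (lam (k - p + 1)) (lam p) \<in> part L k (4 - 2 * int k)"
        if p: "p \<in> {2..k - 1}" for p
      proof -
        have "pcomp L (k - p + 1) p 1 (lam (k - p + 1)) (lam p) \<in>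
          part L (k - p + 1 + p - 1) (3 - 2 * int (k - p + 1) + (3 - 2 * int p))"
          using p by (intro L.pcomp_part lam(1)) auto
        moreover have "k - p + 1 + p - 1 = k" "3 - 2 * int (k - p + 1) + (3 - 2 * int p) = 4 - 2 * int k"
          using p by (auto simp: of_nat_diff)
        ultimately show ?thesis by (simp only:)
      qed
      have sp: "?s p \<sigma> \<in> part L k (4 - 2 * int k)" if "p \<in> {2..k - 1}" "\<sigma> \<in> Sh p (k - p)" for p \<sigma>
        using that by (intro L.act_part pc perm) auto
      note sp' = subgroup_sum[OF L.subgroup_part sp]
      have "dif P k (3 - 2 * int k) (?a k) = \<phi> k (dif L k (3 - 2 * int k) (lam k))"
        using dg_map_dif[OF \<phi> lam(1)[OF k2]] k2 by (simp add: lie_elems_def)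
      also have "\<dots> = - \<phi> k (\<Sum>p = 2..k - 1. \<Sum>\<sigma>\<in>Sh p (k - p). ?s p \<sigma>)"
        unfolding dlam[OF k2]
        by (rule additive_on_minus[OF phi.additive_F subgroup_sum[OF L.subgroup_part sp']])
      also have "\<phi> k (\<Sum>p = 2..k - 1. \<Sum>\<sigma>\<in>Sh p (k - p). ?s p \<sigma>) = (\<Sum>p = 2..k - 1. \<phi> k (\<Sum>\<sigma>\<in>Sh p (k - p). ?s p \<sigma>))"
        by (rule additive_on_sum[OF phi.additive_F sp'])
      also have "\<dots> = (\<Sum>p = 2..k - 1. \<Sum>\<sigma>\<in>Sh p (k - p). \<phi> k (?s p \<sigma>))"
        by (intro sum.cong refl additive_on_sum[OF phi.additive_F sp])
      also have "\<dots> = (\<Sum>p = 2..k - 1. ?t p)"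
      proof (intro sum.cong refl)
        fix p \<sigma> assume p: "p \<in> {2..k - 1}" and \<sigma>: "\<sigma> \<in> Sh p (k - p)"
        have s: "\<sigma> permutes {1..k}" by (rule perm[OF \<sigma>]) (use p in auto)
        have kp: "k - p + 1 \<ge> 2" "p \<ge> 2" using p by auto
        have "\<phi> k (?s p \<sigma>) = act P k \<sigma> (\<phi> k (pcomp L (k - p + 1) p 1 (lam (k - p + 1)) (lam p)))"
          by (rule graded_map_act[OF \<phi>g s pc[OF p]])
        also have "\<phi> k (pcomp L (k - p + 1) p 1 (lam (k - p + 1)) (lam p)) =
            \<phi> (k - p + 1 + p - 1) (pcomp L (k - p + 1) p 1 (lam (k - p + 1)) (lam p))"
        proof -
          have "k = k - p + 1 + p - 1" using p by auto
          then show ?thesis by (rule arg_cong[where f = "\<lambda>j. \<phi> j _"])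
        qed
        also have "\<dots> = pcomp P (k - p + 1) p 1 (\<phi> (k - p + 1) (lam (k - p + 1))) (\<phi> p (lam p))"
          by (rule graded_map_pcomp[OF \<phi>g _ lam(1)[OF kp(1)] lam(1)[OF kp(2)]]) simp
        finally show "\<phi> k (?s p \<sigma>) = act P k \<sigma> (pcomp P (k - p + 1) p 1 (?a (k - p + 1)) (?a p))"
          using kp by (simp only: lie_elems_def if_True)
      qed
      also have "\<dots> = (\<Sum>p = 1..k. ?t p)"
      proof (rule sum.mono_neutral_left)
        show "\<forall>p\<in>{1..k} - {2..k - 1}. ?t p = 0"
        proof
          fix p assume "p \<in> {1..k} - {2..k - 1}"
          then show "?t p = 0" by (intro t0) auto
        qed
      qed auto
      finally show ?thesis .
    qed
  next
    show "?a 1 = 0" by (simp add: lie_elems_def)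
  qed
qed

theorem theorem5p1:
  fixes L :: "('k :: field_char_0, 'l :: ab_group_add) dgoperad"
    and lam :: "nat \<Rightarrow> 'l"
    and P :: "('k, 'a :: ab_group_add) dgoperad" and \<phi> :: "nat \<Rightarrow> 'l \<Rightarrow> 'a"
    and Q :: "('k, 'b :: ab_group_add) dgoperad" and \<psi> :: "nat \<Rightarrow> 'l \<Rightarrow> 'b"
    and F :: "nat \<Rightarrow> 'a \<Rightarrow> 'b"
  assumes "is_LambdaLie_inf L lam"
    and "under_morphism L P \<phi> Q \<psi> F"
    and "quasi_iso P Q F"
  shows "quasi_iso (Tw P (lie_elems lam \<phi>)) (Tw Q (lie_elems lam \<psi>)) (Tw_map F)"
proof -
  have u: "under_object L P \<phi>" "under_object L Q \<psi>" "dg_map P Q F"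
    and F\<phi>: "\<And>n d x. x \<in> part L n d \<Longrightarrow> F n (\<phi> n x) = \<psi> n x"
    using assms(2) unfolding under_morphism_def by blast+
  interpret source: mc_operad P "lie_elems lam \<phi>" by (rule mc_operad_lie_elems[OF assms(1) u(1)])
  interpret target: mc_operad Q "lie_elems lam \<psi>" by (rule mc_operad_lie_elems[OF assms(1) u(2)])
  interpret dg_operad_map P Q F by unfold_locales (rule u(3))
  interpret mc_operad_map P Q F "lie_elems lam \<phi>" "lie_elems lam \<psi>"
  proof
    fix k :: nat
    have "lam k \<in> part L k (3 - 2 * int k)" if "k \<ge> 2"
      using assms(1) that by (simp add: is_LambdaLie_inf_def lie_family_def)
    then show "F k (lie_elems lam \<phi> k) = lie_elems lam \<psi> k"
      using F\<phi>[of "lam k" k "3 - 2 * int k"] additive_on_zero[OF additive_F]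
      by (simp add: lie_elems_def)
  qed
  show ?thesis by (rule quasi_iso_Tw[OF assms(3)])
qed

end
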